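(* Let $X=(X_0,\ldots,X_d)$ and $Y=(Y_0,\ldots,Y_d)$ be random vectors such that $X_1,\ldots,X_d$ are conditionally independent given $X_0$ and $Y_1,\ldots,Y_d$ are conditionally independent given $Y_0$, with $X_0$ and $Y_0$ equal in distribution. Assume for all $i\in\{1,\ldots,d\}$ that (i) $Y_i\uparrow_{st}Y_0$, (ii) $(X_i|X_0)\leq_S(Y_i|Y_0)$. Then $X\leq_{sm}Y$. In particular, $Y$ is PSMD.
   Context: "Increasing" means non-decreasing. $V\uparrow_{st}U$ means that $\mathbb E[f(V)\mid U=u]$ is increasing in $u$ outside a $P^U$-null set, for all increasing $f:\mathbb R\to\mathbb R$ such that the expectations exist. Schur order. For integrable $h:(0,1)\to\mathbb R$, $h^*$ denotes its decreasing rearrangement, i.e. the essentially unique decreasing function with $\lambda(h^*\ge w)=\lambda(h\ge w)$ for all $w\in\mathbb R$ ($\lambda$ is Lebesgue measure on $(0,1)$). For integrable $f,g:(0,1)\to\mathbb R$, $f\prec_Sg$ means $\int_0^xf^*\,d\lambda\le\int_0^xg^*\,d\lambda$ for all $x\in(0,1)$ and $\int_0^1f^*\,d\lambda=\int_0^1g^*\,d\lambda$. Let $q_W(t)=\inf\{x\in\mathbb R:F_W(x)\ge t\}$, $t\in(0,1)$, be the quantile function of $W$. For bivariate random vectors $(U,V)$ and $(U',V')$ with $V$ and $V'$ equal in distribution, the Schur order for conditional distributions $(V|U)\leq_S(V'|U')$ means that $F_{V|U=q_U(\cdot)}(v)\prec_SF_{V'|U'=q_{U'}(\cdot)}(v)$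 for all $v\in\mathbb R$, where $F_{V|U=u}(v)=P(V\le v\mid U=u)$. Thus $(X_i|X_0)\leq_S(Y_i|Y_0)$ includes that $X_i$ and $Y_i$ have the same distribution. Supermodular order. $f:\mathbb R^m\to\mathbb R$ is supermodular if $f(x)+f(y)\le f(x\wedge y)+f(x\vee y)$ for all $x,y$ (componentwise minimum and maximum). A measurable weight function $b:\mathbb R^m\to[1,\infty)$ is fixed (e.g. $b(x)=\max\{1,\|x\|^p\}$); random vectors are assumed $b$-integrable, and test functions are measurable and $b$-bounded ($\sup_x|f(x)|/b(x)<\infty$). $V\leq_{sm}W$ means $\mathbb Ef(V)\le\mathbb Ef(W)$ for all $b$-bounded supermodular $f$. $V$ is positive supermodular dependent (PSMD) if $V^\perp\leq_{sm}V$, where $V^\perp$ has independent components with the same univariate marginals as $V$.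
   Formalization: Besides X and Y, the vector Y^⊥ with independent components is also assumed b-integrable; PSMD needs this to be defined, and X ≤_sm Y can fail without it for a general weight b. It is automatic for b(x)=max{1,‖x‖^p}. *)

theory Defs
  imports "HOL-Probability.Probability"
begin

section \<open>Random vectors indexed by \<open>0, \<dots>, d\<close>\<close>

abbreviation vec_space :: "nat \<Rightarrow> (nat \<Rightarrow> real) measure" where
  "vec_space d \<equiv> \<Pi>\<^sub>M i\<in>{0..d}. borel"

definition law :: "nat \<Rightarrow> 'a measure \<Rightarrow> (nat \<Rightarrow> 'a \<Rightarrow> real) \<Rightarrow> (nat \<Rightarrow> real) measure" where
  "law d M X = distr M (vec_space d) (\<lambda>\<omega>. \<lambda>i\<in>{0..d}. X i \<omega>)"

text \<open>The law of \<open>X\<^sup>\<bottom>\<close>: independent components with the same univariate marginals as \<open>X\<close>.\<close>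

definition indep_law :: "nat \<Rightarrow> 'a measure \<Rightarrow> (nat \<Rightarrow> 'a \<Rightarrow> real) \<Rightarrow> (nat \<Rightarrow> real) measure" where
  "indep_law d M X = (\<Pi>\<^sub>M i\<in>{0..d}. distr M borel (X i))"


section \<open>Conditioning on a real random variable\<close>

abbreviation sigma_gen :: "'a measure \<Rightarrow> ('a \<Rightarrow> real) \<Rightarrow> 'a measure" where
  "sigma_gen M U \<equiv> vimage_algebra (space M) U borel"

text \<open>
  \<open>cond_exp_at M Z U u\<close> is \<open>E[Z | U = u]\<close>: a Borel function \<open>g\<close> with \<open>E[Z | \<sigma>(U)] = g \<circ> U\<close> almost
  surely, which is unique up to null sets of the law of \<open>U\<close>. All uses below are
  insensitive to the choice of the version.
\<close>

definition cond_exp_at :: "'a measure \<Rightarrow> ('a \<Rightarrow> real) \<Rightarrow> ('a \<Rightarrow> real) \<Rightarrow> real \<Rightarrow> real" where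
  "cond_exp_at M Z U = (SOME g. g \<in> borel_measurable borel \<and>
     (AE \<omega> in M. g (U \<omega>) = real_cond_exp M (sigma_gen M U) Z \<omega>))"

lemma borel_measurable_vimage_factor_nonneg:
  fixes f :: "'a \<Rightarrow> real" and U :: "'a \<Rightarrow> real"
  assumes "f \<in> borel_measurable (vimage_algebra S U borel)" and "\<And>x. 0 \<le> f x"
  shows "\<exists>g\<in>borel_measurable borel. \<forall>x\<in>S. f x = g (U x)"
  using assms
proof (induction rule: borel_measurable_induct_real)
  case (set A)
  then obtain B where "B \<in> sets borel" "A = U -` B \<inter> S"
    by (auto simp: sets_vimage_algebra2)
  then show ?case
    by (intro bexI[of _ "indicator B"]) (auto simp: indicator_def)
next
  case (mult u c)
  then obtain g where "g \<in> borel_measurable borel" "\<forall>x\<in>S. u x = g (U x)" by blast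
  then show ?case
    by (intro bexI[of _ "\<lambda>x. c * g x"]) auto
next
  case (add u v)
  then obtain g h where "g \<in> borel_measurable borel" "\<forall>x\<in>S. u x = g (U x)"
    "h \<in> borel_measurable borel" "\<forall>x\<in>S. v x = h (U x)" by blast
  then show ?case
    by (intro bexI[of _ "\<lambda>x. h x + g x"]) auto
next
  case (seq F)
  then obtain g where g: "\<And>i. g i \<in> borel_measurable borel" "\<And>i. \<forall>x\<in>S. F i x = g i (U x)"
    unfolding Bex_def by metis
  have "f x = lim (\<lambda>i. g i (U x))" if "x \<in> S" for x
  proof -
    have "(\<lambda>i. F i x) \<longlonglongrightarrow> f x" using seq that by simp
    with g(2) that show ?thesis by (simp add: limI)
  qed
  with g(1) show ?case
    by (intro bexI[of _ "\<lambda>u. lim (\<lambda>i. g i u)"]) auto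
qed

lemma cond_exp_at_version:
  shows "cond_exp_at M Z U \<in> borel_measurable borel"
    and "AE \<omega> in M. cond_exp_at M Z U (U \<omega>) = real_cond_exp M (sigma_gen M U) Z \<omega>"
proof -
  let ?c = "real_cond_exp M (sigma_gen M U) Z"
  have c: "?c \<in> borel_measurable (sigma_gen M U)" by simp
  have "(\<lambda>x. max 0 (?c x)) \<in> borel_measurable (sigma_gen M U)"
       "(\<lambda>x. max 0 (- ?c x)) \<in> borel_measurable (sigma_gen M U)"
    using c by simp_all
  then obtain g h where
    gh: "g \<in> borel_measurable borel" "\<forall>x\<in>space M. max 0 (?c x) = g (U x)"
        "h \<in> borel_measurable borel" "\<forall>x\<in>space M. max 0 (- ?c x) = h (U x)"
    using borel_measurable_vimage_factor_nonneg[of "\<lambda>x. max 0 (?c x)" "space M" U]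
      borel_measurable_vimage_factor_nonneg[of "\<lambda>x. max 0 (- ?c x)" "space M" U]
    by auto
  then have "g (U x) - h (U x) = ?c x" if "x \<in> space M" for x
    using that by (simp flip: gh(2) gh(4) add: max_def)
  with gh have "\<exists>g. g \<in> borel_measurable borel \<and> (AE \<omega> in M. g (U \<omega>) = ?c \<omega>)"
    by (intro exI[of _ "\<lambda>u. g u - h u"]) auto
  from someI_ex[OF this]
  show "cond_exp_at M Z U \<in> borel_measurable borel"
    and "AE \<omega> in M. cond_exp_at M Z U (U \<omega>) = ?c \<omega>"
    unfolding cond_exp_at_def by auto
qed

text \<open>\<open>cond_cdf M V U v u = P(V \<le> v | U = u)\<close>\<close>

definition cond_cdf :: "'a measure \<Rightarrow> ('a \<Rightarrow> real) \<Rightarrow> ('a \<Rightarrow> real) \<Rightarrow> real \<Rightarrow> real \<Rightarrow> real" where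
  "cond_cdf M V U v = cond_exp_at M (indicator {\<omega>\<in>space M. V \<omega> \<le> v}) U"

text \<open>
  Conditional independence of the family \<open>(X i)\<close>, \<open>i \<in> I\<close>, given \<open>U\<close>, for finite \<open>I\<close>.
  Subfamilies are covered by taking \<open>A i = UNIV\<close>.
\<close>

definition cond_indep ::
    "'a measure \<Rightarrow> ('a \<Rightarrow> real) \<Rightarrow> (nat \<Rightarrow> 'a \<Rightarrow> real) \<Rightarrow> nat set \<Rightarrow> bool" where
  "cond_indep M U X I \<longleftrightarrow>
     (\<forall>A. (\<forall>i\<in>I. A i \<in> sets borel) \<longrightarrow>
       (AE \<omega> in M.
          real_cond_exp M (sigma_gen M U) (indicator {\<omega>\<in>space M. \<forall>i\<in>I. X i \<omega> \<in> A i}) \<omega> =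
          (\<Prod>i\<in>I. real_cond_exp M (sigma_gen M U) (indicator {\<omega>\<in>space M. X i \<omega> \<in> A i}) \<omega>)))"

text \<open>\<open>V \<up>\<^sub>s\<^sub>t U\<close>\<close>

definition st_increasing :: "'a measure \<Rightarrow> ('a \<Rightarrow> real) \<Rightarrow> ('a \<Rightarrow> real) \<Rightarrow> bool" where
  "st_increasing M V U \<longleftrightarrow>
     (\<forall>f::real \<Rightarrow> real. mono f \<longrightarrow> integrable M (\<lambda>\<omega>. f (V \<omega>)) \<longrightarrow>
       (\<exists>N\<in>null_sets (distr M borel U). mono_on (- N) (cond_exp_at M (\<lambda>\<omega>. f (V \<omega>)) U)))"


section \<open>Schur order\<close>

definition is_decr_rearrangement :: "(real \<Rightarrow> real) \<Rightarrow> (real \<Rightarrow> real) \<Rightarrow> bool" where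
  "is_decr_rearrangement h g \<longleftrightarrow>
     antimono_on {0<..<1} g \<and>
     (\<forall>w. measure lborel {t\<in>{0<..<1}. g t \<ge> w} = measure lborel {t\<in>{0<..<1}. h t \<ge> w})"

definition decr_rearrangement :: "(real \<Rightarrow> real) \<Rightarrow> real \<Rightarrow> real" where
  "decr_rearrangement h = (SOME g. is_decr_rearrangement h g)"

lemma is_decr_rearrangement_decr_rearrangement:
  assumes h: "set_integrable lborel {0<..<1} h"
  shows "is_decr_rearrangement h (decr_rearrangement h)"
proof -
  let ?L = "restrict_space lborel {0<..<1::real}"
  interpret L: prob_space ?L
    by (auto simp: emeasure_restrict_space space_restrict_space intro!: prob_spaceI)
  have hm: "h \<in> borel_measurable ?L"
    using borel_measurable_integrable[OF h[unfolded set_integrable_def]]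
    by (simp add: borel_measurable_restrict_space_iff)
  define \<mu> where "\<mu> = distr ?L borel (\<lambda>t. - h t)"
  interpret cdf_distribution \<mu>
    unfolding \<mu>_def cdf_distribution_def using hm by (intro L.real_distribution_distr) auto
  have C: "C x = measure lborel {t\<in>{0<..<1}. h t \<ge> - x}" for x
  proof -
    have "C x = measure ?L {t\<in>{0<..<1}. h t \<ge> - x}"
      using hm unfolding \<mu>_def cdf_def
      by (subst measure_distr)
         (auto simp: space_restrict_space intro!: arg_cong2[where f=measure])
    also have "\<dots> = measure lborel {t\<in>{0<..<1}. h t \<ge> - x}"
      by (subst measure_restrict_space) auto
    finally show ?thesis .
  qed
  have "is_decr_rearrangement h (\<lambda>t. - I t)"
    unfolding is_decr_rearrangement_def
  proof (intro conjI allI)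
    show "antimono_on {0<..<1} (\<lambda>t. - I t)"
      using mono_I by (auto simp: monotone_on_def)
    fix w
    have "measure lborel {t\<in>{0<..<1}. - I t \<ge> w} = measure lborel {t\<in>{0<..<1}. t \<le> C (- w)}"
    proof -
      have "- I t \<ge> w \<longleftrightarrow> t \<le> C (- w)" if "t \<in> {0<..<1}" for t
        using pseudoinverse[of t "- w"] that by (metis greaterThanLessThan_iff le_minus_iff)
      then show ?thesis by (metis (no_types, lifting))
    qed
    also have "\<dots> = measure lborel {0<..<C (- w)}"
      using cdf_bounded_prob[of "- w"] AE_lborel_singleton[of "C (- w)"]
      by (auto intro!: arg_cong[where f=enn2real] emeasure_eq_AE simp: measure_def)
    also have "\<dots> = C (- w)" by (simp add: cdf_nonneg)
    finally show "measure lborel {t\<in>{0<..<1}. - I t \<ge> w} = measure lborel {t\<in>{0<..<1}. h t \<ge> w}"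
      by (simp add: C)
  qed
  then show ?thesis
    unfolding decr_rearrangement_def by (rule someI[of "is_decr_rearrangement h"])
qed

definition schur_le :: "(real \<Rightarrow> real) \<Rightarrow> (real \<Rightarrow> real) \<Rightarrow> bool" where
  "schur_le f g \<longleftrightarrow>
     set_integrable lborel {0<..<1} f \<and> set_integrable lborel {0<..<1} g \<and>
     (\<forall>x\<in>{0<..<1}. (LINT t:{0<..<x}|lborel. decr_rearrangement f t)
                      \<le> (LINT t:{0<..<x}|lborel. decr_rearrangement g t)) \<and>
     (LINT t:{0<..<1}|lborel. decr_rearrangement f t)
       = (LINT t:{0<..<1}|lborel. decr_rearrangement g t)"

definition quantile :: "'a measure \<Rightarrow> ('a \<Rightarrow> real) \<Rightarrow> real \<Rightarrow> real" where
  "quantile M W t = Inf {x. t \<le> cdf (distr M borel W) x}"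

text \<open>\<open>cond_schur_le M V U M' V' U'\<close> is \<open>(V | U) \<le>\<^sub>S (V' | U')\<close>.\<close>

definition cond_schur_le ::
    "'a measure \<Rightarrow> ('a \<Rightarrow> real) \<Rightarrow> ('a \<Rightarrow> real) \<Rightarrow>
     'b measure \<Rightarrow> ('b \<Rightarrow> real) \<Rightarrow> ('b \<Rightarrow> real) \<Rightarrow> bool" where
  "cond_schur_le M V U M' V' U' \<longleftrightarrow>
     distr M borel V = distr M' borel V' \<and>
     (\<forall>v. schur_le (\<lambda>t. cond_cdf M V U v (quantile M U t))
                   (\<lambda>t. cond_cdf M' V' U' v (quantile M' U' t)))"


section \<open>Supermodular order\<close>

text \<open>
  Real vectors with indices \<open>0, \<dots>, d\<close> are functions that are \<open>undefined\<close> off \<open>{0..d}\<close>; this set is closed under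
  the pointwise \<open>inf\<close> and \<open>sup\<close>, which are the componentwise minimum and maximum.
\<close>

definition supermodular :: "nat \<Rightarrow> ((nat \<Rightarrow> real) \<Rightarrow> real) \<Rightarrow> bool" where
  "supermodular d f \<longleftrightarrow>
     (\<forall>x\<in>space (vec_space d). \<forall>y\<in>space (vec_space d). f x + f y \<le> f (inf x y) + f (sup x y))"

definition weight_function :: "nat \<Rightarrow> ((nat \<Rightarrow> real) \<Rightarrow> real) \<Rightarrow> bool" where
  "weight_function d b \<longleftrightarrow>
     b \<in> borel_measurable (vec_space d) \<and> (\<forall>x\<in>space (vec_space d). 1 \<le> b x)"

definition weight_bounded ::
    "nat \<Rightarrow> ((nat \<Rightarrow> real) \<Rightarrow> real) \<Rightarrow> ((nat \<Rightarrow> real) \<Rightarrow> real) \<Rightarrow> bool" where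
  "weight_bounded d b f \<longleftrightarrow> bdd_above ((\<lambda>x. \<bar>f x\<bar> / b x) ` space (vec_space d))"

text \<open>The supermodular order on laws; its domain is the class of \<open>b\<close>-integrable laws.\<close>

definition sm_le ::
    "nat \<Rightarrow> ((nat \<Rightarrow> real) \<Rightarrow> real) \<Rightarrow> (nat \<Rightarrow> real) measure \<Rightarrow> (nat \<Rightarrow> real) measure \<Rightarrow> bool" where
  "sm_le d b P Q \<longleftrightarrow>
     integrable P b \<and> integrable Q b \<and>
     (\<forall>f. f \<in> borel_measurable (vec_space d) \<longrightarrow> weight_bounded d b f \<longrightarrow> supermodular d f \<longrightarrow>
        (LINT x|P. f x) \<le> (LINT x|Q. f x))"

definition PSMD ::
    "nat \<Rightarrow> ((nat \<Rightarrow> real) \<Rightarrow> real) \<Rightarrow> 'a measure \<Rightarrow> (nat \<Rightarrow> 'a \<Rightarrow> real) \<Rightarrow> bool" where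
  "PSMD d b M V \<longleftrightarrow> sm_le d b (indep_law d M V) (law d M V)"

end

theory Submission
  imports Defs
begin

text \<open>
  Suppose first that every component takes finitely many values. Let \<open>T\<close> and \<open>W\<^sub>1, \<dots>, W\<^sub>d\<close> be
  independent and uniform on \<open>(0, 1)\<close>, write \<open>X\<^sub>0\<close> as a quantile transform of \<open>T\<close>, and write \<open>X\<^sub>i\<close> as
  the conditional quantile transform of \<open>W\<^sub>i\<close> given \<open>T\<close>. For fixed \<open>w\<close> the components are functions of
  \<open>T\<close>, and rearranging all of them increasingly raises the expectation of a supermodular function,
  because a comonotone vector admits dual potentials along a finite chain. Averaged over \<open>w\<close>, this
  replaces the conditional distribution functions by their decreasing rearrangements in \<open>T\<close>, and
  leaves \<open>Y\<close> unchanged since \<open>Y\<^sub>i \<up>\<^sub>s\<^sub>t Y\<^sub>0\<close>. The rearranged \<open>X\<^sub>i\<close> can now be exchanged for \<open>Y\<^sub>i\<close> one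
  at a time: the expectation is linear in each conditional distribution function, with weights that
  are monotone in \<open>T\<close>, so the Schur order applies.

  For general components, a supermodular function that is truncated to a box has a modulus of
  continuity \<open>\<Sum>\<^sub>i |V\<^sub>i(x\<^sub>i) - V\<^sub>i(y\<^sub>i)|\<close> with bounded increasing \<open>V\<^sub>i\<close>, hence is a uniform limit of
  functions that depend on finitely many levels. To remove the truncation, subtract functions of one
  variable so that the test function \<open>F\<close> vanishes on the axes through a point \<open>a\<close>. Then
  \<open>F(x \<or> a)\<close>, \<open>F(x \<and> a)\<close> and the remaining mixed part all shrink under truncation, and they are
  integrable because \<open>Y\<close> is associated. So dominated convergence applies without any condition on
  the weight function.
\<close>

section \<open>Comonotone rearrangement on a finite grid\<close>

text \<open>\<open>X\<close> is rearranged before any exchange because the weight attached to one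
  conditional distribution function is an increment of the test function with the other components
  frozen as functions of T. Supermodularity makes this increasing in T only if those components
  increase in T. Versions of conditional probabilities are fixed set by set, so a finite grid also
  allows the exceptional null sets to be united.

  The independent law enters as a third law, not only for PSMD. Its conditional distribution
  functions are constant, and constants are Schur-minimal for a given integral, so the argument for
  \<open>X\<close> applies to it. Tested on indicators of orthants at a, which are supermodular, it
  shows that these orthants have positive probability under \<open>Y\<close>; association then
  bounds the integrals of the truncated F(x \<or> a) and F(x \<and> a) uniformly. The point a is
  found by Fubini under the independent law: almost every a has integrable sections through it and
  positive mass on both closed half-lines in each coordinate.\<close>

abbreviation U01 :: "real measure" where
  "U01 \<equiv> restrict_space lborel {0<..<1}"

lemma prob_space_unit_interval: "prob_space U01"
  by (auto simp: emeasure_restrict_space space_restrict_space intro!: prob_spaceI)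

definition nat_supermodular :: "((nat \<Rightarrow> nat) \<Rightarrow> real) \<Rightarrow> bool" where
  "nat_supermodular g \<longleftrightarrow> (\<forall>x y. g x + g y \<le> g (inf x y) + g (sup x y))"

text \<open>Above the old value \<open>x i\<close> the potential of coordinate \<open>i\<close>
  grows by the increment of \<open>g\<close> along the edge leaving \<open>x\<close>. Since
  \<open>g y + g x \<le> g (inf y x) + g (sup y x)\<close>, the bound at \<open>inf y x\<close>
  carries over to \<open>y\<close>. At or below \<open>x i\<close> nothing changes, so equality
  survives on \<open>C\<close>, which will hold the earlier points of the chain.\<close>

lemma potential_raise_coordinate:
  fixes g :: "(nat \<Rightarrow> nat) \<Rightarrow> real"
  assumes g: "nat_supermodular g" and i: "i \<le> d" and r: "x i \<le> r"
    and le: "\<And>y. y \<le> x \<Longrightarrow> g y \<le> (\<Sum>j\<le>d. \<theta> j (y j))"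
    and eq: "\<And>y. y \<in> C \<Longrightarrow> y \<le> x \<and> g y = (\<Sum>j\<le>d. \<theta> j (y j))"
    and eqx: "g x = (\<Sum>j\<le>d. \<theta> j (x j))"
  shows "\<exists>\<theta>'. (\<forall>y\<le>x(i := r). g y \<le> (\<Sum>j\<le>d. \<theta>' j (y j))) \<and>
           (\<forall>y\<in>C. g y = (\<Sum>j\<le>d. \<theta>' j (y j))) \<and>
           g (x(i := r)) = (\<Sum>j\<le>d. \<theta>' j ((x(i := r)) j))"
proof -
  define \<theta>' where
    "\<theta>' = \<theta>(i := \<lambda>s. \<theta> i (min s (x i)) + g (x(i := max s (x i))) - g x)"
  have sum: "(\<Sum>j\<le>d. \<theta>' j (y j)) = (\<Sum>j\<le>d. \<theta> j (inf y x j)) + g (sup y x) - g x"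
    if y: "y \<le> x(i := r)" for y
  proof -
    have yj: "y j \<le> x j" if "j \<noteq> i" for j
      using le_funD[OF y, of j] that by simp
    then have s: "sup y x = x(i := max (y i) (x i))"
      by (auto simp: fun_eq_iff sup_max max_absorb2)
    have "(\<Sum>j\<le>d. \<theta>' j (y j)) = \<theta>' i (y i) + (\<Sum>j\<in>{..d} - {i}. \<theta>' j (y j))"
      using i by (subst sum.remove[of _ i]) auto
    also have "(\<Sum>j\<in>{..d} - {i}. \<theta>' j (y j)) = (\<Sum>j\<in>{..d} - {i}. \<theta> j (inf y x j))"
      using yj by (intro sum.cong) (auto simp: \<theta>'_def inf_min min_absorb1)
    also have "\<theta>' i (y i) = \<theta> i (inf y x i) + g (sup y x) - g x"
      by (simp add: \<theta>'_def s inf_min)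
    also have "\<theta> i (inf y x i) + g (sup y x) - g x + (\<Sum>j\<in>{..d} - {i}. \<theta> j (inf y x j)) =
        (\<Sum>j\<le>d. \<theta> j (inf y x j)) + g (sup y x) - g x"
      using i by (subst (2) sum.remove[of _ i]) auto
    finally show ?thesis .
  qed
  have x_le: "x \<le> x(i := r)" using r by (auto simp: le_fun_def)
  show ?thesis
  proof (intro exI[of _ \<theta>'] conjI allI impI ballI)
    fix y assume y: "y \<le> x(i := r)"
    have "g y + g x \<le> g (inf y x) + g (sup y x)"
      using g by (auto simp: nat_supermodular_def)
    with le[of "inf y x"] show "g y \<le> (\<Sum>j\<le>d. \<theta>' j (y j))"
      unfolding sum[OF y] by simp
  next
    fix y assume "y \<in> C"
    with eq[of y] x_le show "g y = (\<Sum>j\<le>d. \<theta>' j (y j))"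
      by (subst sum) (auto intro: order_trans simp: inf_absorb1 sup_absorb2)
  next
    show "g (x(i := r)) = (\<Sum>j\<le>d. \<theta>' j ((x(i := r)) j))"
      using x_le eqx by (subst sum) (auto simp: inf_absorb2 sup_absorb1)
  qed
qed

lemma potential_raise:
  fixes g :: "(nat \<Rightarrow> nat) \<Rightarrow> real"
  assumes g: "nat_supermodular g" and xx': "x \<le> x'" and off: "\<And>i. d < i \<Longrightarrow> x' i = 0"
    and le: "\<And>y. y \<le> x \<Longrightarrow> g y \<le> (\<Sum>j\<le>d. \<theta> j (y j))"
    and eq: "\<And>y. y \<in> C \<Longrightarrow> y \<le> x \<and> g y = (\<Sum>j\<le>d. \<theta> j (y j))"
    and eqx: "g x = (\<Sum>j\<le>d. \<theta> j (x j))"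
  shows "\<exists>\<theta>'. (\<forall>y\<le>x'. g y \<le> (\<Sum>j\<le>d. \<theta>' j (y j))) \<and>
           (\<forall>y\<in>C. g y = (\<Sum>j\<le>d. \<theta>' j (y j))) \<and> g x' = (\<Sum>j\<le>d. \<theta>' j (x' j))"
proof -
  define z where "z m = (\<lambda>i. if i < m then x' i else x i)" for m
  have x_le_z: "x \<le> z m" for m using xx' by (auto simp: z_def le_fun_def)
  have "m \<le> Suc d \<Longrightarrow> \<exists>\<theta>'. (\<forall>y\<le>z m. g y \<le> (\<Sum>j\<le>d. \<theta>' j (y j))) \<and>
           (\<forall>y\<in>C. g y = (\<Sum>j\<le>d. \<theta>' j (y j))) \<and> g (z m) = (\<Sum>j\<le>d. \<theta>' j (z m j))" for m
  proof (induction m)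
    case 0
    have "z 0 = x" by (simp add: z_def)
    with le eq eqx show ?case by (intro exI[of _ \<theta>]) auto
  next
    case (Suc m)
    then obtain \<theta>' where \<theta>': "\<forall>y\<le>z m. g y \<le> (\<Sum>j\<le>d. \<theta>' j (y j))"
      "\<forall>y\<in>C. g y = (\<Sum>j\<le>d. \<theta>' j (y j))" "g (z m) = (\<Sum>j\<le>d. \<theta>' j (z m j))"
      by auto
    have z: "z (Suc m) = (z m)(m := x' m)" by (auto simp: z_def fun_eq_iff)
    have "z m m \<le> x' m" using xx' by (simp add: z_def le_fun_def)
    then show ?case
      unfolding z using Suc.prems \<theta>' eq x_le_z[of m]
      by (intro potential_raise_coordinate[OF g]) (auto intro: order_trans)
  qed
  moreover have "x i = 0" if "d < i" for i
    using le_funD[OF xx', of i] off[OF that] by simp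
  then have "z (Suc d) = x'" using off by (auto simp: z_def fun_eq_iff)
  ultimately show ?thesis by force
qed

text \<open>The potentials are dual optimal for the comonotone coupling supported on the chain.\<close>

lemma chain_potential:
  fixes g :: "(nat \<Rightarrow> nat) \<Rightarrow> real"
  assumes g: "nat_supermodular g" and x: "incseq x" and off: "\<And>k i. d < i \<Longrightarrow> x k i = 0"
  shows "\<exists>\<theta>. (\<forall>y\<le>x K. g y \<le> (\<Sum>j\<le>d. \<theta> j (y j))) \<and> (\<forall>k\<le>K. g (x k) = (\<Sum>j\<le>d. \<theta> j (x k j)))"
proof (induction K)
  case 0
  \<comment> \<open>Only the zero vector lies below the zero vector, so any potential of total
    \<open>g (\<lambda>_. 0)\<close> is a valid start; the value is placed on coordinate 0. The
    first chain point is reached from there with no earlier points to preserve.\<close>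
  define \<theta> :: "nat \<Rightarrow> nat \<Rightarrow> real" where "\<theta> j s = (if j = 0 then g (\<lambda>_. 0) else 0)" for j s
  have *: "(\<Sum>j\<le>d. \<theta> j (y j)) = g (\<lambda>_. 0)" for y
    by (simp add: \<theta>_def)
  have **: "y \<le> (\<lambda>_. 0) \<longleftrightarrow> y = (\<lambda>_. 0)" for y :: "nat \<Rightarrow> nat"
    by (auto simp: le_fun_def)
  have "\<exists>\<theta>'. (\<forall>y\<le>x 0. g y \<le> (\<Sum>j\<le>d. \<theta>' j (y j))) \<and>
           (\<forall>y\<in>{}. g y = (\<Sum>j\<le>d. \<theta>' j (y j))) \<and> g (x 0) = (\<Sum>j\<le>d. \<theta>' j (x 0 j))"
    by (rule potential_raise[OF g, where x = "\<lambda>_. 0" and \<theta> = \<theta>])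
       (use off in \<open>auto simp: * ** le_fun_def\<close>)
  then show ?case by auto
next
  case (Suc K)
  then obtain \<theta> where \<theta>: "\<forall>y\<le>x K. g y \<le> (\<Sum>j\<le>d. \<theta> j (y j))"
    "\<forall>k\<le>K. g (x k) = (\<Sum>j\<le>d. \<theta> j (x k j))" by blast
  have "\<exists>\<theta>'. (\<forall>y\<le>x (Suc K). g y \<le> (\<Sum>j\<le>d. \<theta>' j (y j))) \<and>
           (\<forall>y\<in>x ` {..K}. g y = (\<Sum>j\<le>d. \<theta>' j (y j))) \<and>
           g (x (Suc K)) = (\<Sum>j\<le>d. \<theta>' j (x (Suc K) j))"
    by (rule potential_raise[OF g, where x = "x K" and \<theta> = \<theta>])
       (use \<theta> x off in \<open>auto dest: incseqD incseq_SucD\<close>)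
  then obtain \<theta>' where "\<forall>y\<le>x (Suc K). g y \<le> (\<Sum>j\<le>d. \<theta>' j (y j))"
     "\<forall>y\<in>x ` {..K}. g y = (\<Sum>j\<le>d. \<theta>' j (y j))"
     "g (x (Suc K)) = (\<Sum>j\<le>d. \<theta>' j (x (Suc K) j))" by blast
  then show ?case by (intro exI[of _ \<theta>']) (auto simp: le_Suc_eq)
qed

lemma finite_bounded_vectors:
  "finite {l :: nat \<Rightarrow> nat. (\<forall>i. l i \<le> n) \<and> (\<forall>i>d. l i = 0)}"
proof (rule finite_subset)
  show "finite ((\<lambda>l i. if i \<le> d then l i else 0) ` (Pi\<^sub>E {..d} (\<lambda>_. {..n})))"
    by (intro finite_imageI finite_PiE) auto
  show "{l :: nat \<Rightarrow> nat. (\<forall>i. l i \<le> n) \<and> (\<forall>i>d. l i = 0)} \<subseteq>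
      (\<lambda>l i. if i \<le> d then l i else 0) ` (Pi\<^sub>E {..d} (\<lambda>_. {..n}))"
  proof
    fix l :: "nat \<Rightarrow> nat" assume "l \<in> {l. (\<forall>i. l i \<le> n) \<and> (\<forall>i>d. l i = 0)}"
    then show "l \<in> (\<lambda>l i. if i \<le> d then l i else 0) ` (Pi\<^sub>E {..d} (\<lambda>_. {..n}))"
      by (intro image_eqI[of _ _ "restrict l {..d}"]) (auto simp: fun_eq_iff)
  qed
qed

text \<open>Viewing \<open>H\<close> as one random element of a finite discrete space makes its
  composition with any \<open>g\<close> measurable.\<close>

lemma measurable_bounded_vector:
  fixes H :: "'a \<Rightarrow> nat \<Rightarrow> nat"
  assumes meas: "\<And>i. i \<le> d \<Longrightarrow> (\<lambda>\<omega>. H \<omega> i) \<in> measurable M (count_space UNIV)"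
    and le: "\<And>\<omega> i. \<omega> \<in> space M \<Longrightarrow> H \<omega> i \<le> (n::nat)"
    and off: "\<And>\<omega> i. \<omega> \<in> space M \<Longrightarrow> d < i \<Longrightarrow> H \<omega> i = 0"
  shows "H \<in> measurable M (count_space {l. (\<forall>i. l i \<le> n) \<and> (\<forall>i>d. l i = 0)})"
proof (rule iffD2[OF measurable_count_space_eq2[OF finite_bounded_vectors]], intro conjI ballI)
  show "H \<in> space M \<rightarrow> {l. (\<forall>i. l i \<le> n) \<and> (\<forall>i>d. l i = 0)}"
    using le off by auto
  fix l assume l: "l \<in> {l. (\<forall>i. l i \<le> n) \<and> (\<forall>i>d. l i = 0)}"
  have "H -` {l} \<inter> space M = {\<omega> \<in> space M. \<forall>i\<in>{..d}. H \<omega> i = l i}"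
  proof (intro set_eqI iffI)
    fix \<omega> assume \<omega>: "\<omega> \<in> {\<omega> \<in> space M. \<forall>i\<in>{..d}. H \<omega> i = l i}"
    then have "H \<omega> i = l i" for i
      using off[of \<omega> i] l by (cases "i \<le> d") auto
    with \<omega> show "\<omega> \<in> H -` {l} \<inter> space M" by auto
  qed auto
  also have "\<dots> \<in> sets M"
  proof (intro sets.sets_Collect_finite_All)
    fix i assume "i \<in> {..d}"
    then have "(\<lambda>\<omega>. H \<omega> i) -` {l i} \<inter> space M \<in> sets M"
      using meas by (intro measurable_sets[where A = "count_space UNIV"]) auto
    also have "(\<lambda>\<omega>. H \<omega> i) -` {l i} \<inter> space M = {\<omega> \<in> space M. H \<omega> i = l i}" by auto
    finally show "{\<omega> \<in> space M. H \<omega> i = l i} \<in> sets M" .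
  qed simp
  finally show "H -` {l} \<inter> space M \<in> sets M" .
qed

lemma (in finite_measure)
  fixes g :: "(nat \<Rightarrow> nat) \<Rightarrow> real"
  assumes meas: "\<And>i. i \<le> d \<Longrightarrow> (\<lambda>\<omega>. H \<omega> i) \<in> measurable M (count_space UNIV)"
    and le: "\<And>\<omega> i. \<omega> \<in> space M \<Longrightarrow> H \<omega> i \<le> (n::nat)"
    and off: "\<And>\<omega> i. \<omega> \<in> space M \<Longrightarrow> d < i \<Longrightarrow> H \<omega> i = 0"
  shows borel_measurable_bounded_vector: "(\<lambda>\<omega>. g (H \<omega>)) \<in> borel_measurable M"
    and integrable_bounded_vector: "integrable M (\<lambda>\<omega>. g (H \<omega>))"
proof -
  let ?V = "{l :: nat \<Rightarrow> nat. (\<forall>i. l i \<le> n) \<and> (\<forall>i>d. l i = 0)}"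
  show m: "(\<lambda>\<omega>. g (H \<omega>)) \<in> borel_measurable M"
    using measurable_bounded_vector[OF assms] by (rule measurable_compose) auto
  have "\<bar>g (H \<omega>)\<bar> \<le> (\<Sum>l\<in>?V. \<bar>g l\<bar>)" if "\<omega> \<in> space M" for \<omega>
    using le off that
    by (intro member_le_sum[where f = "\<lambda>l. \<bar>g l\<bar>", OF _ _ finite_bounded_vectors]) auto
  then show "integrable M (\<lambda>\<omega>. g (H \<omega>))"
    by (intro integrable_const_bound[OF _ m, of "\<Sum>l\<in>?V. \<bar>g l\<bar>"]) auto
qed

lemma integral_nat_valued_eq:
  fixes \<theta> :: "nat \<Rightarrow> real"
  assumes "prob_space M"
    and "h \<in> measurable M (count_space UNIV)" "h' \<in> measurable M (count_space UNIV)"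
    and "\<And>k. measure M {\<omega> \<in> space M. h \<omega> = k} = measure M {\<omega> \<in> space M. h' \<omega> = (k::nat)}"
  shows "(LINT \<omega>|M. \<theta> (h \<omega>)) = (LINT \<omega>|M. \<theta> (h' \<omega>))"
proof -
  interpret prob_space M by fact
  have "distr M (count_space UNIV) h = distr M (count_space UNIV) h'"
  proof (rule measure_eqI_countable[of _ UNIV])
    fix k :: nat
    show "emeasure (distr M (count_space UNIV) h) {k} = emeasure (distr M (count_space UNIV) h') {k}"
      using assms(2-4) by (auto simp: emeasure_distr vimage_def Int_def conj_commute emeasure_eq_measure)
  qed auto
  then have "(LINT k|distr M (count_space UNIV) h. \<theta> k) = (LINT k|distr M (count_space UNIV) h'. \<theta> k)"
    by simp
  then show ?thesis
    using assms(2,3) by (simp add: integral_distr)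
qed

text \<open>Integrating the potentials proves the inequality: they dominate \<open>g\<close> along
  \<open>H\<close>, their integrals depend only on the one-dimensional laws, and along
  \<open>H'\<close> they equal \<open>g\<close>, because the range of an increasing grid-valued path
  is a finite chain.\<close>

lemma comonotone_rearrangement:
  fixes g :: "(nat \<Rightarrow> nat) \<Rightarrow> real" and H H' :: "real \<Rightarrow> nat \<Rightarrow> nat"
  assumes g: "nat_supermodular g"
    and meas: "\<And>i. i \<le> d \<Longrightarrow> (\<lambda>t. H t i) \<in> measurable U01 (count_space UNIV)"
      "\<And>i. i \<le> d \<Longrightarrow> (\<lambda>t. H' t i) \<in> measurable U01 (count_space UNIV)"
    and le: "\<And>t i. H t i \<le> n" "\<And>t i. H' t i \<le> n"
    and off: "\<And>t i. d < i \<Longrightarrow> H t i = 0" "\<And>t i. d < i \<Longrightarrow> H' t i = 0"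
    and mono: "mono_on {0<..<1} H'"
    and marg: "\<And>i k. i \<le> d \<Longrightarrow> measure U01 {t \<in> space U01. H t i = k} =
       measure U01 {t \<in> space U01. H' t i = k}"
  shows "(LINT t|U01. g (H t)) \<le> (LINT t|U01. g (H' t))"
proof -
  interpret prob_space U01 by (rule prob_space_unit_interval)
  let ?V = "{l :: nat \<Rightarrow> nat. (\<forall>i. l i \<le> n) \<and> (\<forall>i>d. l i = 0)}"
  have "finite (H' ` {0<..<1})"
    using le off by (intro finite_subset[OF _ finite_bounded_vectors[of n d]]) auto
  \<comment> \<open>Finitely many times in \<open>T\<close> represent all values of
    \<open>H'\<close>; taken in increasing order they list these values as a chain.\<close>
  then obtain T where T: "T \<subseteq> {0<..<1}" "finite T" "H' ` {0<..<1} = H' ` T"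
    by (metis finite_subset_image subset_refl)
  have "T \<noteq> {}" using T(3) by (auto simp: not_le[symmetric])
  define ts where "ts = sorted_list_of_set T"
  have ts: "set ts = T" "sorted ts" "ts \<noteq> []"
    using T \<open>T \<noteq> {}\<close> by (auto simp: ts_def)
  define K where "K = length ts"
  \<comment> \<open>The chain is closed off by the largest grid vector: the potentials bound
    \<open>g\<close> only below the last chain point, and values of \<open>H\<close> need not lie
    below a value of \<open>H'\<close>.\<close>
  define top where "top = (\<lambda>i. if i \<le> d then n else 0)"
  define x where "x k = (if k < K then H' (ts ! k) else top)" for k
  have H'_top: "H' t \<le> top" for t using le off by (auto simp: top_def le_fun_def not_le)
  have "incseq x"
  proof (rule incseq_SucI)
    fix k
    show "x k \<le> x (Suc k)"
    proof (cases "Suc k < K")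
      case True
      then have "ts ! k \<in> T" "ts ! Suc k \<in> T" "ts ! k \<le> ts ! Suc k"
        using ts sorted_nth_mono[OF ts(2), of k "Suc k"]
        by (auto simp: K_def simp flip: ts(1))
      with True T(1) mono show ?thesis by (auto simp: x_def intro!: mono_onD[OF mono])
    next
      case False
      then show ?thesis using H'_top by (auto simp: x_def)
    qed
  qed
  moreover have "x k i = 0" if "d < i" for k i
    using off that by (auto simp: x_def top_def)
  ultimately obtain \<theta> where \<theta>: "\<forall>y\<le>x K. g y \<le> (\<Sum>j\<le>d. \<theta> j (y j))"
    "\<forall>k\<le>K. g (x k) = (\<Sum>j\<le>d. \<theta> j (x k j))"
    using chain_potential[OF g, of x d K] by blast
  have int: "integrable U01 (\<lambda>t. \<theta> j (H t j))" "integrable U01 (\<lambda>t. \<theta> j (H' t j))"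
    if "j \<le> d" for j
    using integrable_bounded_vector[OF meas(1) le(1) off(1), where g = "\<lambda>l. \<theta> j (l j)"]
      integrable_bounded_vector[OF meas(2) le(2) off(2), where g = "\<lambda>l. \<theta> j (l j)"] that by auto
  have "(LINT t|U01. g (H t)) \<le> (LINT t|U01. (\<Sum>j\<le>d. \<theta> j (H t j)))"
  proof (rule integral_mono)
    show "integrable U01 (\<lambda>t. g (H t))"
      by (rule integrable_bounded_vector[OF meas(1) le(1) off(1)])
    show "integrable U01 (\<lambda>t. \<Sum>j\<le>d. \<theta> j (H t j))"
      using int by (intro Bochner_Integration.integrable_sum) auto
    fix t
    have "H t \<le> x K" using le off by (auto simp: x_def top_def le_fun_def not_le)
    with \<theta>(1) show "g (H t) \<le> (\<Sum>j\<le>d. \<theta> j (H t j))" by blast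
  qed
  also have "\<dots> = (\<Sum>j\<le>d. LINT t|U01. \<theta> j (H t j))"
    using int by (intro Bochner_Integration.integral_sum) auto
  also have "\<dots> = (\<Sum>j\<le>d. LINT t|U01. \<theta> j (H' t j))"
    using meas marg prob_space_axioms by (intro sum.cong integral_nat_valued_eq) auto
  also have "\<dots> = (LINT t|U01. (\<Sum>j\<le>d. \<theta> j (H' t j)))"
    using int by (subst Bochner_Integration.integral_sum) auto
  also have "\<dots> = (LINT t|U01. g (H' t))"
  proof (rule Bochner_Integration.integral_cong[OF refl])
    fix t assume "t \<in> space U01"
    then have "H' t \<in> H' ` T" using T(3) by (auto simp: space_restrict_space)
    then obtain s where "s \<in> T" "H' t = H' s" by auto
    then obtain k where "k < K" "H' t = x k"
      using ts(1) by (auto simp: x_def K_def in_set_conv_nth)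
    with \<theta>(2) show "(\<Sum>j\<le>d. \<theta> j (H' t j)) = g (H' t)" by simp
  qed
  finally show ?thesis .
qed

section \<open>Integral inequalities of Chebyshev and Harris\<close>

lemma measurable_unit_interval_id [measurable]: "(\<lambda>t. t) \<in> borel_measurable U01"
  by (simp add: borel_measurable_restrict_space_iff)

lemma space_unit_interval [simp]: "space U01 = {0<..<1}"
  by (simp add: space_restrict_space)

lemma measure_unit_interval_le:
  assumes "0 \<le> c" "c \<le> 1"
  shows "measure U01 {t \<in> {0<..<1}. t \<le> c} = c"
proof -
  have "measure U01 {t \<in> {0<..<1}. t \<le> c} = measure lborel {t \<in> {0<..<1}. t \<le> c}"
    by (subst measure_restrict_space) auto
  also have "\<dots> = measure lborel {0<..<c}"
    using assms AE_lborel_singleton[of c] by (intro measure_eq_AE) auto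
  also have "\<dots> = c" using assms by simp
  finally show ?thesis .
qed

lemma AE_unit_interval_neq: "AE t in U01. t \<noteq> c"
  using AE_lborel_singleton[of c] by (auto simp: AE_restrict_space_iff)

text \<open>If \<open>P t\<close> holds, almost all of (0, t) satisfies \<open>P\<close>, so t is at
  most the measure. If not, \<open>P\<close> lies almost surely within (0, t], so the measure is at
  most t, and equality is excluded by discarding one point. The set \<open>G\<close> of full measure
  is there because monotonicity of conditional probabilities is known only outside a null
  set.\<close>

lemma unit_interval_downset_AE:
  assumes [measurable]: "Measurable.pred U01 P"
    and G: "AE t in U01. t \<in> G"
    and down: "\<And>s t. s \<in> G \<inter> {0<..<1} \<Longrightarrow> t \<in> G \<inter> {0<..<1} \<Longrightarrow> s < t \<Longrightarrow> P t \<Longrightarrow> P s"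
  shows "AE t in U01. P t \<longleftrightarrow> t \<le> measure U01 {t \<in> {0<..<1}. P t}"
proof -
  interpret prob_space U01 by (rule prob_space_unit_interval)
  define m where "m = measure U01 {t \<in> {0<..<1}. P t}"
  have sets: "{s \<in> {0<..<1}. P s} \<in> sets U01" "{s \<in> {0<..<1}. s \<le> t} \<in> sets U01" for t :: real
  proof -
    have "{s \<in> space U01. P s} \<in> sets U01" by measurable
    then show "{s \<in> {0<..<1}. P s} \<in> sets U01" by simp
    have "{s \<in> space U01. s \<le> t} \<in> sets U01" by measurable
    then show "{s \<in> {0<..<1}. s \<le> t} \<in> sets U01" by simp
  qed
  show ?thesis
    using G AE_unit_interval_neq[of m] AE_space
  proof eventually_elim
    case (elim t)
    have t: "measure U01 {s \<in> {0<..<1}. s \<le> t} = t"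
      using elim by (intro measure_unit_interval_le) auto
    show ?case
    proof (cases "P t")
      case True
      have "AE s in U01. s \<in> {s \<in> {0<..<1}. s \<le> t} \<longrightarrow> s \<in> {s \<in> {0<..<1}. P s}"
        using G AE_unit_interval_neq[of t] AE_space
      proof eventually_elim
        case (elim s)
        then show ?case using down[of s t] \<open>t \<in> G\<close> \<open>t \<in> space U01\<close> True by auto
      qed
      from finite_measure_mono_AE[OF this sets(1)] t True show ?thesis by simp
    next
      case False
      have "AE s in U01. s \<in> {s \<in> {0<..<1}. P s} \<longrightarrow> s \<in> {s \<in> {0<..<1}. s \<le> t}"
        using G AE_space
      proof eventually_elim
        case (elim s)
        then show ?case using down[of t s] \<open>t \<in> G\<close> \<open>t \<in> space U01\<close> False by force
      qed
      from finite_measure_mono_AE[OF this sets(2)] t False \<open>t \<noteq> m\<close> show ?thesis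
        by (simp add: m_def)
    qed
  qed
qed

lemma integrable_bounded_unit_interval:
  fixes f :: "real \<Rightarrow> real"
  assumes "f \<in> borel_measurable U01" "\<And>t. t \<in> {0<..<1} \<Longrightarrow> \<bar>f t\<bar> \<le> C"
  shows "integrable U01 f"
proof -
  interpret prob_space U01 by (rule prob_space_unit_interval)
  show ?thesis using assms by (intro integrable_const_bound[where B = C]) auto
qed

lemma integral_unit_interval_swap:
  fixes f :: "real \<Rightarrow> real \<Rightarrow> real"
  assumes "case_prod f \<in> borel_measurable (U01 \<Otimes>\<^sub>M U01)"
    and "\<And>t u. t \<in> {0<..<1} \<Longrightarrow> u \<in> {0<..<1} \<Longrightarrow> \<bar>f t u\<bar> \<le> C"
  shows "(LINT u|U01. LINT t|U01. f t u) =
         (LINT t|U01. LINT u|U01. f t u)"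
proof -
  interpret U: prob_space U01 by (rule prob_space_unit_interval)
  interpret pair_prob_space U01 U01 ..
  have "integrable (U01 \<Otimes>\<^sub>M U01) (case_prod f)"
    using assms by (intro integrable_const_bound[where B = C]) (auto simp: space_pair_measure)
  then show ?thesis by (rule Fubini_integral)
qed

text \<open>Writing the increasing weight as a mixture of indicators of up-sets reduces the claim to
  the case where the weight is such an indicator.\<close>

lemma integral_increasing_weight_nonneg:
  fixes \<delta> K :: "real \<Rightarrow> real"
  assumes \<delta>: "mono_on {0<..<1} \<delta>"
    and [measurable]: "\<delta> \<in> borel_measurable U01" "K \<in> borel_measurable U01"
    and C: "\<And>t. t \<in> {0<..<1} \<Longrightarrow> \<bar>\<delta> t\<bar> \<le> C" and B: "\<And>t. t \<in> {0<..<1} \<Longrightarrow> \<bar>K t\<bar> \<le> B"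
    and le: "\<And>x. x \<in> {0<..<1} \<Longrightarrow> (LINT t|U01. (if t \<le> x then K t else 0)) \<le> 0"
    and eq: "(LINT t|U01. K t) = 0"
  shows "0 \<le> (LINT t|U01. \<delta> t * K t)"
proof -
  interpret prob_space U01 by (rule prob_space_unit_interval)
  have B0: "0 \<le> B" using B[of "1/2"] by auto
  \<comment> \<open>\<open>c\<close> is kept positive so that \<open>\<epsilon>\<close> can map the
    range of \<open>\<delta>\<close> affinely into [0, 1].\<close>
  define c where "c = max C 1"
  have c: "0 < c" "\<And>t. t \<in> {0<..<1} \<Longrightarrow> \<bar>\<delta> t\<bar> \<le> c"
    using C by (auto simp: c_def max_def intro: order_trans)
  define \<epsilon> where "\<epsilon> t = (\<delta> t + c) / (2 * c)" for t
  have \<epsilon>: "0 \<le> \<epsilon> t" "\<epsilon> t \<le> 1" if "t \<in> {0<..<1}" for t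
    using c(2)[OF that] c(1) by (auto simp: \<epsilon>_def field_simps abs_le_iff)
  have [measurable]: "\<epsilon> \<in> borel_measurable U01" by (simp add: \<epsilon>_def[abs_def])
  have Kint: "integrable U01 K"
    using B by (intro integrable_bounded_unit_interval) auto
  have layer: "(LINT r|U01. (if r \<le> \<epsilon> t then K t else 0)) = \<epsilon> t * K t"
    if "t \<in> {0<..<1}" for t
  proof -
    have "(LINT r|U01. (if r \<le> \<epsilon> t then K t else 0)) =
        (LINT r|U01. indicator {r \<in> {0<..<1}. r \<le> \<epsilon> t} r * K t)"
      by (intro Bochner_Integration.integral_cong) (auto simp: indicator_def)
    also have "\<dots> = measure U01 ({r \<in> {0<..<1}. r \<le> \<epsilon> t} \<inter> space U01) * K t"
      by (simp del: space_unit_interval)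
    also have "{r \<in> {0<..<1}. r \<le> \<epsilon> t} \<inter> space U01 = {r \<in> {0<..<1}. r \<le> \<epsilon> t}"
      by auto
    also have "measure U01 \<dots> = \<epsilon> t"
      by (rule measure_unit_interval_le[OF \<epsilon>[OF that]])
    finally show ?thesis .
  qed
  have m: "(\<lambda>(t, r). if r \<le> \<epsilon> t then K t else 0) \<in> borel_measurable (U01 \<Otimes>\<^sub>M U01)"
    by measurable
  \<comment> \<open>The superlevel set of \<open>\<epsilon>\<close> at \<open>r\<close> is, up to a
    null set, the complement of an initial interval (0, m]. As \<open>K\<close> has total integral
    zero, its integral there is minus the one over (0, m], hence nonnegative.\<close>
  have "0 \<le> (LINT t|U01. (if r \<le> \<epsilon> t then K t else 0))" if "r \<in> {0<..<1}" for r
  proof -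
    define m where "m = measure U01 {t \<in> {0<..<1}. \<not> r \<le> \<epsilon> t}"
    have "AE t in U01. \<not> r \<le> \<epsilon> t \<longleftrightarrow> t \<le> m"
      unfolding m_def
    proof (rule unit_interval_downset_AE[where G = UNIV])
      fix s t assume "s \<in> UNIV \<inter> {0<..<1::real}" "t \<in> UNIV \<inter> {0<..<1::real}" "s < t" "\<not> r \<le> \<epsilon> t"
      moreover from this have "\<delta> s \<le> \<delta> t" by (intro mono_onD[OF \<delta>]) auto
      then have "\<epsilon> s \<le> \<epsilon> t" using c(1) by (simp add: \<epsilon>_def divide_right_mono)
      ultimately show "\<not> r \<le> \<epsilon> s" by simp
    qed simp_all
    then have "(LINT t|U01. (if r \<le> \<epsilon> t then K t else 0)) =
        (LINT t|U01. K t - (if t \<le> m then K t else 0))"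
      by (intro integral_cong_AE) (auto elim!: eventually_mono)
    also have "\<dots> = (LINT t|U01. K t) - (LINT t|U01. (if t \<le> m then K t else 0))"
      using B B0 by (intro Bochner_Integration.integral_diff Kint integrable_bounded_unit_interval[where C = B]) auto
    finally have *: "(LINT t|U01. (if r \<le> \<epsilon> t then K t else 0)) =
        (LINT t|U01. K t) - (LINT t|U01. (if t \<le> m then K t else 0))" .
    have "(LINT t|U01. (if t \<le> m then K t else 0)) \<le> 0"
    proof -
      consider "m \<le> 0" | "1 \<le> m" | "m \<in> {0<..<1}" by fastforce
      then show ?thesis
      proof cases
        case 1
        then have "(LINT t|U01. (if t \<le> m then K t else 0)) = (LINT t|U01. 0)"
          by (intro Bochner_Integration.integral_cong) auto
        then show ?thesis by simp
      next
        case 2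
        then have "(LINT t|U01. (if t \<le> m then K t else 0)) = (LINT t|U01. K t)"
          by (intro Bochner_Integration.integral_cong) auto
        then show ?thesis using eq by simp
      qed (rule le)
    qed
    with * eq show ?thesis by simp
  qed
  then have "0 \<le> (LINT r|U01. LINT t|U01. (if r \<le> \<epsilon> t then K t else 0))"
    by (intro integral_nonneg_AE) auto
  also have "\<dots> = (LINT t|U01. LINT r|U01. (if r \<le> \<epsilon> t then K t else 0))"
    using B B0 by (intro integral_unit_interval_swap[OF m, where C = B]) auto
  also have "\<dots> = (LINT t|U01. \<epsilon> t * K t)"
    using layer by (intro Bochner_Integration.integral_cong) auto
  \<comment> \<open>The affine shift contributes a multiple of the integral of \<open>K\<close>,
    which is zero.\<close>
  also have "\<dots> = (LINT t|U01. \<delta> t * K t / (2 * c) + K t / 2)"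
    using c(1) by (intro Bochner_Integration.integral_cong) (auto simp: \<epsilon>_def field_simps)
  also have "\<dots> = (LINT t|U01. \<delta> t * K t / (2 * c)) + (LINT t|U01. K t / 2)"
  proof (intro Bochner_Integration.integral_add)
    have "\<bar>\<delta> t * K t\<bar> \<le> C * B" if "t \<in> {0<..<1}" for t
      using C[OF that] B[OF that] by (auto simp: abs_mult intro!: mult_mono)
    then have "integrable U01 (\<lambda>t. \<delta> t * K t)"
      by (intro integrable_bounded_unit_interval) auto
    then show "integrable U01 (\<lambda>t. \<delta> t * K t / (2 * c))" by simp
  qed (use Kint in simp)
  also have "\<dots> = (LINT t|U01. \<delta> t * K t) / (2 * c)" using eq by simp
  finally show ?thesis using c(1) by (simp add: zero_le_divide_iff)
qed

text \<open>Both factors of \<open>(a s - a t) * (b s - b t)\<close> have the same sign, so its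
  double integral over s and t is nonnegative; expanded, this is twice the difference of the two
  sides.\<close>

lemma chebyshev_integral_unit_interval:
  fixes a b :: "real \<Rightarrow> real"
  assumes ab: "mono_on {0<..<1} a" "mono_on {0<..<1} b"
    and [measurable]: "a \<in> borel_measurable U01" "b \<in> borel_measurable U01"
    and C: "\<And>t. t \<in> {0<..<1} \<Longrightarrow> \<bar>a t\<bar> \<le> C" "\<And>t. t \<in> {0<..<1} \<Longrightarrow> \<bar>b t\<bar> \<le> C"
  shows "(LINT t|U01. a t) * (LINT t|U01. b t) \<le> (LINT t|U01. a t * b t)"
proof -
  interpret prob_space U01 by (rule prob_space_unit_interval)
  have int [simp]: "integrable U01 a" "integrable U01 b"
    using C by (auto intro!: integrable_bounded_unit_interval[where C = C])
  have "\<bar>a t * b t\<bar> \<le> C * C" if "t \<in> {0<..<1}" for t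
    using C(1)[OF that] C(2)[OF that] by (auto simp: abs_mult intro!: mult_mono)
  then have int2 [simp]: "integrable U01 (\<lambda>t. a t * b t)"
    by (intro integrable_bounded_unit_interval) auto
  define A where "A = (LINT t|U01. a t)"
  define B where "B = (LINT t|U01. b t)"
  define D where "D = (LINT t|U01. a t * b t)"
  have "0 \<le> a s * b s - a s * B - b s * A + D" if s: "s \<in> {0<..<1}" for s
  proof -
    have "0 \<le> (LINT t|U01. (a s - a t) * (b s - b t))"
    proof (intro integral_nonneg_AE AE_I2)
      fix t assume "t \<in> space U01"
      with s mono_onD[OF ab(1)] mono_onD[OF ab(2)] show "0 \<le> (a s - a t) * (b s - b t)"
        by (cases "s \<le> t") (auto simp: zero_le_mult_iff)
    qed
    also have "\<dots> = (LINT t|U01. a s * b s - a s * b t - b s * a t + a t * b t)"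
      by (intro Bochner_Integration.integral_cong) (auto simp: algebra_simps)
    also have "\<dots> = a s * b s - a s * B - b s * A + D"
      by (simp add: A_def B_def D_def prob_space[simplified])
    finally show ?thesis .
  qed
  then have "0 \<le> (LINT s|U01. a s * b s - a s * B - b s * A + D)"
    by (intro integral_nonneg_AE) auto
  also have "\<dots> = 2 * (D - A * B)"
    by (simp add: A_def[symmetric] B_def[symmetric] D_def[symmetric] prob_space[simplified])
  finally show ?thesis by (simp add: A_def B_def D_def)
qed

lemma (in product_prob_space)
  fixes a :: "('i \<Rightarrow> 'a) \<Rightarrow> real"
  assumes J: "finite J" "i \<notin> J"
    and a [measurable]: "a \<in> borel_measurable (Pi\<^sub>M (insert i J) M)"
    and C: "\<And>w. w \<in> space (Pi\<^sub>M (insert i J) M) \<Longrightarrow> \<bar>a w\<bar> \<le> C"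
  shows integral_PiM_insert_bounded: "(LINT w|Pi\<^sub>M (insert i J) M. a w) =
      (LINT w|Pi\<^sub>M J M. LINT u|M i. a (w(i := u)))"
    and measurable_PiM_section: "w \<in> space (Pi\<^sub>M J M) \<Longrightarrow> (\<lambda>u. a (w(i := u))) \<in> borel_measurable (M i)"
    and measurable_PiM_marginal: "(\<lambda>w. LINT u|M i. a (w(i := u))) \<in> borel_measurable (Pi\<^sub>M J M)"
    and bounded_PiM_marginal: "w \<in> space (Pi\<^sub>M J M) \<Longrightarrow> \<bar>LINT u|M i. a (w(i := u))\<bar> \<le> C"
proof -
  interpret J: finite_product_prob_space M "insert i J" by standard (use J in auto)
  have "integrable (Pi\<^sub>M (insert i J) M) a"
    using C by (intro J.P.integrable_const_bound[where B = C]) auto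
  then show "(LINT w|Pi\<^sub>M (insert i J) M. a w) = (LINT w|Pi\<^sub>M J M. LINT u|M i. a (w(i := u)))"
    using J by (intro product_integral_insert) auto
  show m: "(\<lambda>u. a (w(i := u))) \<in> borel_measurable (M i)" if [measurable]: "w \<in> space (Pi\<^sub>M J M)" for w
    by measurable
  show "(\<lambda>w. LINT u|M i. a (w(i := u))) \<in> borel_measurable (Pi\<^sub>M J M)"
    by measurable
  show "\<bar>LINT u|M i. a (w(i := u))\<bar> \<le> C" if w: "w \<in> space (Pi\<^sub>M J M)" for w
  proof -
    have b: "\<bar>a (w(i := u))\<bar> \<le> C" if "u \<in> space (M i)" for u
      using that w by (intro C) (auto simp: space_PiM PiE_iff extensional_def)
    have "\<bar>LINT u|M i. a (w(i := u))\<bar> \<le> (LINT u|M i. \<bar>a (w(i := u))\<bar>)"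
      by (rule integral_abs_bound)
    also have "\<dots> \<le> (LINT u|M i. C)"
      using b m[OF w] by (intro integral_mono M.integrable_const_bound[where B = C] M.integrable_const) auto
    also have "\<dots> = C" by (simp add: M.prob_space)
    finally show ?thesis .
  qed
qed

text \<open>Induction on the coordinates: integrals over one coordinate are again bounded and
  increasing in the remaining ones, so the induction hypothesis applies to them, and for fixed
  remaining coordinates the one-dimensional Chebyshev inequality recombines the product.\<close>

lemma harris_inequality:
  fixes a b :: "('i \<Rightarrow> real) \<Rightarrow> real"
  assumes "finite I"
    and "a \<in> borel_measurable (Pi\<^sub>M I (\<lambda>_. U01))" "b \<in> borel_measurable (Pi\<^sub>M I (\<lambda>_. U01))"
    and "\<And>w. w \<in> space (Pi\<^sub>M I (\<lambda>_. U01)) \<Longrightarrow> \<bar>a w\<bar> \<le> C"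
    and "\<And>w. w \<in> space (Pi\<^sub>M I (\<lambda>_. U01)) \<Longrightarrow> \<bar>b w\<bar> \<le> C"
    and "mono_on (space (Pi\<^sub>M I (\<lambda>_. U01))) a" "mono_on (space (Pi\<^sub>M I (\<lambda>_. U01))) b"
  shows "(LINT w|Pi\<^sub>M I (\<lambda>_. U01). a w) * (LINT w|Pi\<^sub>M I (\<lambda>_. U01). b w)
    \<le> (LINT w|Pi\<^sub>M I (\<lambda>_. U01). a w * b w)"
  using assms
proof (induction I arbitrary: a b rule: finite_induct)
  case empty
  have "(LINT w|Pi\<^sub>M {} (\<lambda>_. U01). f w) = f (\<lambda>_. undefined)" for f :: "('i \<Rightarrow> real) \<Rightarrow> real"
    by (simp add: PiM_empty lebesgue_integral_count_space_finite)
  then show ?case by simp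
next
  case (insert i I)
  interpret U: prob_space U01 by (rule prob_space_unit_interval)
  interpret product_prob_space "\<lambda>_::'i. U01" by standard
  interpret I: finite_product_prob_space "\<lambda>_::'i. U01" I by standard (use insert in auto)
  let ?P = "Pi\<^sub>M I (\<lambda>_. U01)" and ?Q = "Pi\<^sub>M (insert i I) (\<lambda>_. U01)"
  have C0: "0 \<le> C"
  proof -
    interpret Q: finite_product_prob_space "\<lambda>_::'i. U01" "insert i I" by standard (use insert in auto)
    obtain w where "w \<in> space ?Q" using Q.P.not_empty by blast
    with insert.prems(3)[of w] show ?thesis by linarith
  qed
  note [measurable] = insert.prems(1,2)
  have ab: "\<bar>a w * b w\<bar> \<le> C * C" if "w \<in> space ?Q" for w
    using insert.prems(3,4)[OF that] C0 by (auto simp: abs_mult intro!: mult_mono)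
  have abm: "(\<lambda>w. a w * b w) \<in> borel_measurable ?Q" by measurable
  have upd: "w(i := u) \<in> space ?Q" if "w \<in> space ?P" "u \<in> {0<..<1}" for w u
    using that by (auto simp: space_PiM PiE_iff extensional_def)
  define a' where "a' w = (LINT u|U01. a (w(i := u)))" for w
  define b' where "b' w = (LINT u|U01. b (w(i := u)))" for w
  have le_upd: "w(i := u) \<le> w'(i := u')" if "w \<le> w'" "u \<le> u'" for w w' :: "'i \<Rightarrow> real" and u u'
    using that by (auto simp: le_fun_def)
  have mono': "mono_on (space ?P) (\<lambda>w. LINT u|U01. c (w(i := u)))"
    if c: "c \<in> borel_measurable ?Q" "\<And>w. w \<in> space ?Q \<Longrightarrow> \<bar>c w\<bar> \<le> C" "mono_on (space ?Q) c" for c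
  proof (rule mono_onI)
    fix w w' assume w: "w \<in> space ?P" "w' \<in> space ?P" "w \<le> w'"
    note s = measurable_PiM_section[OF insert.hyps c(1,2)]
    show "(LINT u|U01. c (w(i := u))) \<le> (LINT u|U01. c (w'(i := u)))"
      using w upd c(2) s le_upd
      by (intro integral_mono mono_onD[OF c(3)] integrable_bounded_unit_interval[where C = C]) auto
  qed
  note sec = measurable_PiM_section[OF insert.hyps insert.prems(1,3)]
    measurable_PiM_section[OF insert.hyps insert.prems(2,4)]
  have m': "a' \<in> borel_measurable ?P" "b' \<in> borel_measurable ?P"
    unfolding a'_def b'_def
    by (rule measurable_PiM_marginal[OF insert.hyps insert.prems(1,3)]
        measurable_PiM_marginal[OF insert.hyps insert.prems(2,4)], assumption)+
  have bd': "\<bar>a' w\<bar> \<le> C" "\<bar>b' w\<bar> \<le> C" if "w \<in> space ?P" for w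
    unfolding a'_def b'_def
    by (rule bounded_PiM_marginal[OF insert.hyps insert.prems(1,3) that]
        bounded_PiM_marginal[OF insert.hyps insert.prems(2,4) that], assumption)+
  have mono_ab': "mono_on (space ?P) a'" "mono_on (space ?P) b'"
    unfolding a'_def b'_def by (intro mono' insert.prems; assumption)+
  have "(LINT w|?Q. a w) * (LINT w|?Q. b w) = (LINT w|?P. a' w) * (LINT w|?P. b' w)"
    using insert by (simp add: integral_PiM_insert_bounded[where C = C] a'_def b'_def)
  also have "\<dots> \<le> (LINT w|?P. a' w * b' w)"
    by (intro insert.IH m' bd' mono_ab')
  also have "\<dots> \<le> (LINT w|?P. LINT u|U01. a (w(i := u)) * b (w(i := u)))"
  proof (rule integral_mono)
    have "\<bar>a' w * b' w\<bar> \<le> C * C" if "w \<in> space ?P" for w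
      using bd'[OF that] C0 by (auto simp: abs_mult intro!: mult_mono)
    then show "integrable ?P (\<lambda>w. a' w * b' w)"
      using m' by (intro I.P.integrable_const_bound[where B = "C * C"]) auto
    show "integrable ?P (\<lambda>w. LINT u|U01. a (w(i := u)) * b (w(i := u)))"
      using measurable_PiM_marginal[OF insert.hyps abm ab] bounded_PiM_marginal[OF insert.hyps abm ab]
      by (intro I.P.integrable_const_bound[where B = "C * C"]) auto
    fix w assume w: "w \<in> space ?P"
    show "a' w * b' w \<le> (LINT u|U01. a (w(i := u)) * b (w(i := u)))"
      unfolding a'_def b'_def
    proof (rule chebyshev_integral_unit_interval[where C = C])
      show "mono_on {0<..<1} (\<lambda>u. a (w(i := u)))" "mono_on {0<..<1} (\<lambda>u. b (w(i := u)))"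
        by (intro mono_onI mono_onD[OF insert.prems(5)] mono_onD[OF insert.prems(6)] upd[OF w]
            le_upd order_refl; assumption)+
    qed (use w sec insert.prems(3,4) upd in blast)+
  qed
  also have "\<dots> = (LINT w|?Q. a w * b w)"
    using insert.hyps by (simp add: integral_PiM_insert_bounded[OF _ _ abm ab])
  finally show ?case .
qed

section \<open>Conditionally independent vectors on a finite grid\<close>

text \<open>With \<open>R j\<close> read as "the value is at most j", this is for nested
  \<open>R\<close> the least \<open>j < n\<close> with \<open>R j\<close>, or \<open>n\<close> if
  there is none. As a cardinality it stays bounded by \<open>n\<close> and antitone in
  \<open>R\<close> at exceptional points where nestedness fails.\<close>

definition level :: "nat \<Rightarrow> (nat \<Rightarrow> bool) \<Rightarrow> nat" where
  "level n R = card {j. j < n \<and> \<not> R j}"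

lemma level_le: "level n R \<le> n"
  using card_mono[of "{..<n}" "{j. j < n \<and> \<not> R j}"] by (auto simp: level_def)

lemma level_antimono: "(\<And>j. j < n \<Longrightarrow> R j \<Longrightarrow> R' j) \<Longrightarrow> level n R' \<le> level n R"
  unfolding level_def by (rule card_mono) auto

lemma level_cong: "(\<And>j. j < n \<Longrightarrow> R j \<longleftrightarrow> R' j) \<Longrightarrow> level n R = level n R'"
  unfolding level_def by (rule arg_cong[where f = card]) auto

lemma level_eq_sum: "level n R = (\<Sum>j<n. if R j then 0 else 1)"
proof -
  have "(\<Sum>j<n. if R j then 0 else (1::nat)) = (\<Sum>j\<in>{j. j < n \<and> \<not> R j}. 1)"
    by (rule sum.mono_neutral_cong_right) auto
  then show ?thesis by (simp add: level_def)
qed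

definition nested :: "nat \<Rightarrow> (nat \<Rightarrow> bool) \<Rightarrow> bool" where
  "nested n R \<longleftrightarrow> (\<forall>j. Suc j < n \<longrightarrow> R j \<longrightarrow> R (Suc j))"

lemma nestedD:
  assumes "nested n R" "j \<le> k" "k < n" "R j"
  shows "R k"
  using assms(2,3)
proof (induction k rule: dec_induct)
  case (step k)
  then show ?case using assms(1) by (auto simp: nested_def)
qed (use assms(4) in simp)

lemma level_le_iff:
  assumes "nested n R" "k < n"
  shows "level n R \<le> k \<longleftrightarrow> R k"
proof
  assume "R k"
  with assms have "{j. j < n \<and> \<not> R j} \<subseteq> {..<k}"
    using nestedD[of n R k] by (auto simp: not_le[symmetric])
  then have "card {j. j < n \<and> \<not> R j} \<le> card {..<k}"
    by (intro card_mono) auto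
  then show "level n R \<le> k" by (simp add: level_def)
next
  assume le: "level n R \<le> k"
  show "R k"
  proof (rule ccontr)
    assume "\<not> R k"
    with assms have "{..k} \<subseteq> {j. j < n \<and> \<not> R j}"
      using nestedD[of n R _ k] by auto
    then have "card {..k} \<le> card {j. j < n \<and> \<not> R j}"
      by (intro card_mono) auto
    with le show False by (simp add: level_def)
  qed
qed

text \<open>It turns a function of the level into an affine function of the indicators of the
  \<open>R j\<close>. After integration, expectations are therefore linear in the conditional
  distribution functions.\<close>

lemma level_abel_summation:
  fixes \<phi> :: "nat \<Rightarrow> real"
  assumes "nested n R"
  shows "\<phi> (level n R) = \<phi> n - (\<Sum>j<n. if R j then \<phi> (Suc j) - \<phi> j else 0)"
proof -
  let ?k = "level n R"
  have "(\<Sum>j<n. if R j then \<phi> (Suc j) - \<phi> j else 0) = (\<Sum>j\<in>{?k..<n}. \<phi> (Suc j) - \<phi> j)"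
    using level_le_iff[OF assms] by (intro sum.mono_neutral_cong_right) auto
  also have "\<dots> = \<phi> n - \<phi> ?k"
    using level_le[of n R] by (rule sum_Suc_diff')
  finally show ?thesis by simp
qed

lemma measurable_level:
  assumes "\<And>j. j < n \<Longrightarrow> Measurable.pred M (\<lambda>x. R x j)"
  shows "(\<lambda>x. level n (R x)) \<in> measurable M (count_space UNIV)"
  unfolding level_eq_sum using assms by (intro measurable_sum_nat measurable_If) (auto simp: pred_def)

section \<open>Coupling of all components by one common and \<open>d\<close> independent uniform
  variables\<close>

abbreviation cube :: "nat \<Rightarrow> (nat \<Rightarrow> real) measure" where
  "cube d \<equiv> \<Pi>\<^sub>M i\<in>{1..d}. U01"

text \<open>The \<open>i\<close>-th component of the vector below is at most \<open>j\<close> iff \<open>R i j t (w i)\<close> holds.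
  Here \<open>t\<close> drives component \<open>0\<close> and \<open>w i\<close> is the independent randomization of component \<open>i\<close>.\<close>

definition level_vec :: "nat \<Rightarrow> nat \<Rightarrow> (real \<Rightarrow> nat) \<Rightarrow> (nat \<Rightarrow> nat \<Rightarrow> real \<Rightarrow> real \<Rightarrow> bool) \<Rightarrow>
    real \<Rightarrow> (nat \<Rightarrow> real) \<Rightarrow> nat \<Rightarrow> nat" where
  "level_vec d n k R t w =
     (\<lambda>i. if i = 0 then k t else if i \<le> d then level n (\<lambda>j. R i j t (w i)) else 0)"

locale level_coupling =
  fixes d n :: nat and k :: "real \<Rightarrow> nat"
  assumes k_meas: "k \<in> measurable U01 (count_space UNIV)"
    and k_le: "k t \<le> n"
    and k_mono: "mono_on {0<..<1} k"
begin

sublocale U: prob_space U01 by (rule prob_space_unit_interval)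
sublocale UP: product_prob_space "\<lambda>_::nat. U01" "{1..d}" by standard
sublocale W: finite_product_prob_space "\<lambda>_::nat. U01" "{1..d}" by standard simp

abbreviation vec where "vec \<equiv> level_vec d n k"

definition rel_measurable :: "(nat \<Rightarrow> nat \<Rightarrow> real \<Rightarrow> real \<Rightarrow> bool) \<Rightarrow> bool" where
  "rel_measurable R \<longleftrightarrow> (\<forall>i\<in>{1..d}. \<forall>j<n.
     Measurable.pred (U01 \<Otimes>\<^sub>M U01) (\<lambda>(t, u). R i j t u))"

text \<open>These are the families under which every component is an increasing function of
  \<open>t\<close>. Rearranged families satisfy it for all \<open>t\<close> and \<open>u\<close>;
  for conditional distribution functions as such, monotonicity in \<open>t\<close> can fail and
  nestedness is known only almost everywhere.\<close>

definition rel_path :: "(nat \<Rightarrow> nat \<Rightarrow> real \<Rightarrow> real \<Rightarrow> bool) \<Rightarrow> bool" where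
  "rel_path R \<longleftrightarrow> rel_measurable R \<and> (\<forall>i\<in>{1..d}. (\<forall>t u. nested n (\<lambda>j. R i j t u)) \<and>
     (\<forall>j<n. \<forall>t u. \<forall>s\<le>t. R i j t u \<longrightarrow> R i j s u))"

text \<open>The inner integral runs over \<open>t\<close> because rearrangement acts on
  \<open>t\<close> with \<open>w\<close> fixed.\<close>

definition E :: "((nat \<Rightarrow> nat) \<Rightarrow> real) \<Rightarrow> (nat \<Rightarrow> nat \<Rightarrow> real \<Rightarrow> real \<Rightarrow> bool) \<Rightarrow> real" where
  "E g R = (LINT w|cube d. LINT t|U01. g (vec R t w))"

lemma vec_le: "vec R t w i \<le> n"
  using k_le level_le by (simp add: level_vec_def)

lemma vec_off: "d < i \<Longrightarrow> vec R t w i = 0"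
  by (simp add: level_vec_def)

lemma vec_bounded:
  fixes g :: "(nat \<Rightarrow> nat) \<Rightarrow> real"
  shows "\<exists>C. \<forall>R t w. \<bar>g (vec R t w)\<bar> \<le> C"
proof -
  let ?V = "{l :: nat \<Rightarrow> nat. (\<forall>i. l i \<le> n) \<and> (\<forall>i>d. l i = 0)}"
  have "\<bar>g (vec R t w)\<bar> \<le> (\<Sum>l\<in>?V. \<bar>g l\<bar>)" for R t w
    using vec_le vec_off
    by (intro member_le_sum[where f = "\<lambda>l. \<bar>g l\<bar>", OF _ _ finite_bounded_vectors]) auto
  then show ?thesis by blast
qed

lemma measurable_vec:
  assumes R: "rel_measurable R"
  shows "(\<lambda>x. vec R (snd x) (fst x) i) \<in> measurable (cube d \<Otimes>\<^sub>M U01) (count_space UNIV)"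
proof -
  consider "i = 0" | "i \<in> {1..d}" | "d < i" by fastforce
  then show ?thesis
  proof cases
    case 1
    then show ?thesis using k_meas by (simp add: level_vec_def)
  next
    case 2
    have [measurable]: "(\<lambda>x. (snd x, fst x i)) \<in> measurable (cube d \<Otimes>\<^sub>M U01) (U01 \<Otimes>\<^sub>M U01)"
      using 2 by measurable
    have "(\<lambda>x. level n (\<lambda>j. R i j (snd x) (fst x i))) \<in> measurable (cube d \<Otimes>\<^sub>M U01) (count_space UNIV)"
    proof (rule measurable_level)
      fix j assume "j < n"
      with R 2 have "Measurable.pred (U01 \<Otimes>\<^sub>M U01) (\<lambda>(t, u). R i j t u)"
        by (auto simp: rel_measurable_def)
      from measurable_compose[OF \<open>(\<lambda>x. (snd x, fst x i)) \<in> _\<close> this]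
      show "Measurable.pred (cube d \<Otimes>\<^sub>M U01) (\<lambda>x. R i j (snd x) (fst x i))" by simp
    qed
    with 2 show ?thesis by (simp add: level_vec_def)
  next
    case 3
    then show ?thesis by (simp add: level_vec_def)
  qed
qed

lemma borel_measurable_vec:
  assumes "rel_measurable R"
  shows "(\<lambda>x. g (vec R (snd x) (fst x)) :: real) \<in> borel_measurable (cube d \<Otimes>\<^sub>M U01)"
proof -
  interpret pair_prob_space "cube d" U01 ..
  show ?thesis
    by (rule borel_measurable_bounded_vector[where n = n and d = d])
       (use measurable_vec[OF assms] vec_le vec_off in auto)
qed

lemma borel_measurable_vec_section:
  assumes "rel_measurable R" "w \<in> space (cube d)"
  shows "(\<lambda>t. g (vec R t w) :: real) \<in> borel_measurable U01"
  using measurable_compose_Pair1[OF assms(2) borel_measurable_vec[OF assms(1)]] by simp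

lemma integrable_vec_section:
  fixes g :: "(nat \<Rightarrow> nat) \<Rightarrow> real"
  assumes "rel_measurable R" "w \<in> space (cube d)"
  shows "integrable U01 (\<lambda>t. g (vec R t w))"
proof -
  obtain C where "\<And>R t w. \<bar>g (vec R t w)\<bar> \<le> C"
    using vec_bounded[of g] by blast
  with borel_measurable_vec_section[OF assms] show ?thesis
    by (intro integrable_bounded_unit_interval) auto
qed

lemma borel_measurable_vec_marginal:
  assumes "rel_measurable R"
  shows "(\<lambda>w. LINT t|U01. g (vec R t w) :: real) \<in> borel_measurable (cube d)"
  using borel_measurable_vec[OF assms, of g]
  by (intro U.borel_measurable_lebesgue_integral) (simp add: case_prod_beta')

lemma vec_marginal_bounded:
  assumes "rel_measurable R" "w \<in> space (cube d)" "\<And>R t w. \<bar>g (vec R t w) :: real\<bar> \<le> C"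
  shows "\<bar>LINT t|U01. g (vec R t w)\<bar> \<le> C"
proof -
  have "\<bar>LINT t|U01. g (vec R t w)\<bar> \<le> (LINT t|U01. \<bar>g (vec R t w)\<bar>)"
    by (rule integral_abs_bound)
  also have "\<dots> \<le> (LINT t|U01. C)"
    using assms integrable_vec_section[OF assms(1,2)] by (intro integral_mono) auto
  also have "\<dots> = C" using U.prob_space by simp
  finally show ?thesis .
qed

lemma integrable_vec_marginal:
  fixes g :: "(nat \<Rightarrow> nat) \<Rightarrow> real"
  assumes "rel_measurable R"
  shows "integrable (cube d) (\<lambda>w. LINT t|U01. g (vec R t w))"
proof -
  obtain C where "\<And>R t w. \<bar>g (vec R t w)\<bar> \<le> C"
    using vec_bounded[of g] by blast
  with borel_measurable_vec_marginal[OF assms] vec_marginal_bounded[OF assms] show ?thesis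
    by (intro UP.P.integrable_const_bound[where B = C]) auto
qed

lemma E_swap:
  fixes g :: "(nat \<Rightarrow> nat) \<Rightarrow> real"
  assumes "rel_measurable R"
  shows "E g R = (LINT t|U01. LINT w|cube d. g (vec R t w))"
proof -
  interpret pair_prob_space "cube d" U01 ..
  obtain C where "\<And>R t w. \<bar>g (vec R t w)\<bar> \<le> C"
    using vec_bounded[of g] by blast
  with borel_measurable_vec[OF assms, of g]
  have "integrable (cube d \<Otimes>\<^sub>M U01) (\<lambda>(w, t). g (vec R t w))"
    by (intro integrable_const_bound[where B = C]) (auto simp: case_prod_beta')
  from Fubini_integral[OF this] show ?thesis by (simp add: E_def)
qed

lemma mono_on_vec:
  assumes "rel_path R" shows "mono_on {0<..<1} (\<lambda>t. vec R t w)"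
proof (rule mono_onI, rule le_funI)
  fix s t :: real and i
  assume "s \<in> {0<..<1}" "t \<in> {0<..<1}" "s \<le> t"
  with assms mono_onD[OF k_mono, of s t] show "vec R s w i \<le> vec R t w i"
    by (auto simp: level_vec_def rel_path_def intro!: level_antimono)
qed

text \<open>This is the conditional quantile transform: for uniform \<open>u\<close> and
  \<open>F i j t\<close> in [0, 1], the relation holds with probability
  \<open>F i j t\<close>.\<close>

definition cdf_rel :: "(nat \<Rightarrow> nat \<Rightarrow> real \<Rightarrow> real) \<Rightarrow> nat \<Rightarrow> nat \<Rightarrow> real \<Rightarrow> real \<Rightarrow> bool" where
  "cdf_rel F i j t u \<longleftrightarrow> u \<le> F i j t"

end

text \<open>As a function of \<open>w\<close>, this is a generalized inverse of the decreasing
  rearrangement of \<open>h\<close>.\<close>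

definition superlevel_measure :: "(real \<Rightarrow> real) \<Rightarrow> real \<Rightarrow> real" where
  "superlevel_measure h w = measure U01 {t \<in> {0<..<1}. w \<le> h t}"

lemma sets_superlevel:
  fixes h :: "real \<Rightarrow> real"
  assumes "h \<in> borel_measurable U01"
  shows "{t \<in> {0<..<1}. w \<le> h t} \<in> sets U01"
proof -
  have "h -` {w..} \<inter> space U01 \<in> sets U01"
    by (rule measurable_sets[OF assms]) simp
  also have "h -` {w..} \<inter> space U01 = {t \<in> {0<..<1}. w \<le> h t}" by auto
  finally show ?thesis .
qed

lemma superlevel_measure_bounds: "0 \<le> superlevel_measure h w" "superlevel_measure h w \<le> 1"
  using prob_space.prob_le_1[OF prob_space_unit_interval] by (auto simp: superlevel_measure_def)

lemma superlevel_measure_antimono: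
  assumes "h \<in> borel_measurable U01" "w \<le> w'"
  shows "superlevel_measure h w' \<le> superlevel_measure h w"
proof -
  interpret prob_space U01 by (rule prob_space_unit_interval)
  show ?thesis
    unfolding superlevel_measure_def using assms sets_superlevel by (intro finite_measure_mono) auto
qed

lemma borel_measurable_superlevel_measure [measurable]:
  assumes "h \<in> borel_measurable U01"
  shows "superlevel_measure h \<in> borel_measurable borel"
proof -
  have "mono (\<lambda>w. - superlevel_measure h w)"
    using superlevel_measure_antimono[OF assms] by (auto simp: mono_def)
  then have "(\<lambda>w. - superlevel_measure h w) \<in> borel_measurable borel"
    by (rule borel_measurable_mono)
  then show ?thesis by simp
qed

lemma superlevel_measure_mono_AE:
  assumes "h' \<in> borel_measurable U01" "AE t in U01. h t \<le> h' t"
  shows "superlevel_measure h w \<le> superlevel_measure h' w"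
proof -
  interpret prob_space U01 by (rule prob_space_unit_interval)
  show ?thesis
    unfolding superlevel_measure_def
    using assms sets_superlevel by (intro finite_measure_mono_AE) (auto elim!: eventually_mono)
qed

text \<open>Monotonicity in \<open>j\<close> is only almost sure because each \<open>F i j\<close>
  comes from a separately chosen version of a conditional probability.\<close>

definition conditional_cdfs :: "nat \<Rightarrow> nat \<Rightarrow> (nat \<Rightarrow> nat \<Rightarrow> real \<Rightarrow> real) \<Rightarrow> bool" where
  "conditional_cdfs d n F \<longleftrightarrow> (\<forall>i\<in>{1..d}. (\<forall>j<n. F i j \<in> borel_measurable U01) \<and>
     (\<forall>j. Suc j < n \<longrightarrow> (AE t in U01. F i j t \<le> F i (Suc j) t)))"

section \<open>Increasing rearrangement with the randomization held fixed\<close>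

context level_coupling begin

text \<open>The rearranged vector: for fixed \<open>u\<close>, the increasing rearrangement in \<open>t\<close>.\<close>

definition star_rel :: "(nat \<Rightarrow> nat \<Rightarrow> real \<Rightarrow> real) \<Rightarrow> nat \<Rightarrow> nat \<Rightarrow> real \<Rightarrow> real \<Rightarrow> bool" where
  "star_rel F i j t u \<longleftrightarrow> t \<le> superlevel_measure (F i j) u"

lemma rel_measurable_cdf_rel:
  assumes "conditional_cdfs d n F" shows "rel_measurable (cdf_rel F)"
  unfolding rel_measurable_def cdf_rel_def
proof (intro ballI allI impI)
  fix i j assume "i \<in> {1..d}" "j < n"
  with assms have [measurable]: "F i j \<in> borel_measurable U01"
    by (auto simp: conditional_cdfs_def)
  show "Measurable.pred (U01 \<Otimes>\<^sub>M U01) (\<lambda>(t, u). u \<le> F i j t)"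
    by measurable
qed

lemma rel_path_star_rel:
  assumes "conditional_cdfs d n F" shows "rel_path (star_rel F)"
  unfolding rel_path_def
proof (intro conjI ballI allI impI)
  show "rel_measurable (star_rel F)"
    unfolding rel_measurable_def star_rel_def
  proof (intro ballI allI impI)
    fix i j assume "i \<in> {1..d}" "j < n"
    with assms have [measurable]: "F i j \<in> borel_measurable U01"
      by (auto simp: conditional_cdfs_def)
    show "Measurable.pred (U01 \<Otimes>\<^sub>M U01) (\<lambda>(t, u). t \<le> superlevel_measure (F i j) u)"
      by measurable
  qed
next
  fix i t u assume "i \<in> {1..d}"
  then have "superlevel_measure (F i j) u \<le> superlevel_measure (F i (Suc j)) u" if "Suc j < n" for j
    using assms that by (intro superlevel_measure_mono_AE) (auto simp: conditional_cdfs_def)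
  then show "nested n (\<lambda>j. star_rel F i j t u)"
    unfolding nested_def star_rel_def by (auto intro: order_trans)
qed (auto simp: star_rel_def)

lemma star_rel_antimono:
  assumes "conditional_cdfs d n F" "i \<in> {1..d}" "j < n" "star_rel F i j t u" "u' \<le> u"
  shows "star_rel F i j t u'"
  using assms superlevel_measure_antimono[of "F i j" u' u]
  by (auto simp: star_rel_def conditional_cdfs_def)

text \<open>For fixed \<open>w\<close> the two vectors have, component by component, the same
  distribution in \<open>t\<close>, and the second one is increasing in \<open>t\<close>. So
  \<open>comonotone_rearrangement\<close> applies pointwise in \<open>w\<close>.\<close>

lemma E_le_E_star:
  assumes F: "conditional_cdfs d n F" and g: "nat_supermodular g"
  shows "E g (cdf_rel F) \<le> E g (star_rel F)"
  unfolding E_def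
proof (rule integral_mono)
  note mR = rel_measurable_cdf_rel[OF F]
  have pS: "rel_path (star_rel F)" by (rule rel_path_star_rel[OF F])
  then have mS: "rel_measurable (star_rel F)" by (simp add: rel_path_def)
  show "integrable (cube d) (\<lambda>w. LINT t|U01. g (vec (cdf_rel F) t w))"
    "integrable (cube d) (\<lambda>w. LINT t|U01. g (vec (star_rel F) t w))"
    by (rule integrable_vec_marginal mR mS)+
  fix w assume w: "w \<in> space (cube d)"
  have meas: "(\<lambda>t. vec R t w i) \<in> measurable U01 (count_space UNIV)" if "rel_measurable R" for R i
    using measurable_compose_Pair1[OF w measurable_vec[OF that]] by simp
  have sets_le: "{t \<in> space U01. vec R t w i \<le> b} \<in> sets U01"
    if "rel_measurable R" for R i b
  proof -
    have "(\<lambda>t. vec R t w i) -` {..b} \<inter> space U01 \<in> sets U01"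
      by (rule measurable_sets[OF meas[OF that]]) simp
    also have "(\<lambda>t. vec R t w i) -` {..b} \<inter> space U01 = {t \<in> space U01. vec R t w i \<le> b}"
      by auto
    finally show ?thesis .
  qed
  \<comment> \<open>For \<open>1 \<le> i \<le> d\<close> and \<open>c < n\<close>, both sides equal
    \<open>superlevel_measure (F i c) (w i)\<close>: on the left because almost surely the level is
    at most \<open>c\<close> iff \<open>w i \<le> F i c t\<close>, on the right because the
    rearranged event is an initial interval of that length.\<close>
  have le: "measure U01 {t \<in> space U01. vec (cdf_rel F) t w i \<le> c} =
      measure U01 {t \<in> space U01. vec (star_rel F) t w i \<le> c}" for i c
  proof -
    consider "i = 0" | "d < i" | "n \<le> c" | "i \<in> {1..d}" "c < n" by fastforce
    then show ?thesis
    proof cases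
      case 1
      then show ?thesis by (simp add: level_vec_def)
    next
      case 2
      then show ?thesis by (simp add: vec_off)
    next
      case 3
      have "vec R t w i \<le> c" for R t using order_trans[OF vec_le 3] .
      then show ?thesis by simp
    next
      case 4
      have "AE t in U01. \<forall>j. Suc j < n \<longrightarrow> F i j t \<le> F i (Suc j) t"
        using F 4 by (auto simp: conditional_cdfs_def AE_all_countable)
      then have "AE t in U01. vec (cdf_rel F) t w i \<le> c \<longleftrightarrow> w i \<le> F i c t"
      proof eventually_elim
        case (elim t)
        then have "nested n (\<lambda>j. cdf_rel F i j t (w i))"
          by (auto simp: nested_def cdf_rel_def)
        from level_le_iff[OF this 4(2)] 4(1) show ?case
          by (simp add: level_vec_def cdf_rel_def)
      qed
      moreover have "{t \<in> space U01. vec (cdf_rel F) t w i \<le> c} \<in> sets U01"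
        by (rule sets_le[OF mR])
      moreover have "F i c \<in> borel_measurable U01"
        using F 4 by (auto simp: conditional_cdfs_def)
      ultimately have "measure U01 {t \<in> space U01. vec (cdf_rel F) t w i \<le> c} =
          superlevel_measure (F i c) (w i)"
        unfolding superlevel_measure_def
      proof (intro U.finite_measure_eq_AE)
        assume "AE t in U01. vec (cdf_rel F) t w i \<le> c \<longleftrightarrow> w i \<le> F i c t"
        then show "AE t in U01. (t \<in> {t \<in> space U01. vec (cdf_rel F) t w i \<le> c}) \<longleftrightarrow>
            (t \<in> {t \<in> {0<..<1}. w i \<le> F i c t})"
          by eventually_elim simp
      qed ((rule sets_superlevel)?, assumption)+
      also have "\<dots> = measure U01 {t \<in> {0<..<1}. t \<le> superlevel_measure (F i c) (w i)}"
        by (rule measure_unit_interval_le[symmetric]) (rule superlevel_measure_bounds)+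
      also have "{t \<in> {0<..<1}. t \<le> superlevel_measure (F i c) (w i)} =
          {t \<in> space U01. vec (star_rel F) t w i \<le> c}"
      proof -
        have "nested n (\<lambda>j. star_rel F i j t (w i))" for t
          using pS 4 by (auto simp: rel_path_def)
        from level_le_iff[OF this 4(2)] 4(1) show ?thesis
          by (auto simp: level_vec_def star_rel_def)
      qed
      finally show ?thesis .
    qed
  qed
  show "(LINT t|U01. g (vec (cdf_rel F) t w)) \<le> (LINT t|U01. g (vec (star_rel F) t w))"
  proof (rule comonotone_rearrangement[OF g, where d = d and n = n])
    fix i c
    show "measure U01 {t \<in> space U01. vec (cdf_rel F) t w i = c} =
      measure U01 {t \<in> space U01. vec (star_rel F) t w i = c}"
    proof (cases c)
      case 0
      then show ?thesis using le[of i 0] by simp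
    next
      case (Suc c')
      have "measure U01 {t \<in> space U01. vec R t w i = c} =
          measure U01 {t \<in> space U01. vec R t w i \<le> c} -
          measure U01 {t \<in> space U01. vec R t w i \<le> c'}"
        if "rel_measurable R" for R
      proof -
        have sets: "{t \<in> space U01. vec R t w i \<le> b} \<in> sets U01" for b
          by (rule sets_le[OF that])
        have "{t \<in> space U01. vec R t w i = c} =
            {t \<in> space U01. vec R t w i \<le> c} - {t \<in> space U01. vec R t w i \<le> c'}"
          using Suc by auto
        moreover have "{t \<in> space U01. vec R t w i \<le> c'} \<subseteq> {t \<in> space U01. vec R t w i \<le> c}"
          using Suc by auto
        ultimately show ?thesis
          using U.finite_measure_Diff[OF sets sets] by simp
      qed
      from this[OF mR] this[OF mS] show ?thesis unfolding le by simp
    qed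
  qed (rule meas mR mS vec_le mono_on_vec[OF pS] vec_off, assumption?)+
qed

text \<open>With \<open>G i j\<close> decreasing off a null set, the event
  \<open>w i \<le> G i j t\<close> is already an initial interval in \<open>t\<close> almost
  everywhere and coincides with its rearrangement. This is where the stochastic monotonicity of the
  components of \<open>Y\<close> enters.\<close>

lemma E_eq_E_star:
  assumes G: "conditional_cdfs d n G"
    and decr: "\<And>i j. i \<in> {1..d} \<Longrightarrow> j < n \<Longrightarrow>
      \<exists>A. (AE t in U01. t \<in> A) \<and> antimono_on (A \<inter> {0<..<1}) (G i j)"
  shows "E g (cdf_rel G) = E g (star_rel G)"
  unfolding E_def
proof (rule Bochner_Integration.integral_cong[OF refl])
  note mR = rel_measurable_cdf_rel[OF G]
  have mS: "rel_measurable (star_rel G)" using rel_path_star_rel[OF G] by (simp add: rel_path_def)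
  fix w assume w: "w \<in> space (cube d)"
  have "AE t in U01. cdf_rel G i j t (w i) \<longleftrightarrow> star_rel G i j t (w i)"
    if ij: "i \<in> {1..d}" "j < n" for i j
  proof -
    obtain A where A: "AE t in U01. t \<in> A" "antimono_on (A \<inter> {0<..<1}) (G i j)"
      using decr[OF ij] by blast
    have [measurable]: "G i j \<in> borel_measurable U01"
      using G ij by (auto simp: conditional_cdfs_def)
    show ?thesis
      unfolding cdf_rel_def star_rel_def superlevel_measure_def
    proof (rule unit_interval_downset_AE[OF _ A(1)])
      fix s t assume "s \<in> A \<inter> {0<..<1}" "t \<in> A \<inter> {0<..<1}" "s < t" "w i \<le> G i j t"
      with A(2) have "G i j t \<le> G i j s" by (auto simp: monotone_on_def)
      with \<open>w i \<le> G i j t\<close> show "w i \<le> G i j s" by simp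
    qed measurable
  qed
  then have "AE t in U01. \<forall>i\<in>{1..d}. \<forall>j\<in>{..<n}. cdf_rel G i j t (w i) \<longleftrightarrow> star_rel G i j t (w i)"
    by (intro AE_finite_allI) auto
  then have "AE t in U01. vec (cdf_rel G) t w = vec (star_rel G) t w"
    by eventually_elim (auto simp: level_vec_def fun_eq_iff intro!: level_cong)
  then show "(LINT t|U01. g (vec (cdf_rel G) t w)) = (LINT t|U01. g (vec (star_rel G) t w))"
    by (intro integral_cong_AE borel_measurable_vec_section mR mS w) (auto elim!: eventually_mono)
qed

end

section \<open>Exchange of the conditional distribution functions of one component\<close>

lemma nat_supermodular_increasing_differences:
  assumes g: "nat_supermodular g" and xy: "x \<le> y" and ab: "a \<le> b"
  shows "g (x(i := b)) - g (x(i := a)) \<le> g (y(i := b)) - g (y(i := a))"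
proof -
  have "inf (x(i := b)) (y(i := a)) = x(i := a)" "sup (x(i := b)) (y(i := a)) = y(i := b)"
    using xy ab by (auto simp: fun_eq_iff le_fun_def inf_absorb1 inf_absorb2 sup_absorb1 sup_absorb2)
  with g have "g (x(i := b)) + g (y(i := a)) \<le> g (x(i := a)) + g (y(i := b))"
    by (metis nat_supermodular_def)
  then show ?thesis by simp
qed

context level_coupling begin

lemma borel_measurable_rel:
  assumes "rel_measurable R" "i \<in> {1..d}" "j < n"
  shows "(\<lambda>(t, u). of_bool (R i j t u) :: real) \<in> borel_measurable (U01 \<Otimes>\<^sub>M U01)"
proof -
  have "Measurable.pred (U01 \<Otimes>\<^sub>M U01) (\<lambda>(t, u). R i j t u)"
    using assms by (auto simp: rel_measurable_def)
  from measurable_compose[OF this, of of_bool borel] show ?thesis by (simp add: case_prod_beta')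
qed

text \<open>For nested families and \<open>j < n\<close>, the conditional probability given
  \<open>t\<close> that component \<open>i\<close> is at most \<open>j\<close>.\<close>

definition rel_prob :: "(nat \<Rightarrow> nat \<Rightarrow> real \<Rightarrow> real \<Rightarrow> bool) \<Rightarrow> nat \<Rightarrow> nat \<Rightarrow> real \<Rightarrow> real" where
  "rel_prob R i j t = (LINT u|U01. of_bool (R i j t u))"

lemma borel_measurable_rel_prob:
  assumes "rel_measurable R" "i \<in> {1..d}" "j < n"
  shows "rel_prob R i j \<in> borel_measurable U01"
  unfolding rel_prob_def[abs_def]
  by (rule U.borel_measurable_lebesgue_integral[OF borel_measurable_rel[OF assms]])

lemma rel_prob_bounded:
  assumes "rel_measurable R" "i \<in> {1..d}" "j < n" "t \<in> {0<..<1}"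
  shows "\<bar>rel_prob R i j t\<bar> \<le> 1"
proof -
  have "(\<lambda>u. of_bool (R i j t u) :: real) \<in> borel_measurable U01"
    using measurable_compose_Pair1[OF _ borel_measurable_rel[OF assms(1-3)], of t] assms(4) by simp
  then have "rel_prob R i j t \<le> (LINT u|U01. 1)"
    unfolding rel_prob_def by (intro integral_mono integrable_bounded_unit_interval[where C = 1]) auto
  moreover have "0 \<le> rel_prob R i j t" unfolding rel_prob_def by (intro integral_nonneg_AE) auto
  ultimately show ?thesis using U.prob_space by simp
qed

text \<open>\<open>\<phi> t l\<close> will be the test function with component \<open>i\<close> at
  level \<open>l\<close> and all others frozen at their values for \<open>t\<close>.
  \<open>level_abel_summation\<close> under the integral confines the dependence on \<open>R\<close>
  to the terms \<open>rel_prob R i j\<close>, which enter linearly.\<close>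

lemma integral_level_swap:
  fixes \<phi> :: "real \<Rightarrow> nat \<Rightarrow> real"
  assumes R: "rel_path R" and i: "i \<in> {1..d}"
    and \<phi>: "\<And>l. (\<lambda>t. \<phi> t l) \<in> borel_measurable U01" and C: "\<And>t l. \<bar>\<phi> t l\<bar> \<le> C"
  shows "(LINT u|U01. LINT t|U01. \<phi> t (level n (\<lambda>j. R i j t u))) =
    (LINT t|U01. \<phi> t n) - (\<Sum>j<n. LINT t|U01.
       (\<phi> t (Suc j) - \<phi> t j) * rel_prob R i j t)"
proof -
  note [measurable] = \<phi>
  have C0: "0 \<le> C" using C[of 0 0] by simp
  have mR: "rel_measurable R" using R by (simp add: rel_path_def)
  note rel_m = borel_measurable_rel[OF mR i]
  have ob_m: "(\<lambda>u. of_bool (R i j t u) :: real) \<in> borel_measurable U01" if "j < n" "t \<in> {0<..<1}" for j t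
    using measurable_compose_Pair1[OF _ rel_m[OF that(1)], of t] that(2) by simp
  have ob_int: "integrable U01 (\<lambda>u. of_bool (R i j t u) :: real)" if "j < n" "t \<in> {0<..<1}" for j t
    using ob_m[OF that] by (intro integrable_bounded_unit_interval[where C = 1]) auto
  let ?f = "\<lambda>t u. \<phi> t n - (\<Sum>j<n. (\<phi> t (Suc j) - \<phi> t j) * of_bool (R i j t u))"
  have abel: "\<phi> t (level n (\<lambda>j. R i j t u)) = ?f t u" for t u
  proof -
    have "nested n (\<lambda>j. R i j t u)" using R i by (auto simp: rel_path_def)
    from level_abel_summation[OF this, of "\<phi> t"] show ?thesis
      by (simp add: of_bool_def if_distrib cong: if_cong)
  qed
  have "(LINT u|U01. LINT t|U01. \<phi> t (level n (\<lambda>j. R i j t u))) =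
      (LINT t|U01. LINT u|U01. \<phi> t (level n (\<lambda>j. R i j t u)))"
  proof (rule integral_unit_interval_swap[where C = C])
    have "(\<lambda>x. ?f (fst x) (snd x)) \<in> borel_measurable (U01 \<Otimes>\<^sub>M U01)"
      using rel_m by (intro borel_measurable_diff borel_measurable_sum borel_measurable_times)
        (auto simp: case_prod_beta')
    then show "(\<lambda>(t, u). \<phi> t (level n (\<lambda>j. R i j t u))) \<in> borel_measurable (U01 \<Otimes>\<^sub>M U01)"
      unfolding abel by (simp add: case_prod_beta')
  qed (rule C)
  also have "\<dots> = (LINT t|U01. \<phi> t n - (\<Sum>j<n. (\<phi> t (Suc j) - \<phi> t j) * rel_prob R i j t))"
  proof (rule Bochner_Integration.integral_cong[OF refl])
    fix t assume "t \<in> space U01"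
    then have t: "t \<in> {0<..<1}" by simp
    have "(LINT u|U01. ?f t u) = (LINT u|U01. \<phi> t n) -
        (LINT u|U01. (\<Sum>j<n. (\<phi> t (Suc j) - \<phi> t j) * of_bool (R i j t u)))"
      using ob_int t by (intro Bochner_Integration.integral_diff Bochner_Integration.integrable_sum) auto
    also have "(LINT u|U01. (\<Sum>j<n. (\<phi> t (Suc j) - \<phi> t j) * of_bool (R i j t u))) =
        (\<Sum>j<n. (LINT u|U01. (\<phi> t (Suc j) - \<phi> t j) * of_bool (R i j t u)))"
      using ob_int t by (intro Bochner_Integration.integral_sum) auto
    finally show "(LINT u|U01. \<phi> t (level n (\<lambda>j. R i j t u))) =
        \<phi> t n - (\<Sum>j<n. (\<phi> t (Suc j) - \<phi> t j) * rel_prob R i j t)"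
      unfolding abel using U.prob_space by (simp add: rel_prob_def)
  qed
  also have "\<dots> = (LINT t|U01. \<phi> t n) - (\<Sum>j<n. LINT t|U01.
       (\<phi> t (Suc j) - \<phi> t j) * rel_prob R i j t)"
  proof -
    have "integrable U01 (\<lambda>t. (\<phi> t (Suc j) - \<phi> t j) * rel_prob R i j t)"
      if "j < n" for j
    proof (rule integrable_bounded_unit_interval[where C = "2 * C"])
      show "(\<lambda>t. (\<phi> t (Suc j) - \<phi> t j) * rel_prob R i j t) \<in> borel_measurable U01"
        using borel_measurable_rel_prob[OF mR i that] by measurable
      fix t :: real assume "t \<in> {0<..<1}"
      have "\<bar>(\<phi> t (Suc j) - \<phi> t j) * rel_prob R i j t\<bar> \<le> (2 * C) * 1"
        unfolding abs_mult using C[of t "Suc j"] C[of t j] C0 rel_prob_bounded[OF mR i that \<open>t \<in> _\<close>]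
        by (intro mult_mono) auto
      then show "\<bar>(\<phi> t (Suc j) - \<phi> t j) * rel_prob R i j t\<bar> \<le> 2 * C" by simp
    qed
    then have int: "integrable U01 (\<lambda>t. (\<phi> t (Suc j) - \<phi> t j) * rel_prob R i j t)"
      if "j \<in> {..<n}" for j using that by simp
    have "integrable U01 (\<lambda>t. \<phi> t n)"
      using C by (intro integrable_bounded_unit_interval[where C = C]) auto
    then have "(LINT t|U01. \<phi> t n - (\<Sum>j<n. (\<phi> t (Suc j) - \<phi> t j) * rel_prob R i j t)) =
        (LINT t|U01. \<phi> t n) - (LINT t|U01. (\<Sum>j<n. (\<phi> t (Suc j) - \<phi> t j) * rel_prob R i j t))"
      by (intro Bochner_Integration.integral_diff Bochner_Integration.integrable_sum int)
    also have "(LINT t|U01. (\<Sum>j<n. (\<phi> t (Suc j) - \<phi> t j) * rel_prob R i j t)) =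
      (\<Sum>j<n. LINT t|U01. (\<phi> t (Suc j) - \<phi> t j) * rel_prob R i j t)"
      by (intro Bochner_Integration.integral_sum int)
    finally show ?thesis .
  qed
  finally show ?thesis .
qed

text \<open>A concordance order for the pair of T and the level of one component: the probability
  that \<open>t \<le> x\<close> and the level is at most \<open>j\<close> grows, while the law of
  the level is kept. It is the form in which the Schur order is used for rearranged
  families.\<close>

definition rel_concordance_le :: "(nat \<Rightarrow> real \<Rightarrow> real \<Rightarrow> bool) \<Rightarrow> (nat \<Rightarrow> real \<Rightarrow> real \<Rightarrow> bool) \<Rightarrow> bool" where
  "rel_concordance_le A B \<longleftrightarrow> (\<forall>j<n.
     (\<forall>x\<in>{0<..<1}. (LINT u|U01. LINT t|U01. of_bool (t \<le> x \<and> A j t u) :: real)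
        \<le> (LINT u|U01. LINT t|U01. of_bool (t \<le> x \<and> B j t u))) \<and>
     (LINT u|U01. LINT t|U01. of_bool (A j t u) :: real)
        = (LINT u|U01. LINT t|U01. of_bool (B j t u)))"

text \<open>The integrals over (0, x] of \<open>rel_prob A i j - rel_prob B i j\<close> are
  nonpositive and the total is zero, so an increasing weight gives a nonnegative integral. More
  concordance means that \<open>B\<close> has its mass at smaller \<open>t\<close>, where the weight
  is smaller.\<close>

lemma integral_weight_concordance:
  fixes \<delta> :: "real \<Rightarrow> real"
  assumes A: "rel_measurable A" and B: "rel_measurable B" and ij: "i \<in> {1..d}" "j < n"
    and AB: "rel_concordance_le (A i) (B i)"
    and \<delta>: "mono_on {0<..<1} \<delta>" "\<delta> \<in> borel_measurable U01" "\<And>t. t \<in> {0<..<1} \<Longrightarrow> \<bar>\<delta> t\<bar> \<le> C"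
  shows "(LINT t|U01. \<delta> t * rel_prob B i j t) \<le>
    (LINT t|U01. \<delta> t * rel_prob A i j t)"
proof -
  define K where "K R = rel_prob R i j" for R
  have K: "K R \<in> borel_measurable U01" "\<And>t. t \<in> {0<..<1} \<Longrightarrow> \<bar>K R t\<bar> \<le> 1"
    "(LINT t|U01. K R t) = (LINT u|U01. LINT t|U01. of_bool (R i j t u))"
    "\<And>x. (LINT t|U01. (if t \<le> x then K R t else 0)) =
       (LINT u|U01. LINT t|U01. of_bool (t \<le> x \<and> R i j t u))"
    if R: "rel_measurable R" for R
  proof -
    note m = borel_measurable_rel[OF R ij]
    show "K R \<in> borel_measurable U01"
      unfolding K_def by (rule borel_measurable_rel_prob[OF R ij])
    show "\<bar>K R t\<bar> \<le> 1" if "t \<in> {0<..<1}" for t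
      unfolding K_def by (rule rel_prob_bounded[OF R ij that])
    show "(LINT t|U01. K R t) = (LINT u|U01. LINT t|U01. of_bool (R i j t u))"
      unfolding K_def rel_prob_def by (rule integral_unit_interval_swap[OF m, where C = 1, symmetric]) auto
    fix x :: real
    have "(\<lambda>y. of_bool (fst y \<le> x) * of_bool (R i j (fst y) (snd y)) :: real) \<in> borel_measurable (U01 \<Otimes>\<^sub>M U01)"
      using m by (intro borel_measurable_times) (auto simp: case_prod_beta')
    then have m': "(\<lambda>(t, u). of_bool (t \<le> x \<and> R i j t u) :: real) \<in> borel_measurable (U01 \<Otimes>\<^sub>M U01)"
      by (simp add: case_prod_beta' of_bool_conj)
    have "(LINT t|U01. (if t \<le> x then K R t else 0)) =
        (LINT t|U01. LINT u|U01. of_bool (t \<le> x \<and> R i j t u))"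
      by (intro Bochner_Integration.integral_cong) (auto simp: K_def rel_prob_def)
    also have "\<dots> = (LINT u|U01. LINT t|U01. of_bool (t \<le> x \<and> R i j t u))"
      by (rule integral_unit_interval_swap[OF m', where C = 1, symmetric]) auto
    finally show "(LINT t|U01. (if t \<le> x then K R t else 0)) =
       (LINT u|U01. LINT t|U01. of_bool (t \<le> x \<and> R i j t u))" .
  qed
  note [measurable] = K(1)[OF A] K(1)[OF B] \<delta>(2)
  have Kint: "integrable U01 (K A)" "integrable U01 (K B)"
    "\<And>x. integrable U01 (\<lambda>t. if t \<le> x then K A t else 0)"
    "\<And>x. integrable U01 (\<lambda>t. if t \<le> x then K B t else 0)"
    using K(2)[OF A] K(2)[OF B] by (auto intro!: integrable_bounded_unit_interval[where C = 1])
  have \<delta>K: "integrable U01 (\<lambda>t. \<delta> t * K R t)" if "rel_measurable R" for R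
  proof (rule integrable_bounded_unit_interval[where C = C])
    show "(\<lambda>t. \<delta> t * K R t) \<in> borel_measurable U01"
      using K(1)[OF that] by measurable
    fix t :: real assume t: "t \<in> {0<..<1}"
    then have "\<bar>\<delta> t * K R t\<bar> \<le> C * 1"
      unfolding abs_mult using \<delta>(3)[OF t] K(2)[OF that t] by (intro mult_mono) auto
    then show "\<bar>\<delta> t * K R t\<bar> \<le> C" by simp
  qed
  have "0 \<le> (LINT t|U01. \<delta> t * (K A t - K B t))"
  proof (rule integral_increasing_weight_nonneg[OF \<delta>(1,2) _ \<delta>(3), where B = 2])
    show "\<bar>K A t - K B t\<bar> \<le> 2" if "t \<in> {0<..<1}" for t
      using K(2)[OF A that] K(2)[OF B that] by simp
    show "(LINT t|U01. K A t - K B t) = 0"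
      using Kint K(3)[OF A] K(3)[OF B] AB ij by (simp add: rel_concordance_le_def)
    fix x :: real assume x: "x \<in> {0<..<1}"
    have "(LINT t|U01. (if t \<le> x then K A t - K B t else 0)) =
        (LINT t|U01. (if t \<le> x then K A t else 0) - (if t \<le> x then K B t else 0))"
      by (intro Bochner_Integration.integral_cong) auto
    also have "\<dots> = (LINT t|U01. (if t \<le> x then K A t else 0)) - (LINT t|U01. (if t \<le> x then K B t else 0))"
      using Kint by (intro Bochner_Integration.integral_diff)
    also have "\<dots> \<le> 0"
      using AB ij x by (simp add: K(4)[OF A] K(4)[OF B] rel_concordance_le_def)
    finally show "(LINT t|U01. (if t \<le> x then K A t - K B t else 0)) \<le> 0" .
  qed simp_all
  also have "\<dots> = (LINT t|U01. \<delta> t * K A t - \<delta> t * K B t)"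
    by (simp add: algebra_simps)
  also have "\<dots> = (LINT t|U01. \<delta> t * K A t) - (LINT t|U01. \<delta> t * K B t)"
    using \<delta>K A B by (intro Bochner_Integration.integral_diff) auto
  finally show ?thesis by (simp add: K_def)
qed

text \<open>With the coordinates of \<open>w\<close> other than \<open>i\<close> fixed, increments
  of \<open>g\<close> in component \<open>i\<close> increase with \<open>t\<close>, because the
  other components do and \<open>g\<close> has increasing differences. These increments carry a
  minus sign in \<open>integral_level_swap\<close>, which reverses the inequality of
  \<open>integral_weight_concordance\<close>.\<close>

lemma E_le_E_update:
  assumes g: "nat_supermodular g" and A: "rel_path A" and B: "rel_path B" and i: "i \<in> {1..d}"
    and AB: "rel_concordance_le (A i) (B i)" and off: "\<And>i'. i' \<noteq> i \<Longrightarrow> B i' = A i'"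
  shows "E g A \<le> E g B"
proof -
  define J where "J = {1..d} - {i}"
  have J: "finite J" "i \<notin> J" "insert i J = {1..d}" using i by (auto simp: J_def)
  interpret J: product_prob_space "\<lambda>_::nat. U01" J by standard
  obtain C where C: "\<And>R t w. \<bar>g (vec R t w)\<bar> \<le> C"
    using vec_bounded[of g] by blast
  define m where "m R w = (LINT t|U01. g (vec R t w))" for R w
  have mm: "m R \<in> borel_measurable (Pi\<^sub>M (insert i J) (\<lambda>_. U01))"
    "\<And>w. w \<in> space (Pi\<^sub>M (insert i J) (\<lambda>_. U01)) \<Longrightarrow> \<bar>m R w\<bar> \<le> C" if "rel_path R" for R
    using borel_measurable_vec_marginal[of R g] vec_marginal_bounded[of R _ g C] that C
    unfolding J m_def rel_path_def by auto
  have E: "E g R = (LINT w|Pi\<^sub>M J (\<lambda>_. U01). LINT u|U01. m R (w(i := u)))"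
    if "rel_path R" for R
    using UP.integral_PiM_insert_bounded[OF J(1,2) mm[OF that]] by (simp add: E_def m_def J(3))
  have int: "integrable (Pi\<^sub>M J (\<lambda>_. U01)) (\<lambda>w. LINT u|U01. m R (w(i := u)))"
    if "rel_path R" for R
    using UP.measurable_PiM_marginal[OF J(1,2) mm[OF that]] UP.bounded_PiM_marginal[OF J(1,2) mm[OF that]]
    by (intro J.P.integrable_const_bound[where B = C]) auto
  show ?thesis
    unfolding E[OF A] E[OF B]
  proof (rule integral_mono[OF int[OF A] int[OF B]])
    fix w assume w: "w \<in> space (Pi\<^sub>M J (\<lambda>_. U01))"
    \<comment> \<open>The value 1/2 is a placeholder inside (0, 1); component \<open>i\<close> is
      overwritten in \<open>\<phi>\<close>.\<close>
    define w' where "w' = w(i := 1 / 2)"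
    have w': "w' \<in> space (cube d)"
      using w J(3) by (auto simp: w'_def space_PiM PiE_iff extensional_def)
    define \<phi> where "\<phi> t l = g ((vec A t w')(i := l))" for t l
    have \<phi>_m: "(\<lambda>t. \<phi> t l) \<in> borel_measurable U01" for l
      using borel_measurable_vec_section[OF _ w', of A "\<lambda>v. g (v(i := l))"] A
      by (simp add: \<phi>_def rel_path_def)
    let ?V = "{l :: nat \<Rightarrow> nat. (\<forall>i. l i \<le> n) \<and> (\<forall>i>d. l i = 0)}"
    define L where "L = (\<Sum>v\<in>?V. \<bar>g v\<bar>)"
    have L: "\<bar>\<phi> t l\<bar> \<le> L" if "l \<le> n" for t l
      unfolding L_def \<phi>_def using vec_le vec_off i that
      by (intro member_le_sum[where f = "\<lambda>l. \<bar>g l\<bar>", OF _ _ finite_bounded_vectors]) auto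
    \<comment> \<open>Capping the level at \<open>n\<close> gives a bound for all \<open>l\<close>,
      as \<open>integral_level_swap\<close> demands, and changes no level that occurs.\<close>
    define \<psi> where "\<psi> t l = \<phi> t (min l n)" for t l
    have \<psi>: "(\<lambda>t. \<psi> t l) \<in> borel_measurable U01" "\<bar>\<psi> t l\<bar> \<le> L" for t l
      using \<phi>_m L by (auto simp: \<psi>_def)
    have vec_upd: "g (vec R t (w(i := u))) = \<psi> t (level n (\<lambda>j. R i j t u))"
      if "\<And>i'. i' \<noteq> i \<Longrightarrow> R i' = A i'" for R t u
    proof -
      have "vec R t (w(i := u)) = (vec A t w')(i := level n (\<lambda>j. R i j t u))"
        using that i by (auto simp: level_vec_def w'_def fun_eq_iff)
      then show ?thesis using level_le[of n] by (simp add: \<psi>_def \<phi>_def min_absorb1)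
    qed
    have \<delta>: "mono_on {0<..<1} (\<lambda>t. \<psi> t (Suc j) - \<psi> t j)" for j
    proof (rule mono_onI)
      fix s t :: real assume st: "s \<in> {0<..<1}" "t \<in> {0<..<1}" "s \<le> t"
      have "vec A s w' \<le> vec A t w'" using mono_onD[OF mono_on_vec[OF A] st] .
      then show "\<psi> s (Suc j) - \<psi> s j \<le> \<psi> t (Suc j) - \<psi> t j"
        unfolding \<psi>_def \<phi>_def by (rule nat_supermodular_increasing_differences[OF g]) simp
    qed
    have val: "(LINT u|U01. m R (w(i := u))) = (LINT t|U01. \<psi> t n) -
        (\<Sum>j<n. LINT t|U01. (\<psi> t (Suc j) - \<psi> t j) * rel_prob R i j t)"
      if R: "rel_path R" "\<And>i'. i' \<noteq> i \<Longrightarrow> R i' = A i'" for R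
    proof -
      have "g (vec R t (w(i := u))) = \<psi> t (level n (\<lambda>j. R i j t u))" for t u
        by (rule vec_upd) (rule R(2))
      then show ?thesis
        unfolding m_def using integral_level_swap[OF R(1) i \<psi>] by simp
    qed
    have "(LINT t|U01. (\<psi> t (Suc j) - \<psi> t j) * rel_prob B i j t) \<le>
        (LINT t|U01. (\<psi> t (Suc j) - \<psi> t j) * rel_prob A i j t)"
      if "j < n" for j
    proof (rule integral_weight_concordance[where A = A and B = B and i = i and C = "L + L",
          OF _ _ i that AB \<delta>])
      show "(\<lambda>t. \<psi> t (Suc j) - \<psi> t j) \<in> borel_measurable U01"
        by (intro borel_measurable_diff \<psi>)
      show "\<bar>\<psi> t (Suc j) - \<psi> t j\<bar> \<le> L + L" for t
        using \<psi>(2)[of t "Suc j"] \<psi>(2)[of t j] by linarith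
    qed (use A B in \<open>auto simp: rel_path_def\<close>)
    moreover have "(LINT u|U01. m B (w(i := u))) = (LINT t|U01. \<psi> t n) -
        (\<Sum>j<n. LINT t|U01. (\<psi> t (Suc j) - \<psi> t j) * rel_prob B i j t)"
      by (rule val[OF B]) (rule off)
    ultimately show "(LINT u|U01. m A (w(i := u))) \<le> (LINT u|U01. m B (w(i := u)))"
      unfolding val[OF A refl] by (simp only:) (intro diff_left_mono sum_mono, simp)
  qed
qed

lemma E_le_E_concordance:
  assumes g: "nat_supermodular g" and A: "rel_path A" and B: "rel_path B"
    and AB: "\<And>i. i \<in> {1..d} \<Longrightarrow> rel_concordance_le (A i) (B i)"
  shows "E g A \<le> E g B"
proof -
  define H where "H m = (\<lambda>i. if i \<le> m then B i else A i)" for m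
  have path: "rel_path (H m)" for m
    using A B by (auto simp: H_def rel_path_def rel_measurable_def)
  have "E g (H 0) \<le> E g (H m)" if "m \<le> d" for m
    using that
  proof (induction m)
    case (Suc m)
    have "E g (H m) \<le> E g (H (Suc m))"
      by (rule E_le_E_update[OF g path path, of "Suc m"]) (use Suc.prems AB in \<open>auto simp: H_def\<close>)
    with Suc show ?case by simp
  qed simp
  moreover have "E g R = E g R'" if "\<And>i. i \<in> {1..d} \<Longrightarrow> R i = R' i" for R R'
  proof -
    have "vec R t w = vec R' t w" for t w using that by (auto simp: level_vec_def fun_eq_iff)
    then show ?thesis by (simp add: E_def)
  qed
  \<comment> \<open>The families agree on \<open>{1..d}\<close>; index 0, which \<open>H 0\<close>
    takes from \<open>B\<close>, is not read by \<open>level_vec\<close>.\<close>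
  from this[of "H 0" A] this[of "H d" B] have "E g (H 0) = E g A" "E g (H d) = E g B"
    by (auto simp: H_def)
  ultimately show ?thesis by (metis order_refl)
qed

text \<open>The rearranged vector is increasing in \<open>w\<close> as well as in \<open>t\<close>,
  since a larger \<open>u\<close> makes \<open>star_rel\<close> harder to satisfy. Harris in
  \<open>w\<close> for the averages over \<open>t\<close>, followed by Chebyshev in \<open>t\<close>
  for each \<open>w\<close>, gives association.\<close>

lemma E_star_association:
  assumes F: "conditional_cdfs d n F" and g: "mono g" "mono g'"
  shows "E g (star_rel F) * E g' (star_rel F) \<le> E (\<lambda>l. g l * g' l) (star_rel F)"
proof -
  let ?R = "star_rel F"
  have pS: "rel_path ?R" by (rule rel_path_star_rel[OF F])
  then have mS: "rel_measurable ?R" by (simp add: rel_path_def)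
  obtain C1 C2 where C1: "\<And>R t w. \<bar>g (vec R t w)\<bar> \<le> C1" and C2: "\<And>R t w. \<bar>g' (vec R t w)\<bar> \<le> C2"
    using vec_bounded[of g] vec_bounded[of g'] by blast
  define C where "C = max C1 C2"
  have C: "\<And>R t w. \<bar>g (vec R t w)\<bar> \<le> C" "\<And>R t w. \<bar>g' (vec R t w)\<bar> \<le> C"
    using C1 C2 by (simp_all add: C_def max.coboundedI1 max.coboundedI2)
  have mono_w: "mono_on (space (cube d)) (\<lambda>w. LINT t|U01. h (vec ?R t w))" if h: "mono h" for h :: "_ \<Rightarrow> real"
  proof (rule mono_onI)
    fix w w' assume w: "w \<in> space (cube d)" "w' \<in> space (cube d)" "w \<le> w'"
    have "vec ?R t w \<le> vec ?R t w'" for t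
    proof (rule le_funI)
      fix i
      show "vec ?R t w i \<le> vec ?R t w' i"
        using w(3) star_rel_antimono[OF F, of i _ t "w' i" "w i"]
        by (auto simp: level_vec_def le_fun_def intro!: level_antimono)
    qed
    with h show "(LINT t|U01. h (vec ?R t w)) \<le> (LINT t|U01. h (vec ?R t w'))"
      by (intro integral_mono integrable_vec_section mS w) (auto simp: mono_def)
  qed
  have mono_t: "mono_on {0<..<1} (\<lambda>t. h (vec ?R t w))" if "mono h" for h :: "_ \<Rightarrow> real" and w
    using mono_on_vec[OF pS, of w] that by (auto simp: mono_on_def mono_def)
  have "E g ?R * E g' ?R \<le> (LINT w|cube d. (LINT t|U01. g (vec ?R t w)) * (LINT t|U01. g' (vec ?R t w)))"
    unfolding E_def
    by (rule harris_inequality[where C = C])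
       (rule finite_atLeastAtMost mono_w g borel_measurable_vec_marginal[OF mS]
          vec_marginal_bounded[OF mS] C | assumption)+
  also have "\<dots> \<le> E (\<lambda>l. g l * g' l) ?R"
    unfolding E_def
  proof (rule integral_mono)
    show "integrable (cube d) (\<lambda>w. LINT t|U01. g (vec ?R t w) * g' (vec ?R t w))"
      using integrable_vec_marginal[OF mS, of "\<lambda>l. g l * g' l"] by simp
    have "\<bar>(LINT t|U01. g (vec ?R t w)) * (LINT t|U01. g' (vec ?R t w))\<bar> \<le> C * C"
      if "w \<in> space (cube d)" for w
      unfolding abs_mult using vec_marginal_bounded[OF mS that] C
      by (intro mult_mono) (auto intro: order_trans[OF abs_ge_zero])
    then show "integrable (cube d) (\<lambda>w. (LINT t|U01. g (vec ?R t w)) * (LINT t|U01. g' (vec ?R t w)))"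
      using borel_measurable_vec_marginal[OF mS, of g] borel_measurable_vec_marginal[OF mS, of g']
      by (intro UP.P.integrable_const_bound[where B = "C * C"]) auto
    fix w assume w: "w \<in> space (cube d)"
    show "(LINT t|U01. g (vec ?R t w)) * (LINT t|U01. g' (vec ?R t w)) \<le>
        (LINT t|U01. g (vec ?R t w) * g' (vec ?R t w))"
      by (rule chebyshev_integral_unit_interval[where C = C])
         (simp_all add: mono_t g borel_measurable_vec_section[OF mS w] C)
  qed
  finally show ?thesis .
qed

end

section \<open>Laws with conditionally independent components\<close>

lemma (in finite_measure) integral_finite_valued:
  fixes g :: "'b \<Rightarrow> real"
  assumes V: "finite V" and H: "H \<in> measurable M (count_space V)"
  shows "(LINT x|M. g (H x)) = (\<Sum>l\<in>V. g l * measure M {x \<in> space M. H x = l})"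
proof -
  have sets: "{x \<in> space M. H x = l} \<in> sets M" if "l \<in> V" for l
  proof -
    have "H -` {l} \<inter> space M \<in> sets M" using that by (intro measurable_sets[OF H]) auto
    also have "H -` {l} \<inter> space M = {x \<in> space M. H x = l}" by auto
    finally show ?thesis .
  qed
  have "(LINT x|M. g (H x)) = (LINT x|M. (\<Sum>l\<in>V. g l * indicator {x \<in> space M. H x = l} x))"
  proof (rule Bochner_Integration.integral_cong[OF refl])
    fix x assume x: "x \<in> space M"
    then have "H x \<in> V" using H by (auto simp: measurable_count_space_eq2[OF V])
    have "(\<Sum>l\<in>V. g l * indicator {x \<in> space M. H x = l} x) = (\<Sum>l\<in>V. if l = H x then g l else 0)"
      using x by (intro sum.cong) (auto simp: indicator_def)
    also have "\<dots> = g (H x)" using V \<open>H x \<in> V\<close> by simp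
    finally show "g (H x) = (\<Sum>l\<in>V. g l * indicator {x \<in> space M. H x = l} x)" by simp
  qed
  also have "\<dots> = (\<Sum>l\<in>V. LINT x|M. g l * indicator {x \<in> space M. H x = l} x)"
    using sets by (intro Bochner_Integration.integral_sum integrable_mult_right integrable_real_indicator)
      (auto simp: emeasure_eq_measure)
  also have "\<dots> = (\<Sum>l\<in>V. g l * measure M {x \<in> space M. H x = l})"
    by (intro sum.cong) (auto simp: Int_def conj_commute cong: conj_cong)
  finally show ?thesis .
qed

definition level_map :: "nat \<Rightarrow> nat \<Rightarrow> (nat \<Rightarrow> nat \<Rightarrow> real) \<Rightarrow> (nat \<Rightarrow> real) \<Rightarrow> nat \<Rightarrow> nat" where
  "level_map d n v x = (\<lambda>i. if i \<le> d then level n (\<lambda>j. x i \<le> v i j) else 0)"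

text \<open>\<open>\<kappa> i A u\<close> stands for \<open>P(x i \<in> A | x 0 = u)\<close>.\<close>

locale conditional_product = prob_space P
  for P :: "(nat \<Rightarrow> real) measure" and d :: nat and \<kappa> :: "nat \<Rightarrow> real set \<Rightarrow> real \<Rightarrow> real" +
  assumes sets_P: "sets P = sets (vec_space d)"
    and \<kappa>_meas: "i \<in> {1..d} \<Longrightarrow> A \<in> sets borel \<Longrightarrow> \<kappa> i A \<in> borel_measurable borel"
    and \<kappa>_UNIV: "i \<in> {1..d} \<Longrightarrow> AE u in distr P borel (\<lambda>x. x 0). \<kappa> i UNIV u = 1"
    and \<kappa>_nonneg: "i \<in> {1..d} \<Longrightarrow> A \<in> sets borel \<Longrightarrow> AE u in distr P borel (\<lambda>x. x 0). 0 \<le> \<kappa> i A u"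
    and \<kappa>_add: "i \<in> {1..d} \<Longrightarrow> A \<in> sets borel \<Longrightarrow> B \<in> sets borel \<Longrightarrow> A \<inter> B = {} \<Longrightarrow>
        AE u in distr P borel (\<lambda>x. x 0). \<kappa> i (A \<union> B) u = \<kappa> i A u + \<kappa> i B u"
    and measure_rectangle: "(\<And>i. i \<in> {0..d} \<Longrightarrow> S i \<in> sets borel) \<Longrightarrow>
        measure P {x \<in> space P. \<forall>i\<in>{0..d}. x i \<in> S i} =
        (LINT u|distr P borel (\<lambda>x. x 0). indicator (S 0) u * (\<Prod>i\<in>{1..d}. \<kappa> i (S i) u))"
begin

abbreviation P0 :: "real measure" where "P0 \<equiv> distr P borel (\<lambda>x. x 0)"

definition q :: "real \<Rightarrow> real" where "q t = Inf {x. t \<le> cdf P0 x}"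

lemma space_P: "space P = space (vec_space d)"
  by (rule sets_eq_imp_space_eq[OF sets_P])

lemma measurable_component [measurable]: "i \<in> {0..d} \<Longrightarrow> (\<lambda>x. x i) \<in> borel_measurable P"
  unfolding measurable_cong_sets[OF sets_P refl] by (rule measurable_component_singleton)

sublocale P0: cdf_distribution P0
  unfolding cdf_distribution_def by (rule real_distribution_distr) simp

lemma measurable_q [measurable]: "q \<in> borel_measurable U01"
proof -
  have "(\<lambda>t. Inf {x. t \<le> cdf P0 x}) \<in> borel_measurable (restrict_space borel {0<..<1})"
    by (rule P0.measurable_CI)
  then show ?thesis
    unfolding q_def[abs_def] by (subst measurable_cong_sets[OF sets_restrict_space_cong refl]) auto
qed

lemma mono_q: "mono_on {0<..<1} q"
  unfolding q_def[abs_def] by (rule P0.mono_I)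

lemma distr_q: "distr U01 borel q = P0"
  unfolding q_def[abs_def] by (rule P0.distr_I_eq_M)

lemma AE_q: "AE u in P0. Q u \<Longrightarrow> AE t in U01. Q (q t)"
  unfolding distr_q[symmetric] by (rule AE_distrD[OF measurable_q])

lemma integral_q:
  "f \<in> borel_measurable borel \<Longrightarrow> (LINT u|P0. f u) = (LINT t|U01. f (q t) :: real)"
  unfolding distr_q[symmetric] by (rule integral_distr[OF measurable_q])

lemma \<kappa>_sum:
  assumes i: "i \<in> {1..d}" and "finite C" and cell: "\<And>c. cell c \<in> sets borel"
    and disj: "\<And>c c'. c \<noteq> c' \<Longrightarrow> cell c \<inter> cell c' = {}"
  shows "AE u in P0. \<kappa> i (\<Union>c\<in>C. cell c) u = (\<Sum>c\<in>C. \<kappa> i (cell c) u)"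
  using \<open>finite C\<close>
proof (induction C rule: finite_induct)
  case empty
  show ?case using \<kappa>_add[OF i, of "{}" "{}"] by simp
next
  case (insert c C)
  have "cell c \<inter> cell c' = {}" if "c' \<in> C" for c'
    by (rule disj) (use that insert.hyps in auto)
  then have "cell c \<inter> (\<Union>c\<in>C. cell c) = {}" by blast
  then have "AE u in P0. \<kappa> i (cell c \<union> (\<Union>c\<in>C. cell c)) u = \<kappa> i (cell c) u + \<kappa> i (\<Union>c\<in>C. cell c) u"
    using insert.hyps cell by (intro \<kappa>_add[OF i]) auto
  with insert.IH show ?case
    by eventually_elim (use insert.hyps in simp)
qed

end

locale threshold_levels = conditional_product +
  fixes n :: nat and v :: "nat \<Rightarrow> nat \<Rightarrow> real"
  assumes v_mono: "i \<le> d \<Longrightarrow> Suc j < n \<Longrightarrow> v i j \<le> v i (Suc j)"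
begin

definition k :: "real \<Rightarrow> nat" where "k t = level n (\<lambda>j. q t \<le> v 0 j)"

definition F :: "nat \<Rightarrow> nat \<Rightarrow> real \<Rightarrow> real" where "F i j t = \<kappa> i {..v i j} (q t)"

definition cell :: "nat \<Rightarrow> nat \<Rightarrow> real set" where
  "cell i c = {y. level n (\<lambda>j. y \<le> v i j) = c}"

sublocale level_coupling d n k
proof
  show "k \<in> measurable U01 (count_space UNIV)"
    unfolding k_def[abs_def] by (rule measurable_level) measurable
  show "k t \<le> n" for t by (simp add: k_def level_le)
  show "mono_on {0<..<1} k"
  proof (rule mono_onI)
    fix s t :: real assume "s \<in> {0<..<1}" "t \<in> {0<..<1}" "s \<le> t"
    then have "q s \<le> q t" by (rule mono_onD[OF mono_q])
    then show "k s \<le> k t" unfolding k_def by (intro level_antimono) auto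
  qed
qed

lemma nested_thresholds: "i \<le> d \<Longrightarrow> nested n (\<lambda>j. y \<le> v i j)"
  using v_mono by (auto simp: nested_def intro: order_trans)

lemma cell_sets: "cell i c \<in> sets borel"
proof -
  have "(\<lambda>y. level n (\<lambda>j. y \<le> v i j)) \<in> measurable borel (count_space UNIV)"
    by (rule measurable_level) measurable
  from measurable_sets[OF this, of "{c}"] show ?thesis
    by (simp add: cell_def vimage_def)
qed

lemma measurable_F: "i \<in> {1..d} \<Longrightarrow> F i j \<in> borel_measurable U01"
  unfolding F_def[abs_def] by (rule measurable_compose[OF measurable_q \<kappa>_meas]) auto

text \<open>Each instance of additivity of \<open>\<kappa>\<close> holds off its own null set. The
  grid needs only finitely many of them, so for almost every \<open>t\<close> the cell values form
  one probability vector with the \<open>F i j t\<close> as partial sums.\<close>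

lemma F_eq_sum_AE:
  assumes i: "i \<in> {1..d}"
  shows "AE t in U01. (\<forall>c. 0 \<le> \<kappa> i (cell i c) (q t)) \<and>
    (\<Sum>c\<le>n. \<kappa> i (cell i c) (q t)) = 1 \<and> (\<forall>j\<in>{..<n}. F i j t = (\<Sum>c\<le>j. \<kappa> i (cell i c) (q t)))"
proof -
  have sum: "AE u in P0. \<kappa> i (\<Union>c\<in>C. cell i c) u = (\<Sum>c\<in>C. \<kappa> i (cell i c) u)" if "finite C" for C
    using cell_sets that by (intro \<kappa>_sum[OF i]) (auto simp: cell_def)
  have "AE u in P0. \<forall>c. 0 \<le> \<kappa> i (cell i c) u"
    using \<kappa>_nonneg[OF i cell_sets] by (simp add: AE_all_countable)
  moreover have "AE u in P0. (\<Sum>c\<le>n. \<kappa> i (cell i c) u) = 1"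
  proof -
    have "(\<Union>c\<in>{..n}. cell i c) = UNIV" by (auto simp: cell_def level_le)
    with sum[of "{..n}"] \<kappa>_UNIV[OF i] show ?thesis by (auto elim: eventually_elim2)
  qed
  moreover have "AE u in P0. \<forall>j\<in>{..<n}. \<kappa> i {..v i j} u = (\<Sum>c\<le>j. \<kappa> i (cell i c) u)"
  proof (intro AE_finite_allI)
    fix j assume "j \<in> {..<n}"
    then have "(\<Union>c\<in>{..j}. cell i c) = {..v i j}"
      using level_le_iff[OF nested_thresholds, of i j] i by (auto simp: cell_def)
    with sum[of "{..j}"] show "AE u in P0. \<kappa> i {..v i j} u = (\<Sum>c\<le>j. \<kappa> i (cell i c) u)" by simp
  qed simp
  ultimately have "AE u in P0. (\<forall>c. 0 \<le> \<kappa> i (cell i c) u) \<and> (\<Sum>c\<le>n. \<kappa> i (cell i c) u) = 1 \<and>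
      (\<forall>j\<in>{..<n}. \<kappa> i {..v i j} u = (\<Sum>c\<le>j. \<kappa> i (cell i c) u))"
    by eventually_elim auto
  from AE_q[OF this] show ?thesis by (simp add: F_def)
qed

lemma conditional_cdfs_F: "conditional_cdfs d n F"
  unfolding conditional_cdfs_def
proof (intro ballI conjI allI impI)
  fix i j assume i: "i \<in> {1..d}" and "Suc j < n"
  show "AE t in U01. F i j t \<le> F i (Suc j) t"
    using F_eq_sum_AE[OF i] by eventually_elim (use \<open>Suc j < n\<close> in auto)
qed (rule measurable_F)

text \<open>Cell probabilities are differences of consecutive \<open>F i j t\<close>, so the
  quantile transform of a uniform variable has the conditional law prescribed by
  \<open>\<kappa>\<close>.\<close>

lemma measure_level_eq_AE:
  assumes i: "i \<in> {1..d}"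
  shows "AE t in U01. \<forall>c\<le>n.
    measure U01 {u \<in> space U01. level n (\<lambda>j. cdf_rel F i j t u) = c} = \<kappa> i (cell i c) (q t)"
  using F_eq_sum_AE[OF i]
proof eventually_elim
  case (elim t)
  define p where "p c = \<kappa> i (cell i c) (q t)" for c
  have p: "\<And>c. 0 \<le> p c" "(\<Sum>c\<le>n. p c) = 1" "\<And>j. j < n \<Longrightarrow> F i j t = (\<Sum>c\<le>j. p c)"
    using elim by (auto simp: p_def)
  let ?lev = "\<lambda>u. level n (\<lambda>j. cdf_rel F i j t u)"
  have nest: "nested n (\<lambda>j. cdf_rel F i j t u)" for u
    using p by (auto simp: nested_def cdf_rel_def intro: order_trans)
  have meas: "?lev \<in> measurable U01 (count_space UNIV)"
    unfolding cdf_rel_def by (rule measurable_level) measurable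
  have sets: "{u \<in> space U01. ?lev u \<le> c} \<in> sets U01" for c
  proof -
    have "?lev -` {..c} \<inter> space U01 \<in> sets U01"
      by (rule measurable_sets[OF meas]) simp
    also have "?lev -` {..c} \<inter> space U01 = {u \<in> space U01. ?lev u \<le> c}" by auto
    finally show ?thesis .
  qed
  have le: "measure U01 {u \<in> space U01. ?lev u \<le> c} = (\<Sum>c'\<le>c. p c')" if "c \<le> n" for c
  proof (cases "c = n")
    case True
    then have "{u \<in> space U01. ?lev u \<le> c} = space U01" using level_le by auto
    then show ?thesis using p(2) U.prob_space True by (simp only:)
  next
    case False
    with that have c: "c < n" by simp
    have "{u \<in> space U01. ?lev u \<le> c} = {u \<in> {0<..<1}. u \<le> F i c t}"
      using level_le_iff[OF nest c] by (auto simp: cdf_rel_def)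
    moreover have "measure U01 {u \<in> {0<..<1}. u \<le> F i c t} = F i c t"
    proof (rule measure_unit_interval_le)
      show "0 \<le> F i c t" using p(1) by (auto simp: p(3)[OF c] intro: sum_nonneg)
      have "F i c t \<le> (\<Sum>c\<le>n. p c)"
        unfolding p(3)[OF c] using c p(1) by (intro sum_mono2) auto
      then show "F i c t \<le> 1" using p(2) by simp
    qed
    ultimately show ?thesis using p(3)[OF c] by simp
  qed
  show ?case
  proof (intro allI impI)
    fix c assume c: "c \<le> n"
    show "measure U01 {u \<in> space U01. ?lev u = c} = \<kappa> i (cell i c) (q t)"
    proof (cases c)
      case 0
      then show ?thesis using le[of 0] by (simp add: p_def)
    next
      case (Suc c')
      have "{u \<in> space U01. ?lev u = c} =
          {u \<in> space U01. ?lev u \<le> c} - {u \<in> space U01. ?lev u \<le> c'}"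
        using Suc by auto
      moreover have "{u \<in> space U01. ?lev u \<le> c'} \<subseteq> {u \<in> space U01. ?lev u \<le> c}"
        using Suc by auto
      ultimately have "measure U01 {u \<in> space U01. ?lev u = c} = (\<Sum>c'\<le>c. p c') - (\<Sum>c\<le>c'. p c)"
        using U.finite_measure_Diff[OF sets sets, of c' c] le[of c] le[of c'] c Suc by simp
      then show ?thesis using Suc by (simp add: p_def)
    qed
  qed
qed

text \<open>\<open>P\<close> and the coupling give the same mass to each grid vector: for
  \<open>P\<close> by \<open>measure_rectangle\<close>, transported to (0, 1) by the quantile
  function, and in the coupling by independence of the coordinates of \<open>w\<close> for each
  \<open>t\<close>.\<close>

lemma integral_level_map:
  fixes g :: "(nat \<Rightarrow> nat) \<Rightarrow> real"
  shows "(LINT x|P. g (level_map d n v x)) = E g (cdf_rel F)"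
proof -
  let ?V = "{l :: nat \<Rightarrow> nat. (\<forall>i. l i \<le> n) \<and> (\<forall>i>d. l i = 0)}"
  note mR = rel_measurable_cdf_rel[OF conditional_cdfs_F]
  have comp: "(\<lambda>x. level_map d n v x i) \<in> measurable P (count_space UNIV)" if "i \<le> d" for i
  proof -
    have "(\<lambda>x. level n (\<lambda>j. x i \<le> v i j)) \<in> measurable P (count_space UNIV)"
      using that by (intro measurable_level) measurable
    then show ?thesis using that by (simp add: level_map_def)
  qed
  have LV: "level_map d n v \<in> measurable P (count_space ?V)"
    by (rule measurable_bounded_vector) (use comp in \<open>auto simp: level_map_def level_le\<close>)
  have P_l: "measure P {x \<in> space P. level_map d n v x = l} =
      (LINT t|U01. indicator {l 0} (k t) * (\<Prod>i\<in>{1..d}. \<kappa> i (cell i (l i)) (q t)))"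
    if "l \<in> ?V" for l
  proof -
    have "{x \<in> space P. level_map d n v x = l} = {x \<in> space P. \<forall>i\<in>{0..d}. x i \<in> cell i (l i)}"
      using that by (auto simp: level_map_def cell_def fun_eq_iff)
    then have "measure P {x \<in> space P. level_map d n v x = l} =
        (LINT u|P0. indicator (cell 0 (l 0)) u * (\<Prod>i\<in>{1..d}. \<kappa> i (cell i (l i)) u))"
      using measure_rectangle[of "\<lambda>i. cell i (l i)"] cell_sets by simp
    also have "\<dots> = (LINT t|U01. indicator (cell 0 (l 0)) (q t) * (\<Prod>i\<in>{1..d}. \<kappa> i (cell i (l i)) (q t)))"
      using cell_sets \<kappa>_meas by (intro integral_q borel_measurable_times borel_measurable_prod) auto
    also have "(\<lambda>t. indicator (cell 0 (l 0)) (q t) :: real) = (\<lambda>t. indicator {l 0} (k t))"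
      by (auto simp: cell_def k_def indicator_def)
    finally show ?thesis .
  qed
  have good: "AE t in U01. \<forall>i\<in>{1..d}. \<forall>c\<le>n.
    measure U01 {u \<in> space U01. level n (\<lambda>j. cdf_rel F i j t u) = c} = \<kappa> i (cell i c) (q t)"
    by (intro AE_finite_allI measure_level_eq_AE) auto
  have sets_i: "{u \<in> space U01. level n (\<lambda>j. cdf_rel F i j t u) = c} \<in> sets U01" for i t c
  proof -
    have "(\<lambda>u. level n (\<lambda>j. cdf_rel F i j t u)) \<in> measurable U01 (count_space UNIV)"
      unfolding cdf_rel_def by (rule measurable_level) measurable
    from measurable_sets[OF this, of "{c}"]
    have "(\<lambda>u. level n (\<lambda>j. cdf_rel F i j t u)) -` {c} \<inter> space U01 \<in> sets U01" by simp
    also have "(\<lambda>u. level n (\<lambda>j. cdf_rel F i j t u)) -` {c} \<inter> space U01 =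
        {u \<in> space U01. level n (\<lambda>j. cdf_rel F i j t u) = c}" by auto
    finally show ?thesis .
  qed
  \<comment> \<open>\<open>h l t\<close> is the conditional probability of the grid vector
    \<open>l\<close> given \<open>t\<close>; both expectations become finite sums over
    \<open>l\<close> with these weights.\<close>
  define h where "h l t = indicator {l 0} (k t) * (\<Prod>i\<in>{1..d}. \<kappa> i (cell i (l i)) (q t))" for l :: "nat \<Rightarrow> nat" and t
  have h_meas: "h l \<in> borel_measurable U01" for l
  proof -
    have "(\<lambda>t. \<kappa> i (cell i (l i)) (q t)) \<in> borel_measurable U01" if "i \<in> {1..d}" for i
      by (rule measurable_compose[OF measurable_q \<kappa>_meas[OF that cell_sets]])
    moreover have "(\<lambda>t. indicator {l 0} (k t) :: real) \<in> borel_measurable U01"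
      by (rule measurable_compose[OF k_meas]) simp
    ultimately show ?thesis
      unfolding h_def[abs_def] by (intro borel_measurable_times borel_measurable_prod)
  qed
  have h: "AE t in U01. \<forall>l\<in>?V. h l t = measure (cube d) {w \<in> space (cube d). vec (cdf_rel F) t w = l}"
    using good
  proof (eventually_elim, intro ballI)
    fix t l
    assume t: "\<forall>i\<in>{1..d}. \<forall>c\<le>n.
      measure U01 {u \<in> space U01. level n (\<lambda>j. cdf_rel F i j t u) = c} = \<kappa> i (cell i c) (q t)"
      and l: "l \<in> ?V"
    show "h l t = measure (cube d) {w \<in> space (cube d). vec (cdf_rel F) t w = l}"
    proof (cases "k t = l 0")
      case True
      have "{w \<in> space (cube d). vec (cdf_rel F) t w = l} =
          Pi\<^sub>E {1..d} (\<lambda>i. {u \<in> space U01. level n (\<lambda>j. cdf_rel F i j t u) = l i})"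
        (is "?A = ?B")
      proof (intro set_eqI iffI)
        fix w assume "w \<in> ?A"
        then have w: "w \<in> space (cube d)" "\<And>i. vec (cdf_rel F) t w i = l i" by auto
        have "level n (\<lambda>j. cdf_rel F i j t (w i)) = l i" if "i \<in> {1..d}" for i
          using w(2)[of i] that by (simp add: level_vec_def)
        with w(1) show "w \<in> ?B" by (auto simp: space_PiM PiE_iff)
      next
        fix w assume w: "w \<in> ?B"
        have "vec (cdf_rel F) t w i = l i" for i
        proof -
          consider "i = 0" | "i \<in> {1..d}" | "d < i" by fastforce
          then show ?thesis
            by cases (use w l True in \<open>auto simp: level_vec_def PiE_iff\<close>)
        qed
        with w show "w \<in> ?A" by (auto simp: space_PiM PiE_iff fun_eq_iff)
      qed
      then have "measure (cube d) {w \<in> space (cube d). vec (cdf_rel F) t w = l} =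
          (\<Prod>i\<in>{1..d}. measure U01 {u \<in> space U01. level n (\<lambda>j. cdf_rel F i j t u) = l i})"
        using W.prob_times[OF sets_i] by simp
      also have "\<dots> = (\<Prod>i\<in>{1..d}. \<kappa> i (cell i (l i)) (q t))"
        using t l by (intro prod.cong) auto
      finally show ?thesis using True by (simp add: h_def)
    next
      case False
      then have *: "{w \<in> space (cube d). vec (cdf_rel F) t w = l} = {}"
        by (auto simp: level_vec_def fun_eq_iff)
      show ?thesis unfolding * using False by (simp add: h_def)
    qed
  qed
  have h_int: "integrable U01 (h l)" if "l \<in> ?V" for l
  proof (rule U.integrable_const_bound[where B = 1])
    show "AE t in U01. norm (h l t) \<le> 1"
      using h by eventually_elim (use that UP.P.prob_le_1 in auto)
  qed (rule h_meas)
  have "E g (cdf_rel F) = (LINT t|U01. LINT w|cube d. g (vec (cdf_rel F) t w))"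
    by (rule E_swap[OF mR])
  also have "\<dots> = (LINT t|U01. (\<Sum>l\<in>?V. g l * h l t))"
  proof (rule integral_cong_AE)
    show "(\<lambda>t. LINT w|cube d. g (vec (cdf_rel F) t w)) \<in> borel_measurable U01"
    proof (rule UP.P.borel_measurable_lebesgue_integral)
      have "(\<lambda>y. g (vec (cdf_rel F) (snd (case y of (t, w) \<Rightarrow> (w, t))) (fst (case y of (t, w) \<Rightarrow> (w, t)))))
          \<in> borel_measurable (U01 \<Otimes>\<^sub>M cube d)"
        by (rule measurable_compose[OF measurable_pair_swap' borel_measurable_vec[OF mR]])
      then show "(\<lambda>(t, w). g (vec (cdf_rel F) t w)) \<in> borel_measurable (U01 \<Otimes>\<^sub>M cube d)"
        by (simp add: case_prod_beta')
    qed
    show "(\<lambda>t. \<Sum>l\<in>?V. g l * h l t) \<in> borel_measurable U01"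
      by (intro borel_measurable_sum borel_measurable_times borel_measurable_const h_meas)
    show "AE t in U01. (LINT w|cube d. g (vec (cdf_rel F) t w)) = (\<Sum>l\<in>?V. g l * h l t)"
      using h AE_space
    proof eventually_elim
      case (elim t)
      have "vec (cdf_rel F) t \<in> measurable (cube d) (count_space ?V)"
      proof (rule measurable_bounded_vector)
        show "(\<lambda>w. vec (cdf_rel F) t w i) \<in> measurable (cube d) (count_space UNIV)" for i
          using measurable_compose[OF measurable_Pair2'[OF elim(2)] measurable_vec[OF mR]] by simp
      qed (rule vec_le vec_off, assumption?)+
      from UP.P.integral_finite_valued[OF finite_bounded_vectors this, of g] elim(1)
      show ?case by simp
    qed
  qed
  also have "\<dots> = (\<Sum>l\<in>?V. g l * (LINT t|U01. h l t))"
    using h_int by (subst Bochner_Integration.integral_sum) auto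
  also have "\<dots> = (LINT x|P. g (level_map d n v x))"
    using integral_finite_valued[OF finite_bounded_vectors LV, of g] P_l by (simp add: h_def)
  finally show ?thesis by simp
qed

end

text \<open>For \<open>f\<close> with values in [0, 1], the integral of its decreasing rearrangement
  over (0, x) equals that of \<open>min x (superlevel_measure f u)\<close> over \<open>u\<close>. So
  this is the Schur order written without choosing a rearrangement.\<close>

definition superlevel_le :: "(real \<Rightarrow> real) \<Rightarrow> (real \<Rightarrow> real) \<Rightarrow> bool" where
  "superlevel_le f g \<longleftrightarrow>
     (\<forall>x\<in>{0<..<1}. (LINT u|U01. min x (superlevel_measure f u)) \<le>
        (LINT u|U01. min x (superlevel_measure g u))) \<and>
     (LINT u|U01. superlevel_measure f u) = (LINT u|U01. superlevel_measure g u)"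

lemma integral_of_bool_le:
  assumes "0 \<le> c" "c \<le> 1"
  shows "(LINT t|U01. of_bool (t \<le> c) :: real) = c"
proof -
  have "(LINT t|U01. of_bool (t \<le> c) :: real) =
      (LINT t|U01. indicator {t \<in> {0<..<1}. t \<le> c} t)"
    by (intro Bochner_Integration.integral_cong) (auto simp: indicator_def)
  also have "\<dots> = measure U01 ({t \<in> {0<..<1}. t \<le> c} \<inter> space U01)"
    by (simp del: space_unit_interval)
  also have "{t \<in> {0<..<1}. t \<le> c} \<inter> space U01 = {t \<in> {0<..<1}. t \<le> c}"
    by auto
  also have "measure U01 \<dots> = c" by (rule measure_unit_interval_le[OF assms])
  finally show ?thesis .
qed

lemma (in level_coupling) rel_concordance_le_star_rel:
  assumes "\<And>j. j < n \<Longrightarrow> superlevel_le (F i j) (G i j)"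
  shows "rel_concordance_le (star_rel F i) (star_rel G i)"
proof -
  have *: "(LINT t|U01. of_bool (t \<le> x \<and> t \<le> m) :: real) = min x m"
    if "0 \<le> m" "m \<le> 1" "x \<in> {0<..<1}" for x m :: real
    using integral_of_bool_le[of "min x m"] that by simp
  show ?thesis
    unfolding rel_concordance_le_def star_rel_def
    using assms
    by (simp add: * superlevel_measure_bounds integral_of_bool_le superlevel_le_def)
qed

text \<open>Both sides are the area below the graph of \<open>h\<close> over (0, x). Sliced by
  \<open>u\<close> instead of \<open>t\<close>, the section is an initial interval of length
  \<open>superlevel_measure f u\<close> capped at \<open>x\<close>. The value \<open>x = 1\<close>
  is allowed so that the total integrals are covered as well.\<close>

lemma decr_rearrangement_integral:
  assumes h: "is_decr_rearrangement f h" and f [measurable]: "f \<in> borel_measurable U01"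
    and f01: "AE t in U01. 0 \<le> f t \<and> f t \<le> 1" and x: "x \<in> {0<..1}"
  shows "(LINT t:{0<..<x}|lborel. h t) = (LINT u|U01. min x (superlevel_measure f u))"
proof -
  interpret prob_space U01 by (rule prob_space_unit_interval)
  have anti: "\<And>s t. s \<in> {0<..<1} \<Longrightarrow> t \<in> {0<..<1} \<Longrightarrow> s \<le> t \<Longrightarrow> h t \<le> h s"
    using h by (auto simp: is_decr_rearrangement_def monotone_on_def)
  have [measurable]: "h \<in> borel_measurable U01"
  proof -
    have "(\<lambda>t. - h t) \<in> borel_measurable (restrict_space borel {0<..<1})"
      using anti by (intro borel_measurable_mono_on_fnc mono_onI) auto
    then have "(\<lambda>t. - h t) \<in> borel_measurable U01"
      by (subst measurable_cong_sets[OF sets_restrict_space_cong refl]) auto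
    then show ?thesis by simp
  qed
  have level: "superlevel_measure h w = superlevel_measure f w" for w
    using h unfolding superlevel_measure_def
    by (subst (1 2) measure_restrict_space) (auto simp: is_decr_rearrangement_def)
  \<comment> \<open>\<open>h\<close> is confined to [0, 1] at every point: a value above 1 at
    \<open>t\<close> would persist on (0, t] by monotonicity, whereas \<open>h\<close> shares its
    superlevel measures with \<open>f\<close>. The lower bound works the same way to the right of
    \<open>t\<close>.\<close>
  have h_le: "h t \<le> 1" if t: "t \<in> {0<..<1}" for t
  proof (rule ccontr)
    assume "\<not> h t \<le> 1"
    have "superlevel_measure f (h t) = measure U01 {}"
      unfolding superlevel_measure_def
    proof (rule finite_measure_eq_AE)
      show "AE s in U01. s \<in> {s \<in> {0<..<1}. h t \<le> f s} \<longleftrightarrow> s \<in> {}"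
        using f01 by eventually_elim (use \<open>\<not> h t \<le> 1\<close> in auto)
    qed (use sets_superlevel[OF f] in auto)
    then have "superlevel_measure h (h t) = 0" by (simp add: level)
    moreover have "measure U01 {s \<in> {0<..<1}. s \<le> t} \<le> superlevel_measure h (h t)"
      unfolding superlevel_measure_def
      using anti t by (intro finite_measure_mono sets_superlevel) auto
    ultimately show False using measure_unit_interval_le[of t] t by simp
  qed
  have h_ge: "0 \<le> h t" if t: "t \<in> {0<..<1}" for t
  proof (rule ccontr)
    assume "\<not> 0 \<le> h t"
    have "superlevel_measure f 0 = measure U01 (space U01)"
      unfolding superlevel_measure_def
    proof (rule finite_measure_eq_AE)
      show "AE s in U01. s \<in> {s \<in> {0<..<1}. 0 \<le> f s} \<longleftrightarrow> s \<in> space U01"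
        using f01 by eventually_elim auto
    qed (rule sets_superlevel[OF f] sets.top)+
    then have "superlevel_measure h 0 = 1" using prob_space by (simp add: level)
    moreover have "superlevel_measure h 0 \<le> measure U01 {s \<in> {0<..<1}. s \<le> t}"
      unfolding superlevel_measure_def
    proof (rule finite_measure_mono)
      show "{s \<in> {0<..<1}. 0 \<le> h s} \<subseteq> {s \<in> {0<..<1}. s \<le> t}"
        using anti[OF t] \<open>\<not> 0 \<le> h t\<close> by force
      show "{s \<in> {0<..<1}. s \<le> t} \<in> sets U01"
        using sets_superlevel[of "\<lambda>s. - s" "- t"] by simp
    qed
    ultimately show False using measure_unit_interval_le[of t] t by simp
  qed
  have "(LINT t:{0<..<x}|lborel. h t) = (LINT t:{0<..<1}|lborel. of_bool (t < x) * h t)"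
    unfolding set_lebesgue_integral_def using x
    by (intro Bochner_Integration.integral_cong) (auto simp: indicator_def)
  also have "\<dots> = (LINT t|U01. of_bool (t < x) * h t)"
    unfolding set_lebesgue_integral_def by (subst integral_restrict_space) auto
  also have "\<dots> = (LINT t|U01. LINT u|U01. of_bool (t < x \<and> u \<le> h t))"
  proof (rule Bochner_Integration.integral_cong[OF refl])
    fix t assume "t \<in> space U01"
    then show "of_bool (t < x) * h t = (LINT u|U01. of_bool (t < x \<and> u \<le> h t))"
      using integral_of_bool_le[of "h t"] h_le[of t] h_ge[of t] by simp
  qed
  also have "\<dots> = (LINT u|U01. LINT t|U01. of_bool (t < x \<and> u \<le> h t))"
  proof (rule integral_unit_interval_swap[where C = 1, symmetric])
    have "Measurable.pred (U01 \<Otimes>\<^sub>M U01) (\<lambda>y. fst y < x \<and> snd y \<le> h (fst y))"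
      by measurable
    from measurable_compose[OF this, of of_bool borel]
    show "(\<lambda>(t, u). of_bool (t < x \<and> u \<le> h t) :: real) \<in> borel_measurable (U01 \<Otimes>\<^sub>M U01)"
      by (simp add: case_prod_beta')
  qed simp
  also have "\<dots> = (LINT u|U01. min x (superlevel_measure f u))"
  proof (rule Bochner_Integration.integral_cong[OF refl])
    fix u
    have "AE t in U01. u \<le> h t \<longleftrightarrow> t \<le> superlevel_measure h u"
      unfolding superlevel_measure_def
    proof (rule unit_interval_downset_AE[where G = UNIV])
      fix s t assume "s \<in> UNIV \<inter> {0<..<1::real}" "t \<in> UNIV \<inter> {0<..<1::real}" "s < t" "u \<le> h t"
      with anti[of s t] show "u \<le> h s" by simp
    qed simp_all
    then have "(LINT t|U01. of_bool (t < x \<and> u \<le> h t) :: real) =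
        (LINT t|U01. of_bool (t \<le> min x (superlevel_measure h u)))"
      using AE_unit_interval_neq[of x]
      by (intro integral_cong_AE) (auto elim!: eventually_elim2)
    also have "\<dots> = min x (superlevel_measure h u)"
      using x superlevel_measure_bounds[of h u] by (intro integral_of_bool_le) auto
    finally show "(LINT t|U01. of_bool (t < x \<and> u \<le> h t) :: real) = min x (superlevel_measure f u)"
      by (simp add: level)
  qed
  finally show ?thesis .
qed

lemma schur_le_imp_superlevel_le:
  assumes fg: "schur_le f g"
    and f: "f \<in> borel_measurable U01" "AE t in U01. 0 \<le> f t \<and> f t \<le> 1"
    and g: "g \<in> borel_measurable U01" "AE t in U01. 0 \<le> g t \<and> g t \<le> 1"
  shows "superlevel_le f g"
proof -
  have "is_decr_rearrangement f (decr_rearrangement f)" "is_decr_rearrangement g (decr_rearrangement g)"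
    using fg by (auto simp: schur_le_def intro!: is_decr_rearrangement_decr_rearrangement)
  from decr_rearrangement_integral[OF this(1) f] decr_rearrangement_integral[OF this(2) g]
  have *: "(LINT t:{0<..<x}|lborel. decr_rearrangement f t) = (LINT u|U01. min x (superlevel_measure f u))"
    "(LINT t:{0<..<x}|lborel. decr_rearrangement g t) = (LINT u|U01. min x (superlevel_measure g u))"
    if "x \<in> {0<..1}" for x using that by auto
  have "min 1 (superlevel_measure h u) = superlevel_measure h u" for h u
    using superlevel_measure_bounds[of h u] by simp
  with fg *[of 1] * show ?thesis by (auto simp: schur_le_def superlevel_le_def)
qed

section \<open>Quantization\<close>

definition level_set_map :: "nat \<Rightarrow> nat \<Rightarrow> (nat \<Rightarrow> nat \<Rightarrow> real set) \<Rightarrow> (nat \<Rightarrow> real) \<Rightarrow> nat \<Rightarrow> nat" where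
  "level_set_map d n D x = (\<lambda>i. if i \<le> d then level n (\<lambda>j. x i \<in> D i j) else 0)"

definition down_set :: "real set \<Rightarrow> bool" where
  "down_set D \<longleftrightarrow> (\<forall>x\<in>D. \<forall>y\<le>x. y \<in> D)"

text \<open>The Schur order only sees half-lines \<open>{..c}\<close>. Every down-set is a pointwise limit of these.\<close>

lemma down_set_approx:
  assumes "down_set D"
  shows "\<exists>s::nat \<Rightarrow> real. \<forall>x. \<forall>\<^sub>F m in sequentially. x \<le> s m \<longleftrightarrow> x \<in> D"
proof -
  have ev: "\<forall>\<^sub>F m in sequentially. x \<le> real m" for x :: real
    using filterlim_real_sequentially by (simp add: filterlim_at_top)
  consider "D = {}" | "D = UNIV" | a where "D = {..a}" | a where "D = {..<a}"
  proof (cases "D = {} \<or> D = UNIV")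
    case False
    then obtain z where "z \<notin> D" and ne: "D \<noteq> {}" by blast
    have bdd: "bdd_above D"
    proof (rule bdd_aboveI[of _ z])
      show "x \<le> z" if "x \<in> D" for x
        using assms that \<open>z \<notin> D\<close> unfolding down_set_def by (meson linear)
    qed
    have "{..<Sup D} \<subseteq> D"
    proof
      fix x assume "x \<in> {..<Sup D}"
      then obtain y where "y \<in> D" "x < y" using less_cSup_iff[OF ne bdd] by auto
      with assms show "x \<in> D" by (auto simp: down_set_def)
    qed
    moreover have "D \<subseteq> {..Sup D}" using bdd by (auto intro: cSup_upper)
    ultimately have "D = (if Sup D \<in> D then {..Sup D} else {..<Sup D})"
      by (auto simp: order_le_less)
    then show ?thesis using that(3,4) by (metis (full_types))
  qed (use that in blast)
  then show ?thesis
  proof cases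
    case 1
    have "\<forall>\<^sub>F m in sequentially. x \<le> - real m \<longleftrightarrow> x \<in> D" for x
      using ev[of "1 - x"] 1 by (auto elim!: eventually_mono)
    then show ?thesis by (intro exI[of _ "\<lambda>m. - real m"] allI)
  next
    case 2
    have "\<forall>\<^sub>F m in sequentially. x \<le> real m \<longleftrightarrow> x \<in> D" for x
      using ev[of x] 2 by (auto elim!: eventually_mono)
    then show ?thesis by (intro exI[of _ "\<lambda>m. real m"] allI)
  next
    case (3 a)
    then show ?thesis by (intro exI[of _ "\<lambda>_. a"]) auto
  next
    case (4 a)
    have "\<forall>\<^sub>F m in sequentially. x \<le> a - inverse (real (Suc m)) \<longleftrightarrow> x \<in> D" for x
    proof (cases "x < a")
      case True
      then have "\<forall>\<^sub>F m in sequentially. inverse (real (Suc m)) < a - x"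
        using order_tendstoD(2)[OF LIMSEQ_inverse_real_of_nat, of "a - x"] by simp
      then show ?thesis by eventually_elim (use True 4 in auto)
    next
      case False
      have "\<not> x \<le> a - inverse (real (Suc m))" for m
        using False inverse_positive_iff_positive[of "real (Suc m)"] by linarith
      then show ?thesis using False 4 by auto
    qed
    then show ?thesis by (intro exI[of _ "\<lambda>m. a - inverse (real (Suc m))"] allI)
  qed
qed

lemma measurable_level_map_component:
  assumes P: "sets P = sets (vec_space d)" and i: "i \<le> d"
  shows "(\<lambda>x. level_map d n v x i) \<in> measurable P (count_space UNIV)"
proof -
  have [measurable]: "(\<lambda>x. x i) \<in> borel_measurable P"
    unfolding measurable_cong_sets[OF P refl] using i by (intro measurable_component_singleton) simp
  have "(\<lambda>x. level n (\<lambda>j. x i \<le> v i j)) \<in> measurable P (count_space UNIV)"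
    by (intro measurable_level) measurable
  then show ?thesis using i by (simp add: level_map_def)
qed

lemma level_map_le: "level_map d n v x i \<le> n"
  and level_map_off: "d < i \<Longrightarrow> level_map d n v x i = 0"
  by (auto simp: level_map_def level_le)

text \<open>At each \<open>x\<close> only finitely many threshold comparisons matter, so the
  integrands are eventually constant in \<open>m\<close>; they share a bound because the grid is
  finite.\<close>

lemma level_map_tendsto:
  fixes g :: "(nat \<Rightarrow> nat) \<Rightarrow> real"
  assumes "prob_space P" and P: "sets P = sets (vec_space d)"
    and s: "\<And>i j x. i \<le> d \<Longrightarrow> j < n \<Longrightarrow> \<forall>\<^sub>F m in sequentially. x \<le> s i j m \<longleftrightarrow> x \<in> D i j"
  shows "(\<lambda>m. LINT x|P. g (level_map d n (\<lambda>i j. s i j m) x)) \<longlonglongrightarrow> (LINT x|P. g (level_set_map d n D x))"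
    and "(\<lambda>x. g (level_set_map d n D x)) \<in> borel_measurable P"
proof -
  interpret prob_space P by fact
  let ?V = "{l :: nat \<Rightarrow> nat. (\<forall>i. l i \<le> n) \<and> (\<forall>i>d. l i = 0)}"
  have meas: "(\<lambda>x. g (level_map d n (\<lambda>i j. s i j m) x)) \<in> borel_measurable P" for m
    by (rule borel_measurable_bounded_vector[where n = n and d = d, OF measurable_level_map_component[OF P]])
       (simp_all add: level_map_le level_map_off)
  have lim: "(\<lambda>m. g (level_map d n (\<lambda>i j. s i j m) x)) \<longlonglongrightarrow> g (level_set_map d n D x)" for x
  proof (rule tendsto_eventually)
    have "\<forall>\<^sub>F m in sequentially. \<forall>i\<in>{..d}. \<forall>j\<in>{..<n}. x i \<le> s i j m \<longleftrightarrow> x i \<in> D i j"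
      using s by (intro eventually_ball_finite ballI) auto
    then show "\<forall>\<^sub>F m in sequentially. g (level_map d n (\<lambda>i j. s i j m) x) = g (level_set_map d n D x)"
      by eventually_elim
        (auto simp: level_map_def level_set_map_def fun_eq_iff intro!: arg_cong[where f = g] level_cong)
  qed
  show m: "(\<lambda>x. g (level_set_map d n D x)) \<in> borel_measurable P"
    using lim by (intro borel_measurable_LIMSEQ_real[OF _ meas])
  have bd: "\<bar>g (level_map d n v x)\<bar> \<le> (\<Sum>l\<in>?V. \<bar>g l\<bar>)" for v x
    by (rule member_le_sum[where f = "\<lambda>l. \<bar>g l\<bar>", OF _ _ finite_bounded_vectors])
       (auto simp: level_map_le level_map_off)
  show "(\<lambda>m. LINT x|P. g (level_map d n (\<lambda>i j. s i j m) x)) \<longlonglongrightarrow> (LINT x|P. g (level_set_map d n D x))"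
    using m meas lim bd
    by (intro integral_dominated_convergence[where w = "\<lambda>_. \<Sum>l\<in>?V. \<bar>g l\<bar>"]) auto
qed

text \<open>Formulated for laws and kernels so that it serves twice: with \<open>P\<close> the law
  of \<open>X\<close>, and with \<open>P\<close> the product of the marginals of
  \<open>Q\<close>.\<close>

locale ordered_pair = P: conditional_product P d \<kappa> + Q: conditional_product Q d \<kappa>'
  for P Q :: "(nat \<Rightarrow> real) measure" and d \<kappa> \<kappa>' +
  assumes P0_eq: "distr P borel (\<lambda>x. x 0) = distr Q borel (\<lambda>x. x 0)"
    and schur: "i \<in> {1..d} \<Longrightarrow> superlevel_le (\<lambda>t. \<kappa> i {..c} (P.q t)) (\<lambda>t. \<kappa>' i {..c} (P.q t))"
    and stoch_incr: "i \<in> {1..d} \<Longrightarrow>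
      \<exists>A. (AE t in U01. t \<in> A) \<and> antimono_on (A \<inter> {0<..<1}) (\<lambda>t. \<kappa>' i {..c} (P.q t))"
begin

lemma q_eq: "P.q = Q.q"
  by (simp add: P.q_def[abs_def] Q.q_def[abs_def] P0_eq)

context
  fixes n :: nat and v :: "nat \<Rightarrow> nat \<Rightarrow> real"
  assumes v_mono: "\<And>i j. i \<le> d \<Longrightarrow> Suc j < n \<Longrightarrow> v i j \<le> v i (Suc j)"
begin

interpretation TP: threshold_levels P d \<kappa> n v
  by unfold_locales (rule v_mono)

interpretation TQ: threshold_levels Q d \<kappa>' n v
  by unfold_locales (rule v_mono)

lemma k_eq: "TP.k = TQ.k"
  by (simp add: TP.k_def[abs_def] TQ.k_def[abs_def] q_eq)

lemma integral_Q_eq_star: "(LINT x|Q. g (level_map d n v x)) = TQ.E g (TQ.star_rel TQ.F)" for g :: "_ \<Rightarrow> real"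
  unfolding TQ.integral_level_map
  using stoch_incr by (intro TQ.E_eq_E_star TQ.conditional_cdfs_F) (simp add: TQ.F_def[abs_def] q_eq)

lemma level_map_supermodular_le:
  assumes g: "nat_supermodular g"
  shows "(LINT x|P. g (level_map d n v x)) \<le> (LINT x|Q. g (level_map d n v x))"
proof -
  have "(LINT x|P. g (level_map d n v x)) \<le> TP.E g (TP.star_rel TP.F)"
    unfolding TP.integral_level_map by (rule TP.E_le_E_star[OF TP.conditional_cdfs_F g])
  also have "\<dots> \<le> TP.E g (TP.star_rel TQ.F)"
  proof (rule TP.E_le_E_concordance[OF g])
    show "TP.rel_path (TP.star_rel TP.F)" by (rule TP.rel_path_star_rel[OF TP.conditional_cdfs_F])
    show "TP.rel_path (TP.star_rel TQ.F)" by (rule TP.rel_path_star_rel[OF TQ.conditional_cdfs_F])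
    show "TP.rel_concordance_le (TP.star_rel TP.F i) (TP.star_rel TQ.F i)" if "i \<in> {1..d}" for i
      using schur[OF that]
      by (intro TP.rel_concordance_le_star_rel) (simp add: TP.F_def[abs_def] TQ.F_def[abs_def] q_eq)
  qed
  also have "\<dots> = TQ.E g (TQ.star_rel TQ.F)" by (simp add: k_eq)
  finally show ?thesis by (simp add: integral_Q_eq_star)
qed

lemma level_map_association:
  fixes g g' :: "(nat \<Rightarrow> nat) \<Rightarrow> real"
  assumes "mono g" "mono g'"
  shows "(LINT x|Q. g (level_map d n v x)) * (LINT x|Q. g' (level_map d n v x)) \<le>
    (LINT x|Q. g (level_map d n v x) * g' (level_map d n v x))"
  using TQ.E_star_association[OF TQ.conditional_cdfs_F assms]
  by (simp add: integral_Q_eq_star integral_Q_eq_star[of "\<lambda>l. g l * g' l"])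

end

context
  fixes n :: nat and D :: "nat \<Rightarrow> nat \<Rightarrow> real set"
  assumes down: "\<And>i j. down_set (D i j)" and inc: "\<And>i j. D i j \<subseteq> D i (Suc j)"
begin

text \<open>If two consecutive down-sets differ, a point of the difference eventually separates
  their thresholds. If they coincide, so do the thresholds, because the approximating sequence is
  chosen as a function of the set alone.\<close>

lemma threshold_approx:
  "\<exists>s :: nat \<Rightarrow> nat \<Rightarrow> nat \<Rightarrow> real.
    (\<forall>i j x. \<forall>\<^sub>F m in sequentially. x \<le> s i j m \<longleftrightarrow> x \<in> D i j) \<and>
    (\<forall>\<^sub>F m in sequentially. \<forall>i\<in>{..d}. \<forall>j\<in>{..<n}. s i j m \<le> s i (Suc j) m)"
proof -
  from down_set_approx have "\<forall>S. \<exists>s::nat \<Rightarrow> real. down_set S \<longrightarrow> (\<forall>x. \<forall>\<^sub>F m in sequentially. x \<le> s m \<longleftrightarrow> x \<in> S)"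
    by blast
  then obtain \<sigma> :: "real set \<Rightarrow> nat \<Rightarrow> real" where
    \<sigma>: "\<And>S x. down_set S \<Longrightarrow> \<forall>\<^sub>F m in sequentially. x \<le> \<sigma> S m \<longleftrightarrow> x \<in> S" by metis
  show ?thesis
  proof (intro exI[of _ "\<lambda>i j. \<sigma> (D i j)"] conjI allI)
    show "\<forall>\<^sub>F m in sequentially. \<forall>i\<in>{..d}. \<forall>j\<in>{..<n}. \<sigma> (D i j) m \<le> \<sigma> (D i (Suc j)) m"
    proof (intro eventually_ball_finite ballI)
      fix i j
      show "\<forall>\<^sub>F m in sequentially. \<sigma> (D i j) m \<le> \<sigma> (D i (Suc j)) m"
      proof (cases "D i (Suc j) = D i j")
        case False
        with inc[of i j] obtain x where "x \<in> D i (Suc j)" "x \<notin> D i j" by blast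
        with \<sigma>[OF down, of x i j] \<sigma>[OF down, of x i "Suc j"] show ?thesis
          by (auto elim: eventually_elim2)
      qed simp
    qed simp_all
  qed (rule \<sigma>[OF down])
qed

lemma level_set_map_supermodular_le:
  assumes g: "nat_supermodular g"
  shows "(LINT x|P. g (level_set_map d n D x)) \<le> (LINT x|Q. g (level_set_map d n D x))"
proof -
  obtain s where s: "\<And>i j x. \<forall>\<^sub>F m in sequentially. x \<le> s i j m \<longleftrightarrow> x \<in> D i j"
    "\<forall>\<^sub>F m in sequentially. \<forall>i\<in>{..d}. \<forall>j\<in>{..<n}. s i j m \<le> s i (Suc j) m"
    using threshold_approx by blast
  show ?thesis
  proof (rule tendsto_le[OF sequentially_bot level_map_tendsto(1) level_map_tendsto(1)])
    show "\<forall>\<^sub>F m in sequentially. (LINT x|P. g (level_map d n (\<lambda>i j. s i j m) x)) \<le>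
        (LINT x|Q. g (level_map d n (\<lambda>i j. s i j m) x))"
      using s(2) by eventually_elim (intro level_map_supermodular_le g, auto)
  qed (use s P.prob_space_axioms Q.prob_space_axioms P.sets_P Q.sets_P in auto)
qed

lemma level_set_map_association:
  fixes g g' :: "(nat \<Rightarrow> nat) \<Rightarrow> real"
  assumes "mono g" "mono g'"
  shows "(LINT x|Q. g (level_set_map d n D x)) * (LINT x|Q. g' (level_set_map d n D x)) \<le>
    (LINT x|Q. g (level_set_map d n D x) * g' (level_set_map d n D x))"
proof -
  obtain s where s: "\<And>i j x. \<forall>\<^sub>F m in sequentially. x \<le> s i j m \<longleftrightarrow> x \<in> D i j"
    "\<forall>\<^sub>F m in sequentially. \<forall>i\<in>{..d}. \<forall>j\<in>{..<n}. s i j m \<le> s i (Suc j) m"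
    using threshold_approx by blast
  note lim = level_map_tendsto(1)[OF Q.prob_space_axioms Q.sets_P s(1)]
  show ?thesis
  proof (rule tendsto_le[OF sequentially_bot lim[where n = n and g = "\<lambda>l. g l * g' l"] tendsto_mult[OF lim[where n = n and g = g] lim[where n = n and g = g']]])
    show "\<forall>\<^sub>F m in sequentially. (LINT x|Q. g (level_map d n (\<lambda>i j. s i j m) x)) *
        (LINT x|Q. g' (level_map d n (\<lambda>i j. s i j m) x)) \<le>
        (LINT x|Q. g (level_map d n (\<lambda>i j. s i j m) x) * g' (level_map d n (\<lambda>i j. s i j m) x))"
      using s(2) by eventually_elim (intro level_map_association assms, auto)
  qed
qed

end

end

text \<open>Each coordinate passes to its level and back to a representative point. As the
  \<open>e i\<close> are increasing, the way back respects \<open>inf\<close> and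
  \<open>sup\<close>, so a supermodular function of the points is supermodular in the
  levels.\<close>

definition quantizer :: "nat \<Rightarrow> ((nat \<Rightarrow> real) \<Rightarrow> nat \<Rightarrow> real) \<Rightarrow> bool" where
  "quantizer d \<rho> \<longleftrightarrow> (\<exists>n D e. (\<forall>i j. down_set (D i j) \<and> D i j \<subseteq> D i (Suc j)) \<and> (\<forall>i. mono (e i)) \<and>
     \<rho> = (\<lambda>x. \<lambda>i\<in>{0..d}. e i (level_set_map d n D x i)))"

definition bounded_monos :: "nat \<Rightarrow> (nat \<Rightarrow> real \<Rightarrow> real) \<Rightarrow> bool" where
  "bounded_monos d V \<longleftrightarrow> (\<forall>i\<le>d. mono (V i) \<and> (\<exists>C. \<forall>s. \<bar>V i s\<bar> \<le> C))"

text \<open>\<open>V i\<close> may jump, and \<open>f\<close> with it. Cutting the range of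
  \<open>V i\<close>, rather than the coordinate axis, into short intervals still makes the
  approximation of \<open>f\<close> uniform.\<close>

definition modulus :: "nat \<Rightarrow> (nat \<Rightarrow> real \<Rightarrow> real) \<Rightarrow> ((nat \<Rightarrow> real) \<Rightarrow> real) \<Rightarrow> bool" where
  "modulus d V f \<longleftrightarrow> (\<forall>x\<in>space (vec_space d). \<forall>y\<in>space (vec_space d).
     \<bar>f x - f y\<bar> \<le> (\<Sum>i\<le>d. \<bar>V i (x i) - V i (y i)\<bar>))"

text \<open>\<open>e j\<close> is a point at which \<open>V\<close> takes a value in the \<open>j\<close>-th interval of length \<open>\<epsilon>\<close>. For an
  interval that \<open>V\<close> misses, the previous point is reused, which keeps \<open>e\<close> increasing.\<close>

lemma mono_quantization:
  fixes V :: "real \<Rightarrow> real"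
  assumes V: "mono V" "\<And>s. \<bar>V s\<bar> \<le> C" and \<epsilon>: "0 < \<epsilon>"
  shows "\<exists>D e n0. (\<forall>j. down_set (D j) \<and> D j \<subseteq> D (Suc j)) \<and> mono e \<and>
    (\<forall>n\<ge>n0. \<forall>s. \<bar>V (e (level n (\<lambda>j. s \<in> D j))) - V s\<bar> \<le> \<epsilon>)"
proof -
  have bdd: "bdd_below (range V)" using V(2) by (intro bdd_belowI[of _ "- C"]) (auto simp: abs_le_iff minus_le_iff)
  define W where "W s = V s - Inf (range V)" for s
  have W0: "0 \<le> W s" for s using bdd by (auto simp: W_def intro!: cInf_lower)
  have W_mono: "mono W" using V(1) by (auto simp: W_def mono_def)
  have "- C \<le> Inf (range V)" using V(2) by (intro cInf_greatest) (auto simp: abs_le_iff minus_le_iff)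
  then have WC: "W s \<le> 2 * C" for s using V(2)[of s] by (auto simp: W_def)
  define D where "D j = {s. W s < real (Suc j) * \<epsilon>}" for j
  define N where "N j s \<longleftrightarrow> real j * \<epsilon> \<le> W s \<and> W s < real (Suc j) * \<epsilon>" for j s
  \<comment> \<open>The infimum of \<open>W\<close> is 0 by construction, so the lowest interval is
    always hit; this starts the recursion for \<open>e\<close>.\<close>
  have "\<exists>s. W s < \<epsilon>"
    using cInf_lessD[of "range V" "Inf (range V) + \<epsilon>"] \<epsilon> by (auto simp: W_def algebra_simps)
  then obtain e0 where e0: "W e0 < \<epsilon>" by blast
  define e where "e = rec_nat e0 (\<lambda>j x. if \<exists>s. N (Suc j) s then SOME s. N (Suc j) s else x)"
  have e_simps: "e 0 = e0" "\<And>j. e (Suc j) = (if \<exists>s. N (Suc j) s then SOME s. N (Suc j) s else e j)"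
    unfolding e_def by (rule old.nat.rec)+
  have sel: "N (Suc j) (e (Suc j))" if "\<exists>s. N (Suc j) s" for j
    unfolding e_simps(2) if_P[OF that] by (rule someI_ex[OF that])
  have e_lt: "W (e j) < real (Suc j) * \<epsilon>" for j
  proof (induction j)
    case (Suc j)
    then have "W (e j) < real (Suc (Suc j)) * \<epsilon>" using \<epsilon> by (simp add: algebra_simps)
    show ?case
    proof (cases "\<exists>s. N (Suc j) s")
      case True
      from sel[OF this] show ?thesis by (simp add: N_def)
    next
      case False
      then have "e (Suc j) = e j" unfolding e_simps(2) by (rule if_not_P)
      with \<open>W (e j) < real (Suc (Suc j)) * \<epsilon>\<close> show ?thesis by simp
    qed
  qed (simp add: e_simps e0)
  have "mono e"
  proof (rule incseq_SucI)
    fix j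
    show "e j \<le> e (Suc j)"
    proof (cases "\<exists>s. N (Suc j) s")
      case True
      then have "N (Suc j) (e (Suc j))" by (rule sel)
      with e_lt[of j] have "W (e j) < W (e (Suc j))" by (simp add: N_def)
      then show ?thesis using monoD[OF W_mono, of "e (Suc j)" "e j"] by linarith
    next
      case False
      then have "e (Suc j) = e j" unfolding e_simps(2) by (rule if_not_P)
      then show ?thesis by simp
    qed
  qed
  moreover have "down_set (D j)" "D j \<subseteq> D (Suc j)" for j
    using W_mono \<epsilon> by (auto simp: down_set_def D_def mono_def algebra_simps intro: le_less_trans)
  \<comment> \<open>\<open>W\<close> takes values in [0, 2C], so \<open>n0\<close> intervals of
    length \<open>\<epsilon>\<close> cover its range and every level is below \<open>n\<close>.
    Positivity of \<open>n0\<close> is for the index \<open>n - 1\<close>.\<close>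
  moreover obtain n0 :: nat where n0: "2 * C < real n0 * \<epsilon>" "0 < n0"
  proof -
    obtain m :: nat where "2 * C / \<epsilon> < real m" using reals_Archimedean2 by blast
    then have "2 * C < real (Suc m) * \<epsilon>" using \<epsilon> by (simp add: field_simps)
    then show ?thesis by (rule that) simp
  qed
  have "\<bar>V (e (level n (\<lambda>j. s \<in> D j))) - V s\<bar> \<le> \<epsilon>" if n: "n0 \<le> n" for n s
  proof -
    define m where "m = level n (\<lambda>j. s \<in> D j)"
    have nest: "nested n (\<lambda>j. s \<in> D j)" using \<open>\<And>j. D j \<subseteq> D (Suc j)\<close> by (auto simp: nested_def)
    have "real n0 * \<epsilon> \<le> real n * \<epsilon>" using n \<epsilon> by simp
    then have "s \<in> D (n - 1)" using WC[of s] n0 n by (simp add: D_def)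
    then have "m \<le> n - 1" using level_le_iff[OF nest, of "n - 1"] n0 n by (simp add: m_def)
    then have "m < n" using n0 n by simp
    then have "s \<in> D m" using level_le_iff[OF nest, of m] by (simp add: m_def)
    moreover have "s \<notin> D (m - 1)" if "0 < m"
    proof
      assume "s \<in> D (m - 1)"
      then have "m \<le> m - 1" using level_le_iff[OF nest, of "m - 1"] \<open>m < n\<close> that
        unfolding m_def[symmetric] by simp
      with that show False by simp
    qed
    ultimately have s: "N m s" using W0[of s] by (cases m) (auto simp: N_def D_def)
    have "N m (e m)"
    proof (cases m)
      case 0
      then show ?thesis using e0 W0 by (simp add: N_def e_simps)
    next
      case (Suc m')
      with s have "\<exists>s. N (Suc m') s" by auto
      from sel[OF this] show ?thesis unfolding Suc .
    qed
    with s have "\<bar>W (e m) - W s\<bar> \<le> \<epsilon>" by (simp add: N_def abs_le_iff algebra_simps)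
    then show ?thesis by (simp add: W_def m_def)
  qed
  ultimately show ?thesis by blast
qed

text \<open>The quantizers depend on \<open>V\<close> alone, not on \<open>f\<close>. Two functions
  with a common modulus can therefore be quantized together, which association requires.\<close>

lemma quantizer_approx:
  assumes V: "bounded_monos d V"
  shows "\<exists>\<rho>. (\<forall>m. quantizer d (\<rho> m)) \<and>
    (\<forall>f. modulus d V f \<longrightarrow> (\<forall>x\<in>space (vec_space d). (\<lambda>m. f (\<rho> m x)) \<longlonglongrightarrow> f x))"
proof -
  have "\<exists>\<rho>. quantizer d \<rho> \<and> (\<forall>f. modulus d V f \<longrightarrow> (\<forall>x\<in>space (vec_space d). \<bar>f (\<rho> x) - f x\<bar> \<le> inverse (real (Suc m))))" for m
  proof -
    \<comment> \<open>The tolerance 1/(m + 1) is split evenly over the \<open>d + 1\<close>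
      coordinates.\<close>
    define \<epsilon> where "\<epsilon> = inverse (real (Suc m)) / real (Suc d)"
    have \<epsilon>: "0 < \<epsilon>" by (simp add: \<epsilon>_def)
    have "\<exists>D e n0. (\<forall>j. down_set (D j) \<and> D j \<subseteq> D (Suc j)) \<and> mono e \<and>
      (i \<le> d \<longrightarrow> (\<forall>n\<ge>n0. \<forall>s. \<bar>V i (e (level n (\<lambda>j. s \<in> D j))) - V i s\<bar> \<le> \<epsilon>))" for i
    proof (cases "i \<le> d")
      case True
      with V obtain C where "mono (V i)" "\<And>s. \<bar>V i s\<bar> \<le> C" by (auto simp: bounded_monos_def)
      from mono_quantization[OF this \<epsilon>] show ?thesis by blast
    next
      case False
      then show ?thesis by (intro exI[of _ "\<lambda>_. {}"] exI[of _ "\<lambda>_. 0"]) (auto simp: down_set_def mono_def)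
    qed
    then obtain D :: "nat \<Rightarrow> nat \<Rightarrow> real set" and e n0 where
      D: "\<And>i j. down_set (D i j) \<and> D i j \<subseteq> D i (Suc j)" "\<And>i. mono (e i)"
      "\<And>i n s. i \<le> d \<Longrightarrow> n0 i \<le> n \<Longrightarrow> \<bar>V i (e i (level n (\<lambda>j. s \<in> D i j))) - V i s\<bar> \<le> \<epsilon>"
      by metis
    define n where "n = (\<Sum>i\<le>d. n0 i)"
    have n: "n0 i \<le> n" if "i \<le> d" for i
      unfolding n_def using that by (intro member_le_sum) auto
    define \<rho> where "\<rho> = (\<lambda>x. \<lambda>i\<in>{0..d}. e i (level_set_map d n D x i))"
    have "quantizer d \<rho>" unfolding quantizer_def \<rho>_def using D by blast
    moreover have "\<bar>f (\<rho> x) - f x\<bar> \<le> inverse (real (Suc m))"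
      if f: "modulus d V f" and x: "x \<in> space (vec_space d)" for f x
    proof -
      have "\<rho> x \<in> space (vec_space d)" by (simp add: \<rho>_def space_PiM)
      with f x have "\<bar>f (\<rho> x) - f x\<bar> \<le> (\<Sum>i\<le>d. \<bar>V i (\<rho> x i) - V i (x i)\<bar>)"
        by (auto simp: modulus_def)
      also have "\<dots> \<le> (\<Sum>i\<le>d. \<epsilon>)"
        using D(3) n by (intro sum_mono) (auto simp: \<rho>_def level_set_map_def)
      also have "\<dots> = inverse (real (Suc m))" by (simp add: \<epsilon>_def del: of_nat_Suc)
      finally show ?thesis .
    qed
    ultimately show ?thesis by blast
  qed
  then obtain \<rho> where \<rho>: "\<And>m. quantizer d (\<rho> m)"
    "\<And>m f x. modulus d V f \<Longrightarrow> x \<in> space (vec_space d) \<Longrightarrow> \<bar>f (\<rho> m x) - f x\<bar> \<le> inverse (real (Suc m))"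
    by metis
  have "(\<lambda>m. f (\<rho> m x)) \<longlonglongrightarrow> f x" if "modulus d V f" "x \<in> space (vec_space d)" for f x
  proof (rule LIM_zero_cancel, rule Lim_null_comparison)
    show "\<forall>\<^sub>F m in sequentially. norm (f (\<rho> m x) - f x) \<le> inverse (real (Suc m))"
      using \<rho>(2)[OF that] by simp
  qed (rule LIMSEQ_inverse_real_of_nat)
  with \<rho>(1) show ?thesis by blast
qed

lemma modulus_bounded:
  assumes V: "bounded_monos d V" and f: "modulus d V f"
  shows "\<exists>C. \<forall>x\<in>space (vec_space d). \<bar>f x\<bar> \<le> C"
proof -
  have "\<exists>C. \<forall>s. i \<le> d \<longrightarrow> \<bar>V i s\<bar> \<le> C" for i using V by (auto simp: bounded_monos_def)
  then obtain C where C: "\<And>i s. i \<le> d \<Longrightarrow> \<bar>V i s\<bar> \<le> C i" by metis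
  define z where "z = (\<lambda>i\<in>{0..d}. 0 :: real)"
  have z: "z \<in> space (vec_space d)" by (simp add: z_def space_PiM)
  have "\<bar>f x\<bar> \<le> \<bar>f z\<bar> + (\<Sum>i\<le>d. C i + C i)" if "x \<in> space (vec_space d)" for x
  proof -
    have "\<bar>f x - f z\<bar> \<le> (\<Sum>i\<le>d. \<bar>V i (x i) - V i (z i)\<bar>)"
      using f that z by (auto simp: modulus_def)
    also have "\<dots> \<le> (\<Sum>i\<le>d. C i + C i)"
      using C by (intro sum_mono order_trans[OF abs_triangle_ineq4] add_mono) auto
    finally show ?thesis by linarith
  qed
  then show ?thesis by blast
qed

lemma quantizer_integral_tendsto:
  fixes f :: "(nat \<Rightarrow> real) \<Rightarrow> real"
  assumes "prob_space P" and P: "sets P = sets (vec_space d)"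
    and \<rho>: "\<And>m. quantizer d (\<rho> m)"
    and lim: "\<And>x. x \<in> space (vec_space d) \<Longrightarrow> (\<lambda>m. f (\<rho> m x)) \<longlonglongrightarrow> f x"
    and C: "\<And>x. x \<in> space (vec_space d) \<Longrightarrow> \<bar>f x\<bar> \<le> C"
  shows "(\<lambda>m. LINT x|P. f (\<rho> m x)) \<longlonglongrightarrow> (LINT x|P. f x)"
proof -
  interpret prob_space P by fact
  have space: "space P = space (vec_space d)" by (rule sets_eq_imp_space_eq[OF P])
  have meas: "(\<lambda>x. f (\<rho> m x)) \<in> borel_measurable P" for m
  proof -
    obtain n D e where D: "\<And>i j. down_set (D i j)" and
      \<rho>m: "\<rho> m = (\<lambda>x. \<lambda>i\<in>{0..d}. e i (level_set_map d n D x i))"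
      using \<rho>[of m] unfolding quantizer_def by blast
    have "\<forall>i j. \<exists>s::nat \<Rightarrow> real. \<forall>x. \<forall>\<^sub>F m in sequentially. x \<le> s m \<longleftrightarrow> x \<in> D i j"
      using down_set_approx[OF D] by blast
    then obtain s :: "nat \<Rightarrow> nat \<Rightarrow> nat \<Rightarrow> real" where s: "\<And>i j x. \<forall>\<^sub>F m in sequentially. x \<le> s i j m \<longleftrightarrow> x \<in> D i j"
      by metis
    show ?thesis
      unfolding \<rho>m
      using level_map_tendsto(2)[OF assms(1) P s, where n = n and g = "\<lambda>l. f (\<lambda>i\<in>{0..d}. e i (l i))"] by simp
  qed
  have \<rho>_space: "\<rho> m x \<in> space (vec_space d)" for m x
    using \<rho>[of m] by (auto simp: quantizer_def space_PiM)
  \<comment> \<open>Measurability of \<open>f\<close> is inherited from the quantized functions,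
    whose pointwise limit it is.\<close>
  have "f \<in> borel_measurable P"
    using lim by (intro borel_measurable_LIMSEQ_real[OF _ meas]) (simp add: space)
  then show ?thesis
    using meas lim C \<rho>_space
    by (intro integral_dominated_convergence[where w = "\<lambda>_. C"]) (auto simp: space)
qed

section \<open>Comparison and association for functions with a bounded modulus\<close>

context ordered_pair begin

lemma quantizer_supermodular_le:
  assumes \<rho>: "quantizer d \<rho>" and f: "supermodular d f"
  shows "(LINT x|P. f (\<rho> x)) \<le> (LINT x|Q. f (\<rho> x))"
proof -
  obtain n D e where D: "\<And>i j. down_set (D i j)" "\<And>i j. D i j \<subseteq> D i (Suc j)" and e: "\<And>i. mono (e i)" and
    \<rho>: "\<rho> = (\<lambda>x. \<lambda>i\<in>{0..d}. e i (level_set_map d n D x i))"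
    using \<rho> unfolding quantizer_def by blast
  have "nat_supermodular (\<lambda>l. f (\<lambda>i\<in>{0..d}. e i (l i)))"
    unfolding nat_supermodular_def
  proof (intro allI)
    fix l l' :: "nat \<Rightarrow> nat"
    let ?h = "\<lambda>l. (\<lambda>i\<in>{0..d}. e i (l i))"
    have "inf (?h l) (?h l') = ?h (inf l l')" "sup (?h l) (?h l') = ?h (sup l l')"
      using e by (auto simp: fun_eq_iff inf_min sup_max min_of_mono max_of_mono)
    moreover have "?h l \<in> space (vec_space d)" "?h l' \<in> space (vec_space d)"
      by (simp_all add: space_PiM)
    ultimately show "f (?h l) + f (?h l') \<le> f (?h (inf l l')) + f (?h (sup l l'))"
      using f unfolding supermodular_def by metis
  qed
  from level_set_map_supermodular_le[where D = D, OF D this] show ?thesis by (simp add: \<rho>)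
qed

lemma quantizer_association:
  fixes f f' :: "(nat \<Rightarrow> real) \<Rightarrow> real"
  assumes \<rho>: "quantizer d \<rho>" and f: "mono_on (space (vec_space d)) f" "mono_on (space (vec_space d)) f'"
  shows "(LINT x|Q. f (\<rho> x)) * (LINT x|Q. f' (\<rho> x)) \<le> (LINT x|Q. f (\<rho> x) * f' (\<rho> x) :: real)"
proof -
  obtain n D e where D: "\<And>i j. down_set (D i j)" "\<And>i j. D i j \<subseteq> D i (Suc j)" and e: "\<And>i. mono (e i)" and
    \<rho>: "\<rho> = (\<lambda>x. \<lambda>i\<in>{0..d}. e i (level_set_map d n D x i))"
    using \<rho> unfolding quantizer_def by blast
  have "mono (\<lambda>l. h (\<lambda>i\<in>{0..d}. e i (l i)))" if "mono_on (space (vec_space d)) h" for h :: "_ \<Rightarrow> real"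
  proof (rule monoI)
    fix l l' :: "nat \<Rightarrow> nat" assume "l \<le> l'"
    then show "h (\<lambda>i\<in>{0..d}. e i (l i)) \<le> h (\<lambda>i\<in>{0..d}. e i (l' i))"
      using e by (intro mono_onD[OF that]) (auto simp: space_PiM le_fun_def mono_def)
  qed
  from level_set_map_association[where D = D, OF D this[OF f(1)] this[OF f(2)]] show ?thesis by (simp add: \<rho>)
qed

lemma modulus_supermodular_le:
  assumes V: "bounded_monos d V" and f: "modulus d V f" "supermodular d f"
  shows "(LINT x|P. f x) \<le> (LINT x|Q. f x)"
proof -
  obtain \<rho> where \<rho>: "\<And>m. quantizer d (\<rho> m)"
    "\<And>x. x \<in> space (vec_space d) \<Longrightarrow> (\<lambda>m. f (\<rho> m x)) \<longlonglongrightarrow> f x"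
    using quantizer_approx[OF V] f(1) by blast
  obtain C where C: "\<And>x. x \<in> space (vec_space d) \<Longrightarrow> \<bar>f x\<bar> \<le> C"
    using modulus_bounded[OF V f(1)] by blast
  show ?thesis
    by (rule LIMSEQ_le[OF quantizer_integral_tendsto[OF P.prob_space_axioms P.sets_P \<rho> C]
          quantizer_integral_tendsto[OF Q.prob_space_axioms Q.sets_P \<rho> C]])
       (use quantizer_supermodular_le[OF \<rho>(1) f(2)] in auto)
qed

lemma modulus_association:
  assumes V: "bounded_monos d V" and f: "modulus d V f" "modulus d V f'"
    and mono: "mono_on (space (vec_space d)) f" "mono_on (space (vec_space d)) f'"
  shows "(LINT x|Q. f x) * (LINT x|Q. f' x) \<le> (LINT x|Q. f x * f' x)"
proof -
  obtain \<rho> where \<rho>: "\<And>m. quantizer d (\<rho> m)"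
    "\<And>x. x \<in> space (vec_space d) \<Longrightarrow> (\<lambda>m. f (\<rho> m x)) \<longlonglongrightarrow> f x"
    "\<And>x. x \<in> space (vec_space d) \<Longrightarrow> (\<lambda>m. f' (\<rho> m x)) \<longlonglongrightarrow> f' x"
    using quantizer_approx[OF V] f by blast
  obtain C C' where C: "\<And>x. x \<in> space (vec_space d) \<Longrightarrow> \<bar>f x\<bar> \<le> C"
    "\<And>x. x \<in> space (vec_space d) \<Longrightarrow> \<bar>f' x\<bar> \<le> C'"
    using modulus_bounded[OF V f(1)] modulus_bounded[OF V f(2)] by blast
  note lim = quantizer_integral_tendsto[OF Q.prob_space_axioms Q.sets_P \<rho>(1)]
  have "\<bar>f x * f' x\<bar> \<le> C * C'" if "x \<in> space (vec_space d)" for x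
    unfolding abs_mult using C[OF that] by (intro mult_mono) (auto intro: order_trans[OF abs_ge_zero])
  then have "(\<lambda>m. LINT x|Q. f (\<rho> m x) * f' (\<rho> m x)) \<longlonglongrightarrow> (LINT x|Q. f x * f' x)"
    by (intro lim[where f = "\<lambda>x. f x * f' x"] tendsto_mult \<rho>)
  from LIMSEQ_le[OF tendsto_mult[OF lim[OF \<rho>(2) C(1)] lim[OF \<rho>(3) C(2)]] this]
  show ?thesis using quantizer_association[OF \<rho>(1) mono] by blast
qed

end

section \<open>Anchored supermodular functions\<close>

abbreviation vecs :: "nat \<Rightarrow> (nat \<Rightarrow> real) set" where
  "vecs d \<equiv> space (vec_space d)"

lemma vecs_upd: "x \<in> vecs d \<Longrightarrow> i \<le> d \<Longrightarrow> x(i := s) \<in> vecs d"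
  by (auto simp: space_PiM PiE_iff extensional_def)

lemma vecs_eqI: "x \<in> vecs d \<Longrightarrow> y \<in> vecs d \<Longrightarrow> (\<And>i. i \<le> d \<Longrightarrow> x i = y i) \<Longrightarrow> x = y"
  by (auto simp: space_PiM fun_eq_iff PiE_iff extensional_def) (metis not_le)

lemma vecs_restrict: "(\<lambda>i\<in>{0..d}. h i) \<in> vecs d"
  by (simp add: space_PiM)

lemma vecs_leI:
  assumes "x \<in> vecs d" "y \<in> vecs d" "\<And>i. i \<le> d \<Longrightarrow> x i \<le> y i" shows "x \<le> y"
proof (rule le_funI)
  fix i show "x i \<le> y i"
    using assms by (cases "i \<le> d") (auto simp: space_PiM PiE_iff extensional_def)
qed

lemma vecs_inf: "x \<in> vecs d \<Longrightarrow> y \<in> vecs d \<Longrightarrow> inf x y \<in> vecs d"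
  and vecs_sup: "x \<in> vecs d \<Longrightarrow> y \<in> vecs d \<Longrightarrow> sup x y \<in> vecs d"
  by (auto simp: space_PiM PiE_iff extensional_def)

lemma supermodularD:
  "supermodular d f \<Longrightarrow> x \<in> vecs d \<Longrightarrow> y \<in> vecs d \<Longrightarrow> f x + f y \<le> f (inf x y) + f (sup x y)"
  by (auto simp: supermodular_def)

lemma supermodular_increasing_differences:
  assumes f: "supermodular d f" and xy: "x \<in> vecs d" "y \<in> vecs d" "i \<le> d"
    and le: "\<And>j. j \<le> d \<Longrightarrow> j \<noteq> i \<Longrightarrow> x j \<le> y j" and st: "s \<le> t"
  shows "f (x(i := t)) - f (x(i := s)) \<le> f (y(i := t)) - f (y(i := s))"
proof -
  have "inf (x(i := t)) (y(i := s)) = x(i := s)" "sup (x(i := t)) (y(i := s)) = y(i := t)"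
    using xy le st
    by (auto intro!: vecs_eqI[of _ d] vecs_inf vecs_sup vecs_upd simp: inf_min sup_max min_def max_def intro: antisym)
  with supermodularD[OF f vecs_upd vecs_upd, of x i y i t s] xy
  show ?thesis by simp
qed

lemma coordinate_path:
  assumes xy: "x \<in> vecs d" "y \<in> vecs d"
  obtains z where "\<And>m. z m \<in> vecs d" "\<And>m j. z m j = x j \<or> z m j = y j"
    "\<And>f :: _ \<Rightarrow> real. f y - f x = (\<Sum>m\<le>d. f ((z m)(m := y m)) - f ((z m)(m := x m)))"
proof -
  define z where "z m = (\<lambda>i. if i < m then y i else x i)" for m
  have z: "z m \<in> vecs d" for m using xy by (auto simp: z_def space_PiM PiE_iff extensional_def)
  have "z 0 = x" by (simp add: z_def)
  moreover have "z (Suc d) = y"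
    by (rule vecs_eqI[OF z xy(2)]) (simp add: z_def)
  moreover have "z (Suc m) = (z m)(m := y m)" "z m = (z m)(m := x m)" for m
    by (auto simp: z_def fun_eq_iff)
  ultimately have "f y - f x = (\<Sum>m\<le>d. f ((z m)(m := y m)) - f ((z m)(m := x m)))" for f :: "_ \<Rightarrow> real"
    using sum_lessThan_telescope[of "\<lambda>m. f (z m)" "Suc d"] by (simp add: lessThan_Suc_atMost)
  with z show ?thesis by (intro that[of z]) (auto simp: z_def)
qed

lemma coordinatewise_mono:
  fixes f :: "(nat \<Rightarrow> real) \<Rightarrow> real"
  assumes xy: "x \<in> vecs d" "y \<in> vecs d" "x \<le> y"
    and step: "\<And>z m s t. z \<in> vecs d \<Longrightarrow> (\<And>j. z j = x j \<or> z j = y j) \<Longrightarrow> m \<le> d \<Longrightarrow> s \<le> t \<Longrightarrow>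
      f (z(m := s)) \<le> f (z(m := t))"
  shows "f x \<le> f y"
proof -
  obtain z where z: "\<And>m. z m \<in> vecs d" "\<And>m j. z m j = x j \<or> z m j = y j"
    "\<And>f :: _ \<Rightarrow> real. f y - f x = (\<Sum>m\<le>d. f ((z m)(m := y m)) - f ((z m)(m := x m)))"
    using coordinate_path[OF xy(1,2)] by blast
  have "0 \<le> (\<Sum>m\<le>d. f ((z m)(m := y m)) - f ((z m)(m := x m)))"
    using xy(3) z by (intro sum_nonneg) (auto simp: le_fun_def intro!: step)
  then show ?thesis using z(3)[of f] by simp
qed

locale anchored =
  fixes d :: nat and F :: "(nat \<Rightarrow> real) \<Rightarrow> real" and a :: "nat \<Rightarrow> real"
  assumes F: "supermodular d F" and a: "a \<in> vecs d" and axis: "\<And>i s. i \<le> d \<Longrightarrow> F (a(i := s)) = 0"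
begin

lemma F_a: "F a = 0"
  using axis[of 0 "a 0"] by simp

text \<open>Increments of \<open>F\<close> along the axis through \<open>a\<close> are zero, and
  increasing differences carry this lower bound to every \<open>x\<close> that dominates
  \<open>a\<close> in the other coordinates.\<close>

lemma step_up:
  assumes "x \<in> vecs d" "i \<le> d" "\<And>j. j \<le> d \<Longrightarrow> j \<noteq> i \<Longrightarrow> a j \<le> x j" "s \<le> t"
  shows "F (x(i := s)) \<le> F (x(i := t))"
  using supermodular_increasing_differences[OF F a assms(1,2), of s t] assms axis by simp

lemma step_down:
  assumes "x \<in> vecs d" "i \<le> d" "\<And>j. j \<le> d \<Longrightarrow> j \<noteq> i \<Longrightarrow> x j \<le> a j" "s \<le> t"
  shows "F (x(i := t)) \<le> F (x(i := s))"
  using supermodular_increasing_differences[OF F assms(1) a assms(2), of s t] assms axis by simp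

lemma mono_above:
  assumes "x \<in> vecs d" "y \<in> vecs d" "a \<le> x" "x \<le> y" shows "F x \<le> F y"
proof (rule coordinatewise_mono[OF assms(1,2,4)])
  fix z m and s t :: real
  assume z: "z \<in> vecs d" "\<And>j. z j = x j \<or> z j = y j" "m \<le> d" "s \<le> t"
  have "a j \<le> z j" for j
    using z(2)[of j] le_funD[OF assms(3), of j] le_funD[OF assms(4), of j] by auto
  with z show "F (z(m := s)) \<le> F (z(m := t))" by (intro step_up) auto
qed

lemma antimono_below:
  assumes "x \<in> vecs d" "y \<in> vecs d" "y \<le> a" "x \<le> y" shows "F y \<le> F x"
proof -
  have "- F x \<le> - F y"
  proof (rule coordinatewise_mono[OF assms(1,2,4)])
    fix z m and s t :: real
    assume z: "z \<in> vecs d" "\<And>j. z j = x j \<or> z j = y j" "m \<le> d" "s \<le> t"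
    have "z j \<le> a j" for j
      using z(2)[of j] le_funD[OF assms(3), of j] le_funD[OF assms(4), of j] by auto
    with z show "- F (z(m := s)) \<le> - F (z(m := t))" by (simp add: step_down)
  qed
  then show ?thesis by simp
qed

lemma nonneg_above: "x \<in> vecs d \<Longrightarrow> a \<le> x \<Longrightarrow> 0 \<le> F x"
  using mono_above[OF a, of x] F_a by simp

lemma nonneg_below: "x \<in> vecs d \<Longrightarrow> x \<le> a \<Longrightarrow> 0 \<le> F x"
  using antimono_below[OF _ a order_refl, of x] F_a by simp

text \<open>This gives an integrable majorant for the truncations of \<open>F\<close> whatever the weight function is.\<close>

lemma mixed_contract:
  assumes x: "x \<in> vecs d" and y: "y \<in> vecs d"
    and between: "\<And>i. i \<le> d \<Longrightarrow> a i \<le> y i \<and> y i \<le> x i \<or> x i \<le> y i \<and> y i \<le> a i"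
  shows "F x - F (sup x a) - F (inf x a) \<le> F y - F (sup y a) - F (inf y a)"
proof -
  \<comment> \<open>\<open>z\<close> agrees with \<open>y\<close> in the coordinates below
    \<open>a\<close> and with \<open>x\<close> in those above. Moving first the lower and then the
    upper coordinates takes one use of supermodularity each.\<close>
  define z where "z = sup x (inf y a)"
  have v: "z \<in> vecs d" "inf y a \<in> vecs d" "sup y a \<in> vecs d"
    using x y a by (auto simp: z_def intro: vecs_inf vecs_sup)
  have "inf x (inf y a) = inf x a" "inf z (sup y a) = y" "sup z (sup y a) = sup x a"
    using x y a between
    by (auto intro!: vecs_eqI[of _ d] vecs_inf vecs_sup simp: z_def inf_min sup_max min_def max_def)
      (fastforce intro: antisym)+
  with supermodularD[OF F x v(2)] supermodularD[OF F v(1,3)]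
  show ?thesis by (simp add: z_def)
qed

lemma mixed_nonpos: "x \<in> vecs d \<Longrightarrow> F x - F (sup x a) - F (inf x a) \<le> 0"
  using supermodularD[OF F _ a, of x] F_a by (simp add: algebra_simps)

text \<open>Inside the box, increasing differences place an increment of \<open>F\<close> in
  direction \<open>i\<close> between those at the corners \<open>L\<close> and \<open>U\<close>.
  Because \<open>a\<close> lies in the box, \<open>F\<close> decreases along the lines through
  \<open>L\<close> and increases along those through \<open>U\<close>, so \<open>W i\<close> is
  increasing and its increments dominate both.\<close>

lemma truncated_modulus:
  assumes \<phi>: "\<And>i. i \<le> d \<Longrightarrow> mono (\<phi> i)" and lu: "\<And>i s. i \<le> d \<Longrightarrow> l i \<le> \<phi> i s \<and> \<phi> i s \<le> u i"
    and alu: "\<And>i. i \<le> d \<Longrightarrow> l i \<le> a i \<and> a i \<le> u i"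
  shows "\<exists>V. bounded_monos d V \<and> modulus d V (\<lambda>x. F (\<lambda>i\<in>{0..d}. \<phi> i (x i)))"
    and "supermodular d (\<lambda>x. F (\<lambda>i\<in>{0..d}. \<phi> i (x i)))"
proof -
  define h where "h x = (\<lambda>i\<in>{0..d}. \<phi> i (x i))" for x :: "nat \<Rightarrow> real"
  have h: "h x \<in> vecs d" for x by (simp add: h_def vecs_restrict)
  show "supermodular d (\<lambda>x. F (\<lambda>i\<in>{0..d}. \<phi> i (x i)))"
    unfolding supermodular_def h_def[symmetric]
  proof (intro ballI)
    fix x y
    have "inf (h x) (h y) = h (inf x y)" "sup (h x) (h y) = h (sup x y)"
      using \<phi> by (auto simp: h_def fun_eq_iff inf_min sup_max min_of_mono max_of_mono)
    with supermodularD[OF F h h, of x y] show "F (h x) + F (h y) \<le> F (h (inf x y)) + F (h (sup x y))"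
      by simp
  qed
  define L where "L = (\<lambda>i\<in>{0..d}. l i)"
  define U where "U = (\<lambda>i\<in>{0..d}. u i)"
  have LU: "L \<in> vecs d" "U \<in> vecs d" by (simp_all add: L_def U_def vecs_restrict)
  define W where "W i s = F (U(i := s)) - F (L(i := s))" for i s
  have W_up: "F (U(i := s)) \<le> F (U(i := t))" and W_down: "F (L(i := t)) \<le> F (L(i := s))"
    if "i \<le> d" "s \<le> t" for i s t
  proof -
    show "F (U(i := s)) \<le> F (U(i := t))"
      using that alu LU by (intro step_up) (auto simp: U_def)
    show "F (L(i := t)) \<le> F (L(i := s))"
      using that alu LU by (intro step_down) (auto simp: L_def)
  qed
  have W_mono: "W i s \<le> W i t" if "i \<le> d" "s \<le> t" for i s t
    using W_up[OF that] W_down[OF that] by (simp add: W_def)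
  define V where "V i s = W i (\<phi> i s)" for i s
  have "bounded_monos d V"
    unfolding bounded_monos_def
  proof (intro allI impI conjI)
    fix i assume i: "i \<le> d"
    show "mono (V i)"
      using \<phi>[OF i] W_mono[OF i] by (auto simp: V_def mono_def)
    have "\<bar>V i s\<bar> \<le> \<bar>W i (l i)\<bar> + \<bar>W i (u i)\<bar>" for s
      using W_mono[OF i, of "l i" "\<phi> i s"] W_mono[OF i, of "\<phi> i s" "u i"] lu[OF i, of s]
      by (auto simp: V_def abs_if)
    then show "\<exists>C. \<forall>s. \<bar>V i s\<bar> \<le> C" by blast
  qed
  moreover have "modulus d V (\<lambda>x. F (h x))"
    unfolding modulus_def
  proof (intro ballI)
    fix x y assume "x \<in> vecs d" "y \<in> vecs d"
    have le: "\<bar>F (w(i := s)) - F (w(i := t))\<bar> \<le> \<bar>W i s - W i t\<bar>"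
      if w: "w \<in> vecs d" "\<And>j. j \<le> d \<Longrightarrow> l j \<le> w j \<and> w j \<le> u j" and i: "i \<le> d" for w i s t
    proof -
      have *: "\<bar>F (w(i := s)) - F (w(i := t))\<bar> \<le> \<bar>W i s - W i t\<bar>" if "s \<le> t" for s t
      proof -
        have "F (L(i := t)) - F (L(i := s)) \<le> F (w(i := t)) - F (w(i := s))"
          "F (w(i := t)) - F (w(i := s)) \<le> F (U(i := t)) - F (U(i := s))"
          using w i that LU by (auto intro!: supermodular_increasing_differences[OF F] simp: L_def U_def)
        with W_up[OF i that] W_down[OF i that] show ?thesis unfolding W_def by linarith
      qed
      show ?thesis
        using *[of s t] *[of t s] by (cases "s \<le> t") (auto simp: abs_minus_commute)
    qed
    obtain z where z: "\<And>m. z m \<in> vecs d" "\<And>m j. z m j = h x j \<or> z m j = h y j"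
      "\<And>f :: _ \<Rightarrow> real. f (h y) - f (h x) = (\<Sum>m\<le>d. f ((z m)(m := h y m)) - f ((z m)(m := h x m)))"
      using coordinate_path[OF h[of x] h[of y]] by blast
    have zlu: "l j \<le> z m j \<and> z m j \<le> u j" if "j \<le> d" for m j
      using z(2)[of m j] lu[OF that] that by (auto simp: h_def)
    have "\<bar>F (h x) - F (h y)\<bar> = \<bar>\<Sum>m\<le>d. F ((z m)(m := h y m)) - F ((z m)(m := h x m))\<bar>"
      using z(3)[of F] by (simp add: abs_minus_commute)
    also have "\<dots> \<le> (\<Sum>m\<le>d. \<bar>F ((z m)(m := h y m)) - F ((z m)(m := h x m))\<bar>)"
      by (rule sum_abs)
    also have "\<dots> \<le> (\<Sum>m\<le>d. \<bar>W m (h y m) - W m (h x m)\<bar>)"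
      using z(1) zlu by (intro sum_mono le) auto
    also have "\<dots> = (\<Sum>m\<le>d. \<bar>V m (x m) - V m (y m)\<bar>)"
      by (intro sum.cong) (auto simp: V_def h_def abs_minus_commute)
    finally show "\<bar>F (h x) - F (h y)\<bar> \<le> (\<Sum>m\<le>d. \<bar>V m (x m) - V m (y m)\<bar>)" .
  qed
  ultimately show "\<exists>V. bounded_monos d V \<and> modulus d V (\<lambda>x. F (\<lambda>i\<in>{0..d}. \<phi> i (x i)))"
    unfolding h_def by blast
qed

end

text \<open>Two functions with different moduli need a common one for association. As all families
  are increasing, their increments add up without cancellation.\<close>

lemma modulus_add_left:
  assumes "bounded_monos d V" "bounded_monos d V'" "modulus d V f"
  shows "modulus d (\<lambda>i s. V i s + V' i s) f"
  unfolding modulus_def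
proof (intro ballI)
  fix x y assume xy: "x \<in> vecs d" "y \<in> vecs d"
  have "\<bar>f x - f y\<bar> \<le> (\<Sum>i\<le>d. \<bar>V i (x i) - V i (y i)\<bar>)"
    using assms(3) xy by (auto simp: modulus_def)
  also have "\<dots> \<le> (\<Sum>i\<le>d. \<bar>V i (x i) + V' i (x i) - (V i (y i) + V' i (y i))\<bar>)"
  proof (rule sum_mono)
    fix i assume "i \<in> {..d}"
    then have m: "mono (V i)" "mono (V' i)" using assms by (auto simp: bounded_monos_def)
    show "\<bar>V i (x i) - V i (y i)\<bar> \<le> \<bar>V i (x i) + V' i (x i) - (V i (y i) + V' i (y i))\<bar>"
    proof (cases "x i \<le> y i")
      case True
      with monoD[OF m(1) True] monoD[OF m(2) True] show ?thesis by linarith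
    next
      case False
      then have "y i \<le> x i" by simp
      with monoD[OF m(1) this] monoD[OF m(2) this] show ?thesis by linarith
    qed
  qed
  finally show "\<bar>f x - f y\<bar> \<le> (\<Sum>i\<le>d. \<bar>V i (x i) + V' i (x i) - (V i (y i) + V' i (y i))\<bar>)" .
qed

lemma bounded_monos_add:
  assumes "bounded_monos d V" "bounded_monos d V'"
  shows "bounded_monos d (\<lambda>i s. V i s + V' i s)"
  unfolding bounded_monos_def
proof (intro allI impI conjI)
  fix i assume i: "i \<le> d"
  with assms show "mono (\<lambda>s. V i s + V' i s)"
    by (auto simp: bounded_monos_def mono_def intro: add_mono)
  from assms(1) i obtain C where "\<And>s. \<bar>V i s\<bar> \<le> C"
    unfolding bounded_monos_def by blast
  moreover from assms(2) i obtain C' where "\<And>s. \<bar>V' i s\<bar> \<le> C'"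
    unfolding bounded_monos_def by blast
  ultimately have "\<bar>V i s + V' i s\<bar> \<le> C + C'" for s
    by (intro order_trans[OF abs_triangle_ineq] add_mono)
  then show "\<exists>C. \<forall>s. \<bar>V i s + V' i s\<bar> \<le> C" by blast
qed

lemma modulus_uminus: "modulus d V f \<Longrightarrow> modulus d V (\<lambda>x. - f x)"
  by (simp add: modulus_def abs_minus_commute)

lemma up_indicator:
  fixes a :: "nat \<Rightarrow> real" and d :: nat
  defines "ind \<equiv> \<lambda>x. of_bool (\<forall>i\<le>d. a i \<le> x i)"
  shows "\<exists>V. bounded_monos d V \<and> modulus d V ind" and "supermodular d ind" and "mono_on (vecs d) ind"
proof -
  show "mono_on (vecs d) ind"
    by (rule mono_onI) (auto simp: ind_def le_fun_def of_bool_def intro: order_trans)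
  show "supermodular d ind"
    by (auto simp: supermodular_def ind_def of_bool_def inf_min sup_max le_max_iff_disj)
  have "bounded_monos d (\<lambda>i s. of_bool (a i \<le> s))"
    by (auto simp: bounded_monos_def mono_def intro!: exI[of _ 1])
  moreover have "modulus d (\<lambda>i s. of_bool (a i \<le> s)) ind"
    unfolding modulus_def
  proof (intro ballI)
    fix x y :: "nat \<Rightarrow> real"
    show "\<bar>ind x - ind y\<bar> \<le> (\<Sum>i\<le>d. \<bar>of_bool (a i \<le> x i) - of_bool (a i \<le> y i)\<bar>)" (is "_ \<le> sum ?g _")
    proof (cases "ind x = ind y")
      case False
      then obtain i where "i \<le> d" "(a i \<le> x i) \<noteq> (a i \<le> y i)"
        unfolding ind_def of_bool_eq_iff by blast
      then have "1 \<le> ?g i" by auto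
      also have "?g i \<le> sum ?g {..d}" using \<open>i \<le> d\<close> by (intro member_le_sum) auto
      finally show ?thesis by (auto simp: ind_def of_bool_def intro: order_trans)
    qed (auto intro: sum_nonneg)
  qed
  ultimately show "\<exists>V. bounded_monos d V \<and> modulus d V ind" by blast
qed

lemma down_indicator:
  fixes a :: "nat \<Rightarrow> real" and d :: nat
  defines "ind \<equiv> \<lambda>x. of_bool (\<forall>i\<le>d. x i \<le> a i)"
  shows "\<exists>V. bounded_monos d V \<and> modulus d V ind" and "supermodular d ind" and "antimono_on (vecs d) ind"
proof -
  show "antimono_on (vecs d) ind"
    by (auto simp: monotone_on_def ind_def le_fun_def of_bool_def intro: order_trans)
  show "supermodular d ind"
    by (auto simp: supermodular_def ind_def of_bool_def inf_min sup_max min_le_iff_disj)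
  have "bounded_monos d (\<lambda>i s. - of_bool (s \<le> a i))"
    by (auto simp: bounded_monos_def mono_def intro!: exI[of _ 1])
  moreover have "modulus d (\<lambda>i s. - of_bool (s \<le> a i)) ind"
    unfolding modulus_def
  proof (intro ballI)
    fix x y :: "nat \<Rightarrow> real"
    show "\<bar>ind x - ind y\<bar> \<le> (\<Sum>i\<le>d. \<bar>- of_bool (x i \<le> a i) - - of_bool (y i \<le> a i)\<bar>)" (is "_ \<le> sum ?g _")
    proof (cases "ind x = ind y")
      case False
      then obtain i where "i \<le> d" "(x i \<le> a i) \<noteq> (y i \<le> a i)"
        unfolding ind_def of_bool_eq_iff by blast
      then have "1 \<le> ?g i" by auto
      also have "?g i \<le> sum ?g {..d}" using \<open>i \<le> d\<close> by (intro member_le_sum) auto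
      finally show ?thesis by (auto simp: ind_def of_bool_def intro: order_trans)
    qed (auto intro: sum_nonneg)
  qed
  ultimately show "\<exists>V. bounded_monos d V \<and> modulus d V ind" by blast
qed

section \<open>Removing the truncation\<close>

text \<open>Fatou's lemma, in the form that passes from truncations to their limit.\<close>

lemma integrable_limit_of_bounded_integrals:
  fixes \<psi> :: "'a \<Rightarrow> real"
  assumes meas: "\<And>n. \<psi>' n \<in> borel_measurable S" and nonneg: "\<And>n x. x \<in> space S \<Longrightarrow> 0 \<le> \<psi>' n x"
    and int: "\<And>n. integrable S (\<psi>' n)" and K: "\<And>n. (LINT x|S. \<psi>' n x) \<le> K"
    and lim: "\<And>x. x \<in> space S \<Longrightarrow> (\<lambda>n. \<psi>' n x) \<longlonglongrightarrow> \<psi> x"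
  shows "integrable S \<psi>"
proof -
  have m: "\<psi> \<in> borel_measurable S" using lim meas by (rule borel_measurable_LIMSEQ_real)
  have pos: "0 \<le> \<psi> x" if "x \<in> space S" for x
    using lim[OF that] nonneg[OF that] by (intro LIMSEQ_le_const) auto
  have "(\<integral>\<^sup>+x. ennreal (\<psi> x) \<partial>S) = (\<integral>\<^sup>+x. liminf (\<lambda>n. ennreal (\<psi>' n x)) \<partial>S)"
  proof (rule nn_integral_cong)
    fix x assume "x \<in> space S"
    then have "(\<lambda>n. ennreal (\<psi>' n x)) \<longlonglongrightarrow> ennreal (\<psi> x)" by (intro tendsto_ennrealI lim)
    then show "ennreal (\<psi> x) = liminf (\<lambda>n. ennreal (\<psi>' n x))"
      by (simp add: lim_imp_Liminf)
  qed
  also have "\<dots> \<le> liminf (\<lambda>n. \<integral>\<^sup>+x. ennreal (\<psi>' n x) \<partial>S)"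
    using meas by (intro nn_integral_liminf) simp
  also have "\<dots> \<le> ennreal K"
  proof (rule Liminf_le)
    show "\<forall>\<^sub>F n in sequentially. (\<integral>\<^sup>+x. ennreal (\<psi>' n x) \<partial>S) \<le> ennreal K"
    proof (rule always_eventually, rule allI)
      fix n
      have "(\<integral>\<^sup>+x. ennreal (\<psi>' n x) \<partial>S) = ennreal (LINT x|S. \<psi>' n x)"
        using int nonneg by (intro nn_integral_eq_integral) auto
      also have "\<dots> \<le> ennreal K" using K by (intro ennreal_leI)
      finally show "(\<integral>\<^sup>+x. ennreal (\<psi>' n x) \<partial>S) \<le> ennreal K" .
    qed
  qed simp
  also have "\<dots> < \<infinity>" by simp
  finally show ?thesis
    using m pos by (intro integrableI_nonneg) auto
qed

text \<open>The exceptional set \<open>Z\<close> is an up-set. Tails starting at rational points of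
  \<open>Z\<close> form a countable union of null sets; at most the least point of \<open>Z\<close>
  escapes it, and that point lies in its own null tail.\<close>

lemma AE_measure_atLeast_pos:
  fixes M :: "real measure"
  assumes "prob_space M" and M: "sets M = sets borel"
  shows "AE s in M. 0 < measure M {s..}"
proof -
  interpret prob_space M by fact
  have sets [simp]: "{s..} \<in> sets M" for s by (simp add: M)
  define Z where "Z = {s. measure M {s..} = 0}"
  have null: "{s..} \<in> null_sets M" if "s \<in> Z" for s
    using that by (auto simp: Z_def null_sets_def emeasure_eq_measure)
  have up: "t \<in> Z" if "s \<in> Z" "s \<le> t" for s t
  proof -
    have "measure M {t..} \<le> measure M {s..}" using that by (intro finite_measure_mono) auto
    then show ?thesis using that(1) measure_nonneg[of M "{t..}"] unfolding Z_def mem_Collect_eq by linarith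
  qed
  have 1: "(\<Union>q\<in>Z \<inter> \<rat>. {q..}) \<in> null_sets M"
    using null by (intro null_sets_UN') (auto simp: countable_rat)
  define B where "B = Z - (\<Union>q\<in>Z \<inter> \<rat>. {q..})"
  have "\<exists>N\<in>null_sets M. B \<subseteq> N"
  proof (cases "B = {}")
    case False
    then obtain y where y: "y \<in> B" by blast
    have "B \<subseteq> {y..}"
    proof
      fix z assume z: "z \<in> B"
      show "z \<in> {y..}"
      proof (rule ccontr)
        assume "z \<notin> {y..}"
        then obtain r where r: "r \<in> \<rat>" "z < r" "r < y" using Rats_dense_in_real[of z y] by auto
        with z have "r \<in> Z" using up[of z r] by (auto simp: B_def)
        moreover have "y \<in> {r..}" using r by simp
        ultimately show False using y r(1) unfolding B_def by blast
      qed
    qed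
    then show ?thesis using null[of y] y by (auto simp: B_def)
  qed auto
  then obtain N where "N \<in> null_sets M" "B \<subseteq> N" by blast
  then have "(\<Union>q\<in>Z \<inter> \<rat>. {q..}) \<union> N \<in> null_sets M" "Z \<subseteq> (\<Union>q\<in>Z \<inter> \<rat>. {q..}) \<union> N"
    using 1 by (auto simp: B_def)
  then have "AE s in M. s \<notin> Z"
    by (intro AE_I') auto
  then show ?thesis
    by eventually_elim (simp add: Z_def zero_less_measure_iff)
qed

lemma AE_measure_atMost_pos:
  fixes M :: "real measure"
  assumes "prob_space M" and M: "sets M = sets borel"
  shows "AE s in M. 0 < measure M {..s}"
proof -
  interpret prob_space M by fact
  have um: "uminus \<in> borel_measurable M"
    by (rule borel_measurable_uminus[OF measurable_ident_sets[OF M]])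
  interpret D: prob_space "distr M borel uminus" by (rule prob_space_distr[OF um])
  have "AE s in distr M borel uminus. 0 < measure (distr M borel uminus) {s..}"
    by (rule AE_measure_atLeast_pos[OF D.prob_space_axioms]) simp
  then have "AE s in M. 0 < measure (distr M borel uminus) {- s..}"
    by (rule AE_distrD[OF um])
  moreover have "measure (distr M borel uminus) {- s..} = measure M {..s}" for s
  proof -
    have "uminus -` {- s..} \<inter> space M = {..s}"
      using sets_eq_imp_space_eq[OF M] by auto
    then show ?thesis using um by (subst measure_distr) simp_all
  qed
  ultimately show ?thesis by simp
qed

text \<open>Collects what the removal of the truncation draws on: \<open>indep_le\<close> gives
  orthants positive mass under \<open>Q\<close>, \<open>assoc\<close> bounds the truncated
  integrals, and \<open>marginal\<close> makes functions of one variable harmless to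
  subtract.\<close>

locale sm_comparison = P: prob_space P + Q: prob_space Q
  for P Q :: "(nat \<Rightarrow> real) measure" and d :: nat +
  assumes sets_P: "sets P = sets (vec_space d)" and sets_Q: "sets Q = sets (vec_space d)"
    and marginal: "i \<le> d \<Longrightarrow> distr P borel (\<lambda>x. x i) = distr Q borel (\<lambda>x. x i)"
    and le: "bounded_monos d V \<Longrightarrow> modulus d V f \<Longrightarrow> supermodular d f \<Longrightarrow> (LINT x|P. f x) \<le> (LINT x|Q. f x)"
    and indep_le: "bounded_monos d V \<Longrightarrow> modulus d V f \<Longrightarrow> supermodular d f \<Longrightarrow>
      (LINT x|(\<Pi>\<^sub>M i\<in>{0..d}. distr Q borel (\<lambda>x. x i)). f x) \<le> (LINT x|Q. f x)"
    and assoc: "bounded_monos d V \<Longrightarrow> modulus d V f \<Longrightarrow> modulus d V f' \<Longrightarrow>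
      mono_on (vecs d) f \<Longrightarrow> mono_on (vecs d) f' \<Longrightarrow>
      (LINT x|Q. f x) * (LINT x|Q. f' x) \<le> (LINT x|Q. f x * f' x)"
begin

abbreviation \<mu> :: "nat \<Rightarrow> real measure" where "\<mu> i \<equiv> distr Q borel (\<lambda>x. x i)"

abbreviation R :: "(nat \<Rightarrow> real) measure" where "R \<equiv> \<Pi>\<^sub>M i\<in>{0..d}. \<mu> i"

lemma space_P: "space P = vecs d" and space_Q: "space Q = vecs d"
  using sets_eq_imp_space_eq[OF sets_P] sets_eq_imp_space_eq[OF sets_Q] by simp_all

lemma measurable_coordinate: "(\<lambda>x. x i) \<in> borel_measurable (vec_space d)"
proof (cases "i \<le> d")
  case False
  have "(\<lambda>x. undefined :: real) \<in> borel_measurable (vec_space d)" by simp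
  also have "(\<lambda>x. undefined :: real) \<in> borel_measurable (vec_space d) \<longleftrightarrow> (\<lambda>x. x i) \<in> borel_measurable (vec_space d)"
    using False by (intro measurable_cong) (auto simp: space_PiM PiE_iff extensional_def)
  finally show ?thesis .
qed simp

lemma measurable_Q: "f \<in> borel_measurable (vec_space d) \<Longrightarrow> f \<in> borel_measurable Q"
  and measurable_P: "f \<in> borel_measurable (vec_space d) \<Longrightarrow> f \<in> borel_measurable P"
  using measurable_cong_sets[OF sets_Q refl] measurable_cong_sets[OF sets_P refl] by auto

lemma prob_space_\<mu>: "prob_space (\<mu> i)"
  by (intro Q.prob_space_distr measurable_Q measurable_coordinate)

sublocale \<mu>: product_prob_space \<mu> "{0..d}"
proof -
  interpret prob_space "\<mu> i" for i by (rule prob_space_\<mu>)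
  show "product_prob_space \<mu>" by standard
qed

sublocale R: finite_product_prob_space \<mu> "{0..d}"
  by standard simp

lemma modulus_integrable:
  assumes "bounded_monos d V" "modulus d V f" "f \<in> borel_measurable (vec_space d)"
  shows "integrable P f" "integrable Q f"
proof -
  obtain C where C: "\<And>x. x \<in> vecs d \<Longrightarrow> \<bar>f x\<bar> \<le> C" using modulus_bounded[OF assms(1,2)] by blast
  show "integrable P f"
    using C measurable_P[OF assms(3)] by (intro P.integrable_const_bound[where B = C]) (auto simp: space_P)
  show "integrable Q f"
    using C measurable_Q[OF assms(3)] by (intro Q.integrable_const_bound[where B = C]) (auto simp: space_Q)
qed

lemma orthant_pos:
  assumes "\<And>i. i \<le> d \<Longrightarrow> S i \<in> sets borel" "\<And>i. i \<le> d \<Longrightarrow> 0 < measure (\<mu> i) (S i)"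
  shows "0 < (LINT x|R. of_bool (\<forall>i\<le>d. x i \<in> S i) :: real)"
proof -
  have "(LINT x|R. of_bool (\<forall>i\<le>d. x i \<in> S i) :: real) = (LINT x|R. indicator (Pi\<^sub>E {0..d} S) x)"
    by (intro Bochner_Integration.integral_cong) (auto simp: indicator_def space_PiM PiE_iff)
  also have "\<dots> = measure R (Pi\<^sub>E {0..d} S \<inter> space R)" by simp
  also have "Pi\<^sub>E {0..d} S \<inter> space R = Pi\<^sub>E {0..d} S" by (auto simp: space_PiM PiE_iff)
  also have "measure R (Pi\<^sub>E {0..d} S) = (\<Prod>i\<in>{0..d}. measure (\<mu> i) (S i))"
    using assms(1) by (intro R.prob_times) auto
  also have "\<dots> > 0" using assms(2) by (intro prod_pos) auto
  finally show ?thesis .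
qed

text \<open>By association, the truncated functions \<open>\<psi>\<close> have bounded integrals: their integral
  against the indicator of an orthant of positive probability is controlled by \<open>F\<close> itself.\<close>

lemma bounded_by_association:
  assumes V: "bounded_monos d V" "modulus d V \<psi>" "\<psi> \<in> borel_measurable (vec_space d)"
    and V': "bounded_monos d V'" "modulus d V' ind" "ind \<in> borel_measurable (vec_space d)"
    and mono: "mono_on (vecs d) \<psi> \<and> mono_on (vecs d) ind \<or> antimono_on (vecs d) \<psi> \<and> antimono_on (vecs d) ind"
    and ind: "\<And>x. 0 \<le> ind x \<and> ind x \<le> (1::real)"
    and F: "integrable Q F" and le_F: "\<And>x. x \<in> vecs d \<Longrightarrow> \<psi> x * ind x \<le> \<bar>F x\<bar>"
    and pos: "0 < (LINT x|Q. ind x)"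
  shows "(LINT x|Q. \<psi> x) \<le> (LINT x|Q. \<bar>F x\<bar>) / (LINT x|Q. ind x)"
proof -
  let ?W = "\<lambda>i s. V i s + V' i s"
  have W: "bounded_monos d ?W" "modulus d ?W \<psi>" "modulus d ?W ind"
    using bounded_monos_add[OF V(1) V'(1)] modulus_add_left[OF V(1) V'(1) V(2)]
      modulus_add_left[OF V'(1) V(1) V'(2)] by (simp_all add: add.commute)
  obtain C where C: "\<And>x. x \<in> vecs d \<Longrightarrow> \<bar>\<psi> x\<bar> \<le> C" using modulus_bounded[OF V(1,2)] by blast
  have "(LINT x|Q. \<psi> x) * (LINT x|Q. ind x) \<le> (LINT x|Q. \<psi> x * ind x)"
  proof (rule disjE[OF mono])
    assume m: "mono_on (vecs d) \<psi> \<and> mono_on (vecs d) ind"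
    show ?thesis by (rule assoc[OF W]) (use m in auto)
  next
    assume m: "antimono_on (vecs d) \<psi> \<and> antimono_on (vecs d) ind"
    have "(LINT x|Q. - \<psi> x) * (LINT x|Q. - ind x) \<le> (LINT x|Q. - \<psi> x * - ind x)"
      by (rule assoc[OF W(1) modulus_uminus[OF W(2)] modulus_uminus[OF W(3)]])
        (use m in \<open>auto simp: monotone_on_def\<close>)
    then show ?thesis by simp
  qed
  also have "\<dots> \<le> (LINT x|Q. \<bar>F x\<bar>)"
  proof (rule integral_mono)
    have "\<bar>\<psi> x * ind x\<bar> \<le> C * 1" if "x \<in> vecs d" for x
      unfolding abs_mult using C[OF that] ind[of x] by (intro mult_mono) auto
    then show "integrable Q (\<lambda>x. \<psi> x * ind x)"
      using measurable_Q[OF V(3)] measurable_Q[OF V'(3)]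
      by (intro Q.integrable_const_bound[where B = "C * 1"]) (auto simp: space_Q)
  qed (use F le_F in \<open>auto simp: space_Q\<close>)
  finally show ?thesis using pos by (simp add: field_simps)
qed

lemma anchored_integral_le:
  assumes anchor: "anchored d F a"
    and F_meas: "F \<in> borel_measurable (vec_space d)" and F_int: "integrable P F" "integrable Q F"
    and up: "\<And>i. i \<le> d \<Longrightarrow> 0 < measure (\<mu> i) {a i..}" and down: "\<And>i. i \<le> d \<Longrightarrow> 0 < measure (\<mu> i) {..a i}"
  shows "(LINT x|P. F x) \<le> (LINT x|Q. F x)"
proof -
  interpret anchored d F a by (rule anchor)
  \<comment> \<open>Adding the absolute values of the \<open>a i\<close> keeps \<open>a\<close>
    inside every box, so truncation moves a coordinate towards \<open>a i\<close> and never past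
    it.\<close>
  define b where "b n = real n + (\<Sum>i\<le>d. \<bar>a i\<bar>)" for n :: nat
  have b: "\<bar>a i\<bar> \<le> b n" if "i \<le> d" for i n
  proof -
    have "\<bar>a i\<bar> \<le> (\<Sum>i\<le>d. \<bar>a i\<bar>)" using that by (intro member_le_sum) auto
    then show ?thesis by (simp add: b_def)
  qed
  define \<phi> where "\<phi> n s = max (- b n) (min (b n) s)" for n s
  have \<phi>_mono: "mono (\<phi> n)" for n by (auto simp: \<phi>_def mono_def)
  have b0: "0 \<le> b n" for n by (simp add: b_def sum_nonneg)
  have \<phi>_bd: "- b n \<le> \<phi> n s" "\<phi> n s \<le> b n" for n s using b0[of n] by (auto simp: \<phi>_def)
  have \<phi>_lim: "\<forall>\<^sub>F n in sequentially. \<phi> n s = s" for s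
  proof -
    have "\<forall>\<^sub>F n in sequentially. \<bar>s\<bar> \<le> real n"
      using filterlim_real_sequentially by (simp add: filterlim_at_top)
    then show ?thesis
    proof eventually_elim
      case (elim n)
      moreover have "real n \<le> b n" by (simp add: b_def sum_nonneg)
      ultimately show ?case by (auto simp: \<phi>_def)
    qed
  qed
  define T where "T h x = (\<lambda>i\<in>{0..d}. h i (x i))" for h :: "nat \<Rightarrow> real \<Rightarrow> real" and x :: "nat \<Rightarrow> real"
  have T: "T h x \<in> vecs d" for h x by (simp add: T_def vecs_restrict)
  have T_meas: "(\<lambda>x. F (T h x)) \<in> borel_measurable (vec_space d)" if "\<And>i. i \<le> d \<Longrightarrow> mono (h i)" for h
  proof (rule measurable_compose[OF _ F_meas])
    show "T h \<in> measurable (vec_space d) (vec_space d)"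
      unfolding T_def[abs_def] using that
      by (intro measurable_restrict measurable_compose[OF measurable_coordinate borel_measurable_mono]) auto
  qed
  \<comment> \<open>\<open>c\<close> is the bare truncation, \<open>cu\<close> and \<open>cd\<close>
    are its supremum and infimum with \<open>a\<close>, and \<open>u\<close> and \<open>l\<close>
    are the untruncated limits of the last two.\<close>
  define c where "c n = (\<lambda>i::nat. \<phi> n)" for n
  define cu where "cu n = (\<lambda>i s. max (\<phi> n s) (a i))" for n
  define cd where "cd n = (\<lambda>i s. min (\<phi> n s) (a i))" for n
  define u where "u = (\<lambda>i s. max s (a i))"
  define l where "l = (\<lambda>i s. min s (a i))"
  have hmono: "mono (c n i)" "mono (cu n i)" "mono (cd n i)" "mono (u i)" "mono (l i)" for n i
    unfolding c_def cu_def cd_def u_def l_def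
    by (auto intro!: monoI max.mono min.mono \<phi>_mono monoD[OF \<phi>_mono])
  have meas: "(\<lambda>x. F (T (c n) x)) \<in> borel_measurable (vec_space d)"
    "(\<lambda>x. F (T (cu n) x)) \<in> borel_measurable (vec_space d)"
    "(\<lambda>x. F (T (cd n) x)) \<in> borel_measurable (vec_space d)" for n
    by (rule T_meas, rule hmono)+
  have bds: "- b n \<le> c n i s \<and> c n i s \<le> b n" "- b n \<le> cu n i s \<and> cu n i s \<le> b n"
    "- b n \<le> cd n i s \<and> cd n i s \<le> b n" if "i \<le> d" for n i s
    using \<phi>_bd[of n s] b[OF that, of n] by (auto simp: c_def cu_def cd_def)
  have ab: "- b n \<le> a i \<and> a i \<le> b n" if "i \<le> d" for n i using b[OF that, of n] by auto
  have sm: "\<exists>V. bounded_monos d V \<and> modulus d V (\<lambda>x. F (T h x))" "supermodular d (\<lambda>x. F (T h x))"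
    if "\<And>i. i \<le> d \<Longrightarrow> mono (h i)" "\<And>i s. i \<le> d \<Longrightarrow> - b n \<le> h i s \<and> h i s \<le> b n" for h n
    using truncated_modulus[of h "\<lambda>_. - b n" "\<lambda>_. b n"] that ab unfolding T_def by blast+
  have smu: "\<exists>V. bounded_monos d V \<and> modulus d V (\<lambda>x. F (T (cu n) x))"
    and smd: "\<exists>V. bounded_monos d V \<and> modulus d V (\<lambda>x. F (T (cd n) x))" for n
    using sm(1)[of "cu n" n] sm(1)[of "cd n" n] hmono bds by blast+
  have T_sup: "T u x = sup x a" and T_inf: "T l x = inf x a" if "x \<in> vecs d" for x
    using that a
    by (auto intro!: vecs_eqI[of _ d] vecs_sup vecs_inf vecs_restrict simp: T_def u_def l_def sup_max inf_min)
  have lims: "\<forall>\<^sub>F n in sequentially. T (c n) x = x" "\<forall>\<^sub>F n in sequentially. T (cu n) x = T u x"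
    "\<forall>\<^sub>F n in sequentially. T (cd n) x = T l x" if x: "x \<in> vecs d" for x
  proof -
    have ev: "\<forall>\<^sub>F n in sequentially. \<forall>i\<in>{..d}. \<phi> n (x i) = x i"
      using \<phi>_lim by (intro eventually_ball_finite) auto
    show "\<forall>\<^sub>F n in sequentially. T (c n) x = x"
      using ev by eventually_elim (rule vecs_eqI[OF T x], simp add: T_def c_def)
    show "\<forall>\<^sub>F n in sequentially. T (cu n) x = T u x" "\<forall>\<^sub>F n in sequentially. T (cd n) x = T l x"
      using ev by (eventually_elim, auto simp: T_def cu_def u_def cd_def l_def fun_eq_iff)+
  qed
  have tendsto: "(\<lambda>n. F (T (c n) x)) \<longlonglongrightarrow> F x" "(\<lambda>n. F (T (cu n) x)) \<longlonglongrightarrow> F (T u x)"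
    "(\<lambda>n. F (T (cd n) x)) \<longlonglongrightarrow> F (T l x)" if x: "x \<in> vecs d" for x
    by (rule tendsto_eventually, rule eventually_mono[OF lims(1)[OF x]], simp)
      (rule tendsto_eventually, rule eventually_mono[OF lims(2)[OF x]], simp,
       rule tendsto_eventually, rule eventually_mono[OF lims(3)[OF x]], simp)
  have ac: "a i \<le> \<phi> n (x i) \<and> \<phi> n (x i) \<le> x i \<or> x i \<le> \<phi> n (x i) \<and> \<phi> n (x i) \<le> a i" if "i \<le> d" for n x i
    using ab[OF that, of n] by (auto simp: \<phi>_def max_def min_def)
  have au: "a \<le> T (cu n) x" "a \<le> T u x" and la: "T (cd n) x \<le> a" "T l x \<le> a" for n x
    by (rule vecs_leI[OF a T], simp add: T_def cu_def u_def)+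
      (rule vecs_leI[OF T a], simp add: T_def cd_def l_def)+
  have cu_le: "T (cu n) x \<le> T u x" and cd_ge: "T l x \<le> T (cd n) x" for n x
  proof -
    show "T (cu n) x \<le> T u x"
    proof (rule vecs_leI[OF T T])
      show "T (cu n) x i \<le> T u x i" if "i \<le> d" for i
        using ac[OF that, of n x] that by (auto simp: T_def cu_def u_def)
    qed
    show "T l x \<le> T (cd n) x"
    proof (rule vecs_leI[OF T T])
      show "T l x i \<le> T (cd n) x i" if "i \<le> d" for i
        using ac[OF that, of n x] that by (auto simp: T_def cd_def l_def)
    qed
  qed
  have nonneg: "0 \<le> F (T (cu n) x)" "0 \<le> F (T (cd n) x)" for n x
    using nonneg_above[OF T au(1)] nonneg_below[OF T la(1)] by auto
  \<comment> \<open>A bound uniform in \<open>n\<close>: on the orthant above \<open>a\<close>,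
    truncation lowers \<open>F\<close>, and association controls the full integral by the one over
    this orthant.\<close>
  have bu: "(LINT x|Q. F (T (cu n) x)) \<le> (LINT x|Q. \<bar>F x\<bar>) / (LINT x|Q. of_bool (\<forall>i\<le>d. a i \<le> x i))" for n
  proof -
    obtain V V' where V: "bounded_monos d V" "modulus d V (\<lambda>x. F (T (cu n) x))" and
      V': "bounded_monos d V'" "modulus d V' (\<lambda>x. of_bool (\<forall>i\<le>d. a i \<le> x i))"
      using smu[of n] up_indicator(1)[of d a] by blast
    show ?thesis
    proof (rule bounded_by_association[OF V meas(2) V'])
      show "(\<lambda>x. of_bool (\<forall>i\<le>d. a i \<le> x i) :: real) \<in> borel_measurable (vec_space d)"
      proof -
        have "Measurable.pred (vec_space d) (\<lambda>x. \<forall>i\<in>{..d}. a i \<le> x i)"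
          using measurable_coordinate by (intro pred_intros_finite) auto
        from measurable_compose[OF this, of of_bool borel] show ?thesis by (simp add: Ball_def)
      qed
      have "mono_on (vecs d) (\<lambda>x. F (T (cu n) x))"
        using hmono(2)[of n] by (intro mono_onI mono_above[OF T T au(1)] vecs_leI[OF T T])
          (auto simp: T_def le_fun_def mono_def)
      with up_indicator(3)[of d a]
      show "mono_on (vecs d) (\<lambda>x. F (T (cu n) x)) \<and> mono_on (vecs d) (\<lambda>x. of_bool (\<forall>i\<le>d. a i \<le> x i) :: real) \<or>
        antimono_on (vecs d) (\<lambda>x. F (T (cu n) x)) \<and> antimono_on (vecs d) (\<lambda>x. of_bool (\<forall>i\<le>d. a i \<le> x i) :: real)" by blast
      show "F (T (cu n) x) * of_bool (\<forall>i\<le>d. a i \<le> x i) \<le> \<bar>F x\<bar>" if x: "x \<in> vecs d" for x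
      proof (cases "\<forall>i\<le>d. a i \<le> x i")
        case True
        then have "T (cu n) x \<le> x"
          using ac[of _ n x] by (intro vecs_leI[OF T x]) (force simp: T_def cu_def)
        from mono_above[OF T x au(1) this] show ?thesis by auto
      next
        case False
        then show ?thesis by (simp only: of_bool_def if_False mult_zero_right abs_ge_zero)
      qed
      \<comment> \<open>Under the product of the marginals the orthant has positive mass by the
        hypothesis on \<open>a\<close>; its indicator is supermodular, so its mass under
        \<open>Q\<close> is at least as large.\<close>
      have "0 < (LINT x|R. of_bool (\<forall>i\<le>d. x i \<in> {a i..}) :: real)"
        using up by (intro orthant_pos) auto
      also have "\<dots> = (LINT x|R. of_bool (\<forall>i\<le>d. a i \<le> x i) :: real)" by simp
      also have "\<dots> \<le> (LINT x|Q. of_bool (\<forall>i\<le>d. a i \<le> x i))"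
        by (rule indep_le[OF V' up_indicator(2)])
      finally show "0 < (LINT x|Q. of_bool (\<forall>i\<le>d. a i \<le> x i) :: real)" .
    qed (use F_int in auto)
  qed
  have bd: "(LINT x|Q. F (T (cd n) x)) \<le> (LINT x|Q. \<bar>F x\<bar>) / (LINT x|Q. of_bool (\<forall>i\<le>d. x i \<le> a i))" for n
  proof -
    obtain V V' where V: "bounded_monos d V" "modulus d V (\<lambda>x. F (T (cd n) x))" and
      V': "bounded_monos d V'" "modulus d V' (\<lambda>x. of_bool (\<forall>i\<le>d. x i \<le> a i))"
      using smd[of n] down_indicator(1)[of d a] by blast
    show ?thesis
    proof (rule bounded_by_association[OF V meas(3) V'])
      show "(\<lambda>x. of_bool (\<forall>i\<le>d. x i \<le> a i) :: real) \<in> borel_measurable (vec_space d)"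
      proof -
        have "Measurable.pred (vec_space d) (\<lambda>x. \<forall>i\<in>{..d}. x i \<le> a i)"
          using measurable_coordinate by (intro pred_intros_finite) auto
        from measurable_compose[OF this, of of_bool borel] show ?thesis by (simp add: Ball_def)
      qed
      have "antimono_on (vecs d) (\<lambda>x. F (T (cd n) x))"
        using hmono(3)[of n] by (intro monotone_onI antimono_below[OF T T la(1)] vecs_leI[OF T T])
          (auto simp: T_def le_fun_def mono_def)
      with down_indicator(3)[of d a]
      show "mono_on (vecs d) (\<lambda>x. F (T (cd n) x)) \<and> mono_on (vecs d) (\<lambda>x. of_bool (\<forall>i\<le>d. x i \<le> a i) :: real) \<or>
        antimono_on (vecs d) (\<lambda>x. F (T (cd n) x)) \<and> antimono_on (vecs d) (\<lambda>x. of_bool (\<forall>i\<le>d. x i \<le> a i) :: real)" by blast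
      show "F (T (cd n) x) * of_bool (\<forall>i\<le>d. x i \<le> a i) \<le> \<bar>F x\<bar>" if x: "x \<in> vecs d" for x
      proof (cases "\<forall>i\<le>d. x i \<le> a i")
        case True
        then have "x \<le> T (cd n) x"
          using ac[of _ n x] by (intro vecs_leI[OF x T]) (force simp: T_def cd_def)
        from antimono_below[OF x T la(1) this] show ?thesis by auto
      next
        case False
        then show ?thesis by (simp only: of_bool_def if_False mult_zero_right abs_ge_zero)
      qed
      have "0 < (LINT x|R. of_bool (\<forall>i\<le>d. x i \<in> {..a i}) :: real)"
        using down by (intro orthant_pos) auto
      also have "\<dots> = (LINT x|R. of_bool (\<forall>i\<le>d. x i \<le> a i) :: real)" by simp
      also have "\<dots> \<le> (LINT x|Q. of_bool (\<forall>i\<le>d. x i \<le> a i))"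
        by (rule indep_le[OF V' down_indicator(2)])
      finally show "0 < (LINT x|Q. of_bool (\<forall>i\<le>d. x i \<le> a i) :: real)" .
    qed (use F_int in auto)
  qed
  have le_T: "(LINT x|P. F (T h x)) \<le> (LINT x|Q. F (T h x))" "integrable P (\<lambda>x. F (T h x))" "integrable Q (\<lambda>x. F (T h x))"
    if h: "\<And>i. i \<le> d \<Longrightarrow> mono (h i)" "\<And>i s. i \<le> d \<Longrightarrow> - b n \<le> h i s \<and> h i s \<le> b n" for h n
  proof -
    have "\<exists>V. bounded_monos d V \<and> modulus d V (\<lambda>x. F (T h x))"
      using sm(1)[of h n] h by blast
    then obtain V where V: "bounded_monos d V" "modulus d V (\<lambda>x. F (T h x))" by blast
    have "supermodular d (\<lambda>x. F (T h x))" using sm(2)[of h n] h by blast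
    moreover have "(\<lambda>x. F (T h x)) \<in> borel_measurable (vec_space d)" using T_meas[of h] h(1) by blast
    ultimately show "(LINT x|P. F (T h x)) \<le> (LINT x|Q. F (T h x))"
      "integrable P (\<lambda>x. F (T h x))" "integrable Q (\<lambda>x. F (T h x))"
      using le[OF V] modulus_integrable[OF V] by blast+
  qed
  have lec: "(LINT x|P. F (T (c n) x)) \<le> (LINT x|Q. F (T (c n) x))" for n
    using le_T(1)[of "c n" n] hmono bds by blast
  have leu: "(LINT x|P. F (T (cu n) x)) \<le> (LINT x|Q. F (T (cu n) x))"
    "integrable P (\<lambda>x. F (T (cu n) x))" "integrable Q (\<lambda>x. F (T (cu n) x))" for n
    using le_T[of "cu n" n] hmono bds by blast+
  have led: "(LINT x|P. F (T (cd n) x)) \<le> (LINT x|Q. F (T (cd n) x))"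
    "integrable P (\<lambda>x. F (T (cd n) x))" "integrable Q (\<lambda>x. F (T (cd n) x))" for n
    using le_T[of "cd n" n] hmono bds by blast+
  \<comment> \<open>Association is available only under \<open>Q\<close>; under \<open>P\<close> the
    truncated integrals are first compared with those under \<open>Q\<close>.\<close>
  have int_u: "integrable P (\<lambda>x. F (T u x))" "integrable Q (\<lambda>x. F (T u x))"
    by (rule integrable_limit_of_bounded_integrals[OF measurable_P[OF meas(2)] nonneg(1) leu(2)
          order_trans[OF leu(1) bu] tendsto(2)], simp add: space_P)
      (rule integrable_limit_of_bounded_integrals[OF measurable_Q[OF meas(2)] nonneg(1) leu(3)
          bu tendsto(2)], simp add: space_Q)
  have int_l: "integrable P (\<lambda>x. F (T l x))" "integrable Q (\<lambda>x. F (T l x))"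
    by (rule integrable_limit_of_bounded_integrals[OF measurable_P[OF meas(3)] nonneg(2) led(2)
          order_trans[OF led(1) bd] tendsto(3)], simp add: space_P)
      (rule integrable_limit_of_bounded_integrals[OF measurable_Q[OF meas(3)] nonneg(2) led(3)
          bd tendsto(3)], simp add: space_Q)
  \<comment> \<open>\<open>F\<close> at the truncated point is a sum of three parts. The upper and
    lower parts lie between 0 and their limits, the mixed part between its value at \<open>x\<close>
    and 0, so \<open>w\<close> is a majorant for all \<open>n\<close>.\<close>
  define w where "w x = \<bar>F (T u x)\<bar> + \<bar>F (T l x)\<bar> + \<bar>F x - F (T u x) - F (T l x)\<bar>" for x
  have w: "\<bar>F (T (c n) x)\<bar> \<le> w x" if x: "x \<in> vecs d" for n x
  proof -
    let ?y = "T (c n) x"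
    have y: "sup ?y a = T (cu n) x" "inf ?y a = T (cd n) x"
      using a by (auto intro!: vecs_eqI[of _ d] vecs_sup vecs_inf vecs_restrict simp: T_def c_def cu_def cd_def sup_max inf_min)
    have "F x - F (sup x a) - F (inf x a) \<le> F ?y - F (sup ?y a) - F (inf ?y a)"
      by (rule mixed_contract[OF x T]) (use ac in \<open>auto simp: T_def c_def\<close>)
    moreover have "F ?y - F (sup ?y a) - F (inf ?y a) \<le> 0" by (rule mixed_nonpos[OF T])
    moreover have "F (T (cu n) x) \<le> F (T u x)" by (rule mono_above[OF T T au(1) cu_le])
    moreover have "F (T (cd n) x) \<le> F (T l x)" by (rule antimono_below[OF T T la(1) cd_ge])
    ultimately show ?thesis
      using nonneg[of n x] unfolding w_def T_sup[OF x] T_inf[OF x] y by linarith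
  qed
  have int_w: "integrable P w" "integrable Q w"
    unfolding w_def[abs_def] using int_u int_l F_int by auto
  have "(\<lambda>n. LINT x|P. F (T (c n) x)) \<longlonglongrightarrow> (LINT x|P. F x)"
    by (rule integral_dominated_convergence[OF measurable_P[OF F_meas] measurable_P[OF meas(1)] int_w(1)])
       (use tendsto(1) w in \<open>auto simp: space_P\<close>)
  moreover have "(\<lambda>n. LINT x|Q. F (T (c n) x)) \<longlonglongrightarrow> (LINT x|Q. F x)"
    by (rule integral_dominated_convergence[OF measurable_Q[OF F_meas] measurable_Q[OF meas(1)] int_w(2)])
       (use tendsto(1) w in \<open>auto simp: space_Q\<close>)
  ultimately show ?thesis
    by (rule LIMSEQ_le) (use lec in blast)
qed

text \<open>All conditions hold for almost every \<open>a\<close> under the product law: sections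
  along one coordinate are integrable by Fubini, and almost every value of a marginal has positive
  mass on both closed half-lines. Finitely many such conditions leave a common point, since
  \<open>R\<close> is a probability measure.\<close>

lemma exists_anchor:
  fixes f :: "(nat \<Rightarrow> real) \<Rightarrow> real"
  assumes f: "integrable R f"
  shows "\<exists>a\<in>vecs d. \<forall>i\<le>d. integrable (\<mu> i) (\<lambda>s. f (a(i := s))) \<and>
    0 < measure (\<mu> i) {a i..} \<and> 0 < measure (\<mu> i) {..a i}"
proof -
  have f_m [measurable]: "f \<in> borel_measurable R" using f by simp
  have "AE a in R. integrable (\<mu> i) (\<lambda>s. f (a(i := s))) \<and> 0 < measure (\<mu> i) {a i..} \<and> 0 < measure (\<mu> i) {..a i}"
    if i: "i \<in> {0..d}" for i
  proof -
    interpret \<mu>i: prob_space "\<mu> i" by (rule prob_space_\<mu>)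
    define J where "J = {0..d} - {i}"
    have J: "finite J" "i \<notin> J" "insert i J = {0..d}" "J \<subseteq> {0..d}" using i by (auto simp: J_def)
    have "(\<integral>\<^sup>+x. ennreal \<bar>f x\<bar> \<partial>Pi\<^sub>M (insert i J) \<mu>) =
        (\<integral>\<^sup>+w. \<integral>\<^sup>+s. ennreal \<bar>f (w(i := s))\<bar> \<partial>\<mu> i \<partial>Pi\<^sub>M J \<mu>)"
      by (rule \<mu>.product_nn_integral_insert[OF J(1,2)]) (unfold J(3), measurable)
    moreover have "(\<integral>\<^sup>+x. ennreal \<bar>f x\<bar> \<partial>R) < \<infinity>"
      using f by (simp add: integrable_iff_bounded)
    ultimately have fin: "(\<integral>\<^sup>+w. \<integral>\<^sup>+s. ennreal \<bar>f (w(i := s))\<bar> \<partial>\<mu> i \<partial>Pi\<^sub>M J \<mu>) \<noteq> \<infinity>"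
      unfolding J(3) by simp
    have f_m': "f \<in> borel_measurable (Pi\<^sub>M (insert i J) \<mu>)" unfolding J(3) by (rule f_m)
    have add: "(\<lambda>(w, s). w(i := s)) \<in> measurable (Pi\<^sub>M J \<mu> \<Otimes>\<^sub>M \<mu> i) (Pi\<^sub>M (insert i J) \<mu>)"
      by (rule measurable_add_dim)
    have comp: "(\<lambda>y. f ((fst y)(i := snd y))) \<in> borel_measurable (Pi\<^sub>M J \<mu> \<Otimes>\<^sub>M \<mu> i)"
      using measurable_compose[OF add f_m'] by (simp add: case_prod_beta')
    have "(\<lambda>w. \<integral>\<^sup>+s. ennreal \<bar>f (w(i := s))\<bar> \<partial>\<mu> i) \<in> borel_measurable (Pi\<^sub>M J \<mu>)"
      by (rule sigma_finite_measure.borel_measurable_nn_integral[OF \<mu>.sigma_finite_measures]) (use comp in \<open>simp add: case_prod_beta'\<close>)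
    from nn_integral_PInf_AE[OF this fin]
    have "AE w in Pi\<^sub>M J \<mu>. integrable (\<mu> i) (\<lambda>s. f (w(i := s)))"
      using AE_space
    proof eventually_elim
      case (elim w)
      have "(\<lambda>s. f (w(i := s))) \<in> borel_measurable (\<mu> i)"
        using measurable_compose[OF measurable_Pair1'[OF elim(2)] comp] by simp
      with elim(1) show ?case by (simp add: integrable_iff_bounded top.not_eq_extremum)
    qed
    moreover have "distr R (Pi\<^sub>M J \<mu>) (\<lambda>a. restrict a J) = Pi\<^sub>M J \<mu>"
      by (rule \<mu>.distr_restrict[symmetric]) (use J(4) in auto)
    ultimately have "AE w in distr R (Pi\<^sub>M J \<mu>) (\<lambda>a. restrict a J). integrable (\<mu> i) (\<lambda>s. f (w(i := s)))"
      by (simp only:)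
    then have "AE a in R. integrable (\<mu> i) (\<lambda>s. f ((restrict a J)(i := s)))"
      by (rule AE_distrD[rotated]) (intro measurable_restrict measurable_component_singleton, use J in auto)
    then have 1: "AE a in R. integrable (\<mu> i) (\<lambda>s. f (a(i := s)))"
      using AE_space
    proof eventually_elim
      case (elim a)
      have "(restrict a J)(i := s) = a(i := s)" for s
        using elim(2) i by (auto simp: J_def fun_eq_iff space_PiM PiE_iff extensional_def)
      with elim(1) show ?case by simp
    qed
    have "AE s in distr R (\<mu> i) (\<lambda>a. a i). 0 < measure (\<mu> i) {s..} \<and> 0 < measure (\<mu> i) {..s}"
      unfolding \<mu>.PiM_component[OF i]
      using AE_measure_atLeast_pos[OF prob_space_\<mu>, of i] AE_measure_atMost_pos[OF prob_space_\<mu>, of i]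
      by simp
    then have "AE a in R. 0 < measure (\<mu> i) {a i..} \<and> 0 < measure (\<mu> i) {..a i}"
      by (rule AE_distrD[OF measurable_component_singleton[OF i]])
    with 1 show ?thesis by eventually_elim simp
  qed
  then have "AE a in R. \<forall>i\<in>{0..d}. integrable (\<mu> i) (\<lambda>s. f (a(i := s))) \<and>
      0 < measure (\<mu> i) {a i..} \<and> 0 < measure (\<mu> i) {..a i}"
    by (intro AE_finite_allI) auto
  then have "AE a in R. a \<in> vecs d \<and> (\<forall>i\<in>{0..d}. integrable (\<mu> i) (\<lambda>s. f (a(i := s))) \<and>
      0 < measure (\<mu> i) {a i..} \<and> 0 < measure (\<mu> i) {..a i})"
    using AE_space by eventually_elim (auto simp: space_PiM)
  from eventually_happens'[OF \<mu>.P.ae_filter_bot this] show ?thesis by force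
qed

text \<open>\<open>h\<close> adds up the changes of \<open>f\<close> along the axes through
  \<open>a\<close>, so \<open>f - h\<close> vanishes on them. It is modular, so \<open>f - h\<close>
  stays supermodular, and its summands depend on one coordinate each, so it has the same integral
  under \<open>P\<close> and \<open>Q\<close>.\<close>

lemma integral_le:
  assumes f_meas: "f \<in> borel_measurable (vec_space d)" and f: "supermodular d f"
    and int: "integrable P f" "integrable Q f" "integrable R f"
  shows "(LINT x|P. f x) \<le> (LINT x|Q. f x)"
proof -
  obtain a where a: "a \<in> vecs d" and ai: "\<And>i. i \<le> d \<Longrightarrow> integrable (\<mu> i) (\<lambda>s. f (a(i := s)))"
    and pos: "\<And>i. i \<le> d \<Longrightarrow> 0 < measure (\<mu> i) {a i..}" "\<And>i. i \<le> d \<Longrightarrow> 0 < measure (\<mu> i) {..a i}"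
    using exists_anchor[OF int(3)] by blast
  define h where "h x = f a + (\<Sum>i\<le>d. f (a(i := x i)) - f a)" for x
  have h_axis: "h (a(i := s)) = f (a(i := s))" if "i \<le> d" for i s
  proof -
    have "(\<Sum>j\<le>d. f (a(j := (a(i := s)) j)) - f a) = (\<Sum>j\<le>d. if j = i then f (a(i := s)) - f a else 0)"
      by (intro sum.cong) auto
    also have "\<dots> = f (a(i := s)) - f a" using that by simp
    finally show ?thesis by (simp add: h_def)
  qed
  have h_modular: "h (inf x y) + h (sup x y) = h x + h y" for x y
  proof -
    have "f (a(i := inf x y i)) - f a + (f (a(i := sup x y i)) - f a) = f (a(i := x i)) - f a + (f (a(i := y i)) - f a)" for i
      by (cases "x i \<le> y i") (auto simp: inf_min sup_max)
    then show ?thesis by (simp add: h_def sum.distrib[symmetric])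
  qed
  have coord_meas: "(\<lambda>x. f (a(i := x i))) \<in> borel_measurable (vec_space d)" if "i \<le> d" for i
  proof (rule measurable_compose[OF _ f_meas])
    have "(\<lambda>x. \<lambda>j\<in>{0..d}. if j = i then x i else a j) \<in> measurable (vec_space d) (vec_space d)"
      using measurable_coordinate by (intro measurable_restrict) auto
    also have "(\<lambda>x. \<lambda>j\<in>{0..d}. if j = i then x i else a j) = (\<lambda>x. a(i := x i))"
      using a that by (auto simp: fun_eq_iff space_PiM PiE_iff extensional_def)
    finally show "(\<lambda>x. a(i := x i)) \<in> measurable (vec_space d) (vec_space d)" .
  qed
  have coord: "integrable P (\<lambda>x. f (a(i := x i)))" "integrable Q (\<lambda>x. f (a(i := x i)))"
    "(LINT x|P. f (a(i := x i))) = (LINT x|Q. f (a(i := x i)))" if i: "i \<le> d" for i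
  proof -
    have m: "(\<lambda>s. f (a(i := s))) \<in> borel_measurable borel" using ai[OF i] by auto
    note c = measurable_P[OF measurable_coordinate[of i]] measurable_Q[OF measurable_coordinate[of i]]
    show "integrable Q (\<lambda>x. f (a(i := x i)))"
      using ai[OF i] integrable_distr_eq[OF c(2) m] by simp
    show "integrable P (\<lambda>x. f (a(i := x i)))"
      using ai[OF i] integrable_distr_eq[OF c(1) m] marginal[OF i] by simp
    show "(LINT x|P. f (a(i := x i))) = (LINT x|Q. f (a(i := x i)))"
      using integral_distr[OF c(1) m] integral_distr[OF c(2) m] marginal[OF i] by simp
  qed
  have h_int: "integrable P h" "integrable Q h" and h_eq: "(LINT x|P. h x) = (LINT x|Q. h x)"
  proof -
    show "integrable P h" "integrable Q h"
      unfolding h_def[abs_def] using coord by (auto intro!: Bochner_Integration.integrable_add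
          Bochner_Integration.integrable_sum Bochner_Integration.integrable_diff)
    have "(LINT x|P. h x) = f a + (\<Sum>i\<le>d. (LINT x|P. f (a(i := x i))) - f a)"
      unfolding h_def using coord(1) P.prob_space
      by (subst Bochner_Integration.integral_add Bochner_Integration.integral_sum;
          auto intro!: Bochner_Integration.integrable_sum Bochner_Integration.integrable_diff
            simp: Bochner_Integration.integral_sum)
    moreover have "(LINT x|Q. h x) = f a + (\<Sum>i\<le>d. (LINT x|Q. f (a(i := x i))) - f a)"
      unfolding h_def using coord(2) Q.prob_space
      by (subst Bochner_Integration.integral_add Bochner_Integration.integral_sum;
          auto intro!: Bochner_Integration.integrable_sum Bochner_Integration.integrable_diff
            simp: Bochner_Integration.integral_sum)
    ultimately show "(LINT x|P. h x) = (LINT x|Q. h x)" using coord(3) by simp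
  qed
  have "anchored d (\<lambda>x. f x - h x) a"
  proof
    show "supermodular d (\<lambda>x. f x - h x)"
      unfolding supermodular_def
    proof (intro ballI)
      fix x y assume "x \<in> vecs d" "y \<in> vecs d"
      with supermodularD[OF f, of x y] h_modular[of x y]
      show "f x - h x + (f y - h y) \<le> f (inf x y) - h (inf x y) + (f (sup x y) - h (sup x y))" by linarith
    qed
  qed (use a h_axis in auto)
  moreover have "h \<in> borel_measurable (vec_space d)"
    unfolding h_def[abs_def] using coord_meas by (intro borel_measurable_add borel_measurable_sum borel_measurable_diff) auto
  ultimately have "(LINT x|P. f x - h x) \<le> (LINT x|Q. f x - h x)"
    using f_meas int h_int pos by (intro anchored_integral_le) auto
  then show ?thesis using int h_int h_eq by simp
qed

end

section \<open>Random vectors\<close>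

locale random_vector = prob_space M for M :: "'a measure" +
  fixes d :: nat and X :: "nat \<Rightarrow> 'a \<Rightarrow> real"
  assumes X_meas: "i \<in> {0..d} \<Longrightarrow> X i \<in> borel_measurable M"
    and indep: "cond_indep M (X 0) X {1..d}"
begin

definition \<kappa> :: "nat \<Rightarrow> real set \<Rightarrow> real \<Rightarrow> real" where
  "\<kappa> i A = cond_exp_at M (indicator {\<omega> \<in> space M. X i \<omega> \<in> A}) (X 0)"

abbreviation G where "G \<equiv> sigma_gen M (X 0)"

lemma X0_meas [measurable]: "X 0 \<in> borel_measurable M"
  using X_meas by simp

sublocale G: finite_measure_subalgebra M G
proof
  show "subalgebra M G"
    unfolding subalgebra_def
    using measurable_sets[OF X0_meas] by (auto simp: sets_vimage_algebra2)
qed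

lemma X0_G: "X 0 \<in> measurable G borel"
  by (rule measurable_vimage_algebra1) auto

lemma event [measurable]:
  assumes "i \<in> {0..d}" "A \<in> sets borel"
  shows "{\<omega> \<in> space M. X i \<omega> \<in> A} \<in> sets M"
proof -
  have "X i -` A \<inter> space M \<in> sets M" by (rule measurable_sets[OF X_meas[OF assms(1)] assms(2)])
  also have "X i -` A \<inter> space M = {\<omega> \<in> space M. X i \<omega> \<in> A}" by auto
  finally show ?thesis .
qed

lemma joint_event:
  assumes "I \<subseteq> {0..d}" "\<And>i. i \<in> I \<Longrightarrow> A i \<in> sets borel"
  shows "{\<omega> \<in> space M. \<forall>i\<in>I. X i \<omega> \<in> A i} \<in> sets M"
  using assms event finite_subset[OF assms(1)] by (intro sets.sets_Collect_finite_All) auto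

lemma integrable_event: "S \<in> sets M \<Longrightarrow> integrable M (indicator S :: _ \<Rightarrow> real)"
  by (intro integrable_real_indicator) (auto simp: emeasure_eq_measure)

lemma borel_measurable_\<kappa>: "\<kappa> i A \<in> borel_measurable borel"
  unfolding \<kappa>_def by (rule cond_exp_at_version)

lemma \<kappa>_version: "AE \<omega> in M. \<kappa> i A (X 0 \<omega>) = real_cond_exp M G (indicator {\<omega> \<in> space M. X i \<omega> \<in> A}) \<omega>"
  unfolding \<kappa>_def by (rule cond_exp_at_version)

lemma AE_\<kappa>:
  assumes "AE \<omega> in M. Q (X 0 \<omega>)" "{u. Q u} \<in> sets borel"
  shows "AE u in distr M borel (X 0). Q u"
  using assms AE_distr_iff[of "X 0" M borel Q] by simp

lemma distr_law_component:
  assumes "i \<in> {0..d}" shows "distr (law d M X) borel (\<lambda>x. x i) = distr M borel (X i)"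
proof -
  have "(\<lambda>\<omega>. \<lambda>i\<in>{0..d}. X i \<omega>) \<in> measurable M (vec_space d)"
    by (intro measurable_restrict X_meas)
  then have "distr (law d M X) borel (\<lambda>x. x i) = distr M borel ((\<lambda>x. x i) \<circ> (\<lambda>\<omega>. \<lambda>i\<in>{0..d}. X i \<omega>))"
    unfolding law_def using assms by (intro distr_distr measurable_component_singleton)
  also have "(\<lambda>x. x i) \<circ> (\<lambda>\<omega>. \<lambda>i\<in>{0..d}. X i \<omega>) = X i" using assms by (auto simp: fun_eq_iff)
  finally show ?thesis .
qed

lemma law_P0: "distr (law d M X) borel (\<lambda>x. x 0) = distr M borel (X 0)"
  by (rule distr_law_component) simp

text \<open>The almost sure properties of conditional expectations are transported to the law of
  \<open>X 0\<close>. The rectangle formula is the tower property for the event in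
  \<open>X 0\<close>, combined with conditional independence of the other components.\<close>

lemma conditional_product_law: "conditional_product (law d M X) d \<kappa>"
proof -
  have vec_meas: "(\<lambda>\<omega>. \<lambda>i\<in>{0..d}. X i \<omega>) \<in> measurable M (vec_space d)"
    by (intro measurable_restrict X_meas)
  interpret L: prob_space "law d M X"
    unfolding law_def by (rule prob_space_distr[OF vec_meas])
  have sets_law: "sets (law d M X) = sets (vec_space d)" by (simp add: law_def)
  note [measurable] = borel_measurable_\<kappa>
  show ?thesis
  proof (unfold_locales, unfold law_P0)
    show "sets (law d M X) = sets (vec_space d)" by (rule sets_law)
  next
    fix i A show "\<kappa> i A \<in> borel_measurable borel" by (rule borel_measurable_\<kappa>)
  next
    fix i assume "i \<in> {1..d}"
    have "AE \<omega> in M. real_cond_exp M G (indicator {\<omega> \<in> space M. X i \<omega> \<in> UNIV}) \<omega> = real_cond_exp M G (\<lambda>_. 1) \<omega>"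
      by (rule G.real_cond_exp_cong) (auto intro!: AE_I2)
    moreover have "AE \<omega> in M. real_cond_exp M G (\<lambda>_. 1) \<omega> = (1::real)"
      by (rule G.real_cond_exp_F_meas) auto
    ultimately have "AE \<omega> in M. \<kappa> i UNIV (X 0 \<omega>) = 1"
      using \<kappa>_version[of i UNIV] by eventually_elim simp
    then show "AE u in distr M borel (X 0). \<kappa> i UNIV u = 1"
      by (rule AE_\<kappa>) measurable
  next
    fix i A assume i: "i \<in> {1..d}" and A: "A \<in> sets (borel :: real measure)"
    have "AE \<omega> in M. 0 \<le> real_cond_exp M G (indicator {\<omega> \<in> space M. X i \<omega> \<in> A}) \<omega>"
      using event[of i A] i A by (intro G.real_cond_exp_pos) auto
    then have "AE \<omega> in M. 0 \<le> \<kappa> i A (X 0 \<omega>)"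
      using \<kappa>_version[of i A] by eventually_elim simp
    then show "AE u in distr M borel (X 0). 0 \<le> \<kappa> i A u"
      by (rule AE_\<kappa>) measurable
  next
    fix i A B assume i: "i \<in> {1..d}" and AB: "A \<in> sets (borel :: real measure)" "B \<in> sets borel" "A \<inter> B = {}"
    let ?e = "\<lambda>A. {\<omega> \<in> space M. X i \<omega> \<in> A}"
    have ind: "indicator (?e (A \<union> B)) = (\<lambda>\<omega>. indicator (?e A) \<omega> + indicator (?e B) \<omega> :: real)"
      using AB(3) by (auto simp: indicator_def fun_eq_iff)
    have "AE \<omega> in M. real_cond_exp M G (indicator (?e (A \<union> B))) \<omega> =
        real_cond_exp M G (indicator (?e A)) \<omega> + real_cond_exp M G (indicator (?e B)) \<omega>"
      unfolding ind using i AB by (intro G.real_cond_exp_add integrable_event event) auto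
    then have "AE \<omega> in M. \<kappa> i (A \<union> B) (X 0 \<omega>) = \<kappa> i A (X 0 \<omega>) + \<kappa> i B (X 0 \<omega>)"
      using \<kappa>_version[of i A] \<kappa>_version[of i B] \<kappa>_version[of i "A \<union> B"] by eventually_elim simp
    then show "AE u in distr M borel (X 0). \<kappa> i (A \<union> B) u = \<kappa> i A u + \<kappa> i B u"
      by (rule AE_\<kappa>) measurable
  next
    fix S :: "nat \<Rightarrow> real set" assume S: "\<And>i. i \<in> {0..d} \<Longrightarrow> S i \<in> sets borel"
    let ?e = "{\<omega> \<in> space M. \<forall>i\<in>{1..d}. X i \<omega> \<in> S i}"
    have e: "?e \<in> sets M" by (rule joint_event) (use S in auto)
    have S0: "S 0 \<in> sets borel" using S by simp
    have rect: "{x \<in> space (law d M X). \<forall>i\<in>{0..d}. x i \<in> S i} \<in> sets (vec_space d)"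
    proof -
      have "{x \<in> space (law d M X). \<forall>i\<in>{0..d}. x i \<in> S i} = Pi\<^sub>E {0..d} S"
        unfolding sets_eq_imp_space_eq[OF sets_law] by (auto simp: space_PiM PiE_iff extensional_def)
      then show ?thesis using S by (simp add: sets_PiM_I_finite)
    qed
    have "measure (law d M X) {x \<in> space (law d M X). \<forall>i\<in>{0..d}. x i \<in> S i} =
        measure M ((\<lambda>\<omega>. \<lambda>i\<in>{0..d}. X i \<omega>) -` {x \<in> space (law d M X). \<forall>i\<in>{0..d}. x i \<in> S i} \<inter> space M)"
      using rect measure_distr[OF vec_meas rect] unfolding law_def by simp
    also have "(\<lambda>\<omega>. \<lambda>i\<in>{0..d}. X i \<omega>) -` {x \<in> space (law d M X). \<forall>i\<in>{0..d}. x i \<in> S i} \<inter> space M =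
        {\<omega> \<in> space M. X 0 \<omega> \<in> S 0} \<inter> ?e" (is "_ = ?J")
    proof -
      have "{0..d} = insert 0 {1..d}" by auto
      then show ?thesis unfolding sets_eq_imp_space_eq[OF sets_law] by (auto simp: space_PiM)
    qed
    also have "measure M ?J = (LINT \<omega>|M. indicator ?J \<omega>)"
      using e event[of 0 "S 0"] S0 by (simp add: Int_absorb2 sets.sets_into_space)
    also have "\<dots> = (LINT \<omega>|M. indicator (S 0) (X 0 \<omega>) * indicator ?e \<omega>)"
      by (intro Bochner_Integration.integral_cong) (auto simp: indicator_def)
    also have "\<dots> = (LINT \<omega>|M. indicator (S 0) (X 0 \<omega>) * real_cond_exp M G (indicator ?e) \<omega>)"
    proof (rule G.real_cond_exp_intg(2)[symmetric])
      show "(\<lambda>\<omega>. indicator (S 0) (X 0 \<omega>) :: real) \<in> borel_measurable G"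
        by (rule measurable_compose[OF X0_G]) (use S0 in simp)
      show "(indicator ?e :: _ \<Rightarrow> real) \<in> borel_measurable M" using e by simp
      show "integrable M (\<lambda>\<omega>. indicator (S 0) (X 0 \<omega>) * indicator ?e \<omega> :: real)"
      proof (rule integrable_const_bound[where B = 1])
        have "(\<lambda>\<omega>. indicator (S 0) (X 0 \<omega>) :: real) \<in> borel_measurable M"
          by (rule measurable_compose[OF X0_meas]) (use S0 in simp)
        then show "(\<lambda>\<omega>. indicator (S 0) (X 0 \<omega>) * indicator ?e \<omega> :: real) \<in> borel_measurable M"
          using e by simp
      qed (auto simp: indicator_def)
    qed
    also have "\<dots> = (LINT \<omega>|M. indicator (S 0) (X 0 \<omega>) * (\<Prod>i\<in>{1..d}. \<kappa> i (S i) (X 0 \<omega>)))"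
    proof (rule integral_cong_AE)
      have "AE \<omega> in M. real_cond_exp M G (indicator ?e) \<omega> =
          (\<Prod>i\<in>{1..d}. real_cond_exp M G (indicator {\<omega> \<in> space M. X i \<omega> \<in> S i}) \<omega>)"
        using indep S unfolding cond_indep_def by auto
      moreover have "AE \<omega> in M. \<forall>i\<in>{1..d}. \<kappa> i (S i) (X 0 \<omega>) = real_cond_exp M G (indicator {\<omega> \<in> space M. X i \<omega> \<in> S i}) \<omega>"
        by (intro AE_finite_allI \<kappa>_version) simp
      ultimately show "AE \<omega> in M. indicator (S 0) (X 0 \<omega>) * real_cond_exp M G (indicator ?e) \<omega> =
          indicator (S 0) (X 0 \<omega>) * (\<Prod>i\<in>{1..d}. \<kappa> i (S i) (X 0 \<omega>))"
        by eventually_elim simp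
      have ind: "(\<lambda>\<omega>. indicator (S 0) (X 0 \<omega>) :: real) \<in> borel_measurable M"
        by (rule measurable_compose[OF X0_meas]) (use S0 in simp)
      show "(\<lambda>\<omega>. indicator (S 0) (X 0 \<omega>) * real_cond_exp M G (indicator ?e) \<omega>) \<in> borel_measurable M"
        using ind by (intro borel_measurable_times borel_measurable_cond_exp2)
      show "(\<lambda>\<omega>. indicator (S 0) (X 0 \<omega>) * (\<Prod>i\<in>{1..d}. \<kappa> i (S i) (X 0 \<omega>))) \<in> borel_measurable M"
        using ind by (intro borel_measurable_times borel_measurable_prod measurable_compose[OF X0_meas borel_measurable_\<kappa>])
    qed
    also have "\<dots> = (LINT u|distr M borel (X 0). indicator (S 0) u * (\<Prod>i\<in>{1..d}. \<kappa> i (S i) u))"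
      using S0 by (intro integral_distr[symmetric] X0_meas borel_measurable_times borel_measurable_prod
          borel_measurable_\<kappa> borel_measurable_indicator)
    finally show "measure (law d M X) {x \<in> space (law d M X). \<forall>i\<in>{0..d}. x i \<in> S i} =
        (LINT u|distr M borel (X 0). indicator (S 0) u * (\<Prod>i\<in>{1..d}. \<kappa> i (S i) u))" .
  qed
qed

sublocale L: conditional_product "law d M X" d \<kappa>
  by (rule conditional_product_law)

lemma q_eq_quantile: "L.q = quantile M (X 0)"
  by (simp add: L.q_def[abs_def] quantile_def[abs_def] law_P0)

lemma \<kappa>_eq_cond_cdf: "\<kappa> i {..c} = cond_cdf M (X i) (X 0) c"
  by (simp add: \<kappa>_def cond_cdf_def)

text \<open>The definition is applied to the increasing function \<open>- indicator {..c}\<close>.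
  Its chosen version need not be the negative of \<open>\<kappa> i {..c}\<close> everywhere, so the
  null set where they differ is removed together with \<open>N\<close>; the rest is pulled back by
  the increasing quantile function.\<close>

lemma stochastic_increase:
  assumes st: "st_increasing M (X i) (X 0)" and i: "i \<in> {1..d}"
  shows "\<exists>A. (AE t in U01. t \<in> A) \<and> antimono_on (A \<inter> {0<..<1}) (\<lambda>t. \<kappa> i {..c} (L.q t))"
proof -
  define f :: "real \<Rightarrow> real" where "f y = - indicator {..c} y" for y
  let ?e = "{\<omega> \<in> space M. X i \<omega> \<in> {..c}}"
  have e: "?e \<in> sets M" using i by (intro event) auto
  have f_eq: "f (X i \<omega>) = - indicator ?e \<omega>" if "\<omega> \<in> space M" for \<omega>
    using that by (simp add: f_def indicator_def)
  have "mono f" by (auto simp: f_def mono_def indicator_def)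
  have f_meas: "(\<lambda>\<omega>. f (X i \<omega>)) \<in> borel_measurable M"
    unfolding f_def using X_meas[of i] i by (intro borel_measurable_uminus measurable_compose[OF X_meas]) auto
  have "integrable M (\<lambda>\<omega>. f (X i \<omega>))"
    using f_meas by (intro integrable_const_bound[where B = 1]) (auto simp: f_def indicator_def)
  with st \<open>mono f\<close> obtain N where N: "N \<in> null_sets (distr M borel (X 0))"
    "mono_on (- N) (cond_exp_at M (\<lambda>\<omega>. f (X i \<omega>)) (X 0))"
    unfolding st_increasing_def by blast
  let ?g = "cond_exp_at M (\<lambda>\<omega>. f (X i \<omega>)) (X 0)"
  have "AE \<omega> in M. real_cond_exp M G (\<lambda>\<omega>. f (X i \<omega>)) \<omega> = real_cond_exp M G (\<lambda>\<omega>. (- 1) * indicator ?e \<omega>) \<omega>"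
    using f_meas e f_eq by (intro G.real_cond_exp_cong AE_I2) auto
  moreover have "AE \<omega> in M. real_cond_exp M G (\<lambda>\<omega>. (- 1) * indicator ?e \<omega>) \<omega> = (- 1) * real_cond_exp M G (indicator ?e) \<omega>"
    by (rule G.real_cond_exp_cmult) (rule integrable_event[OF e])
  ultimately have "AE \<omega> in M. ?g (X 0 \<omega>) = - \<kappa> i {..c} (X 0 \<omega>)"
    using cond_exp_at_version(2)[of M "\<lambda>\<omega>. f (X i \<omega>)" "X 0"] \<kappa>_version[of i "{..c}"]
    by eventually_elim simp
  then have "AE u in distr M borel (X 0). ?g u = - \<kappa> i {..c} u"
  proof (rule AE_\<kappa>)
    note [measurable] = cond_exp_at_version(1)[of M "\<lambda>\<omega>. f (X i \<omega>)" "X 0"] borel_measurable_\<kappa>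
    show "{u. ?g u = - \<kappa> i {..c} u} \<in> sets borel" by measurable
  qed
  moreover have "AE u in distr M borel (X 0). u \<notin> N" using N(1) by (rule AE_not_in)
  ultimately have "AE u in L.P0. u \<notin> N \<and> ?g u = - \<kappa> i {..c} u"
    unfolding law_P0 by eventually_elim simp
  then have ae: "AE t in U01. L.q t \<notin> N \<and> ?g (L.q t) = - \<kappa> i {..c} (L.q t)"
    by (rule L.AE_q)
  let ?A = "{t. L.q t \<notin> N \<and> ?g (L.q t) = - \<kappa> i {..c} (L.q t)}"
  have "antimono_on (?A \<inter> {0<..<1}) (\<lambda>t. \<kappa> i {..c} (L.q t))"
  proof (rule monotone_onI)
    fix s t assume st: "s \<in> ?A \<inter> {0<..<1}" "t \<in> ?A \<inter> {0<..<1}" "s \<le> t"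
    then have "L.q s \<le> L.q t" by (intro mono_onD[OF L.mono_q]) auto
    then have "?g (L.q s) \<le> ?g (L.q t)" using st by (intro mono_onD[OF N(2)]) auto
    with st show "\<kappa> i {..c} (L.q t) \<le> \<kappa> i {..c} (L.q s)" by auto
  qed
  with ae show ?thesis by (intro exI[of _ ?A]) auto
qed

end

section \<open>The product of the marginals as a conditional product law\<close>

context conditional_product begin

lemma \<kappa>_bounds_q:
  assumes i: "i \<in> {1..d}" and A: "A \<in> sets borel"
  shows "AE t in U01. 0 \<le> \<kappa> i A (q t) \<and> \<kappa> i A (q t) \<le> 1"
proof -
  have "AE u in P0. \<kappa> i (A \<union> - A) u = \<kappa> i A u + \<kappa> i (- A) u"
    by (rule \<kappa>_add) (use i A in auto)
  moreover have "AE u in P0. 0 \<le> \<kappa> i A u" "AE u in P0. 0 \<le> \<kappa> i (- A) u"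
    using i A by (auto intro!: \<kappa>_nonneg)
  ultimately have "AE u in P0. 0 \<le> \<kappa> i A u \<and> \<kappa> i A u \<le> 1"
    using \<kappa>_UNIV[OF i] by eventually_elim simp
  then show ?thesis by (rule AE_q)
qed

lemma measurable_\<kappa>_q: "i \<in> {1..d} \<Longrightarrow> A \<in> sets borel \<Longrightarrow> (\<lambda>t. \<kappa> i A (q t)) \<in> borel_measurable U01"
  by (rule measurable_compose[OF measurable_q \<kappa>_meas])

lemma integral_\<kappa>_q:
  assumes i: "i \<in> {1..d}" and A: "A \<in> sets borel"
  shows "(LINT t|U01. \<kappa> i A (q t)) = measure (distr P borel (\<lambda>x. x i)) A"
proof -
  define S where "S = (\<lambda>j. if j = i then A else UNIV)"
  have "(LINT t|U01. \<kappa> i A (q t)) = (LINT u|P0. \<kappa> i A u)"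
    by (rule integral_q[symmetric, OF \<kappa>_meas[OF i A]])
  also have "\<dots> = (LINT u|P0. indicator (S 0) u * (\<Prod>j\<in>{1..d}. \<kappa> j (S j) u))"
  proof (rule integral_cong_AE)
    show "\<kappa> i A \<in> borel_measurable P0" using \<kappa>_meas[OF i A] by simp
    show "(\<lambda>u. indicator (S 0) u * (\<Prod>j\<in>{1..d}. \<kappa> j (S j) u)) \<in> borel_measurable P0"
      using \<kappa>_meas A by (intro borel_measurable_times borel_measurable_prod) (auto simp: S_def)
    have "AE u in P0. \<forall>j\<in>{1..d}. \<kappa> j UNIV u = 1"
      by (intro AE_finite_allI \<kappa>_UNIV) auto
    then show "AE u in P0. \<kappa> i A u = indicator (S 0) u * (\<Prod>j\<in>{1..d}. \<kappa> j (S j) u)"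
    proof eventually_elim
      case (elim u)
      have "(\<Prod>j\<in>{1..d}. \<kappa> j (S j) u) = \<kappa> i (S i) u * (\<Prod>j\<in>{1..d} - {i}. \<kappa> j (S j) u)"
        using i by (subst prod.remove[of _ i]) auto
      also have "(\<Prod>j\<in>{1..d} - {i}. \<kappa> j (S j) u) = 1"
        using elim by (intro prod.neutral) (auto simp: S_def)
      finally show ?case using i by (simp add: S_def)
    qed
  qed
  also have "\<dots> = measure P {x \<in> space P. \<forall>j\<in>{0..d}. x j \<in> S j}"
    by (rule measure_rectangle[symmetric]) (use A in \<open>auto simp: S_def\<close>)
  also have "{x \<in> space P. \<forall>j\<in>{0..d}. x j \<in> S j} = (\<lambda>x. x i) -` A \<inter> space P"
    using i by (auto simp: S_def)
  also have "measure P \<dots> = measure (distr P borel (\<lambda>x. x i)) A"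
    using A i by (intro measure_distr[symmetric] measurable_component) auto
  finally show ?thesis .
qed

text \<open>Constants are Schur-minimal for a given integral. Here this is
  \<open>x * s \<le> min x s\<close> for \<open>x\<close> and \<open>s\<close> in [0, 1], integrated
  over the superlevel measures; the constant gives equality, since its superlevel measure is 0 or
  1.\<close>

lemma superlevel_le_const:
  assumes g: "g \<in> borel_measurable U01" and g01: "AE t in U01. 0 \<le> g t \<and> g t \<le> 1"
    and c: "(LINT t|U01. g t) = c"
  shows "superlevel_le (\<lambda>_. c) g"
proof -
  interpret U: prob_space U01 by (rule prob_space_unit_interval)
  have c01: "0 \<le> c" "c \<le> 1"
  proof -
    have int: "integrable U01 g" using g g01 by (intro U.integrable_const_bound[where B = 1]) auto
    show "0 \<le> c" unfolding c[symmetric] using g01 by (intro integral_nonneg_AE) auto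
    have "(LINT t|U01. g t) \<le> (LINT t|U01. 1)"
      using int g01 by (intro integral_mono_AE) auto
    then show "c \<le> 1" using c U.prob_space by simp
  qed
  have sl: "superlevel_measure (\<lambda>_. c) u = of_bool (u \<le> c)" for u
  proof -
    have "{t \<in> {0<..<1}. u \<le> c} = (if u \<le> c then space U01 else {})" by auto
    then show ?thesis unfolding superlevel_measure_def using U.prob_space by (simp only:) simp
  qed
  have sg: "(LINT u|U01. superlevel_measure g u) = c"
  proof -
    have meas: "(\<lambda>(t, u). of_bool (u \<le> g t) :: real) \<in> borel_measurable (U01 \<Otimes>\<^sub>M U01)"
    proof -
      note [measurable] = g
      have "Measurable.pred (U01 \<Otimes>\<^sub>M U01) (\<lambda>y. snd y \<le> g (fst y))" by measurable
      from measurable_compose[OF this, of of_bool borel] show ?thesis by (simp add: case_prod_beta')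
    qed
    have "(LINT u|U01. superlevel_measure g u) = (LINT u|U01. LINT t|U01. of_bool (u \<le> g t))"
    proof (rule Bochner_Integration.integral_cong[OF refl])
      fix u
      have "(LINT t|U01. of_bool (u \<le> g t) :: real) = (LINT t|U01. indicator {t \<in> {0<..<1}. u \<le> g t} t)"
        by (intro Bochner_Integration.integral_cong) (auto simp: indicator_def)
      also have "\<dots> = measure U01 ({t \<in> {0<..<1}. u \<le> g t} \<inter> space U01)"
        by (simp del: space_unit_interval)
      also have "{t \<in> {0<..<1}. u \<le> g t} \<inter> space U01 = {t \<in> {0<..<1}. u \<le> g t}" by auto
      finally show "superlevel_measure g u = (LINT t|U01. of_bool (u \<le> g t))"
        by (simp add: superlevel_measure_def)
    qed
    also have "\<dots> = (LINT t|U01. LINT u|U01. of_bool (u \<le> g t))"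
      by (rule integral_unit_interval_swap[OF meas, where C = 1]) simp
    also have "\<dots> = (LINT t|U01. g t)"
    proof (rule integral_cong_AE)
      show "(\<lambda>t. LINT u|U01. of_bool (u \<le> g t) :: real) \<in> borel_measurable U01"
        using meas by (rule U.borel_measurable_lebesgue_integral)
      show "AE t in U01. (LINT u|U01. of_bool (u \<le> g t)) = g t"
        using g01 by eventually_elim (simp add: integral_of_bool_le)
    qed (rule g)
    finally show ?thesis using c by simp
  qed
  have m_sg [measurable]: "superlevel_measure g \<in> borel_measurable U01"
    using borel_measurable_superlevel_measure[OF g] by (rule measurable_compose[OF measurable_unit_interval_id])
  show ?thesis
    unfolding superlevel_le_def sl sg
  proof (intro conjI ballI)
    fix x :: real assume x: "x \<in> {0<..<1}"
    have "(LINT u|U01. min x (of_bool (u \<le> c))) = (LINT u|U01. x * of_bool (u \<le> c))"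
      using x by (intro Bochner_Integration.integral_cong) auto
    also have "\<dots> = x * c" using c01 by (simp add: integral_of_bool_le)
    also have "\<dots> = (LINT u|U01. x * superlevel_measure g u)" by (simp add: sg)
    also have "\<dots> \<le> (LINT u|U01. min x (superlevel_measure g u))"
    proof (rule integral_mono)
      have b: "\<bar>superlevel_measure g u\<bar> \<le> 1" for u using superlevel_measure_bounds[of g u] by simp
      have "integrable U01 (superlevel_measure g)"
        using b by (intro integrable_bounded_unit_interval[where C = 1] m_sg)
      then show "integrable U01 (\<lambda>u. x * superlevel_measure g u)" by simp
      show "integrable U01 (\<lambda>u. min x (superlevel_measure g u))"
      proof (rule integrable_bounded_unit_interval[where C = 1])
        show "(\<lambda>u. min x (superlevel_measure g u)) \<in> borel_measurable U01" by measurable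
        show "\<bar>min x (superlevel_measure g u)\<bar> \<le> 1" for u
          using x superlevel_measure_bounds[of g u] by (auto simp: min_def)
      qed
      show "x * superlevel_measure g u \<le> min x (superlevel_measure g u)" for u
        using x superlevel_measure_bounds[of g u] by (auto simp: mult_left_le mult_left_le_one_le)
    qed
    finally show "(LINT u|U01. min x (of_bool (u \<le> c))) \<le> (LINT u|U01. min x (superlevel_measure g u))" .
  qed (use c01 in \<open>simp add: integral_of_bool_le\<close>)
qed

lemma \<mu>_prob: "i \<in> {0..d} \<Longrightarrow> prob_space (distr P borel (\<lambda>x. x i))"
  by (rule prob_space_distr) measurable

lemma conditional_product_indep:
  defines "R \<equiv> \<Pi>\<^sub>M i\<in>{0..d}. distr P borel (\<lambda>x. x i)"
  shows "conditional_product R d (\<lambda>i A _. measure (distr P borel (\<lambda>x. x i)) A)"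
    and "i \<in> {0..d} \<Longrightarrow> distr R borel (\<lambda>x. x i) = distr P borel (\<lambda>x. x i)"
proof -
  \<comment> \<open>The product locale asks for a probability measure at every index, hence a point
    mass outside \<open>{0..d}\<close>.\<close>
  let ?\<nu> = "\<lambda>i. if i \<in> {0..d} then distr P borel (\<lambda>x. x i) else return borel 0"
  have \<nu>: "prob_space (?\<nu> i)" for i
    using \<mu>_prob[of i] by (auto intro: prob_space_return)
  interpret \<nu>: product_prob_space ?\<nu> "{0..d}"
  proof -
    interpret comp: prob_space "?\<nu> i" for i by (rule \<nu>)
    show "product_prob_space ?\<nu>" by standard
  qed
  interpret \<nu>: finite_product_prob_space ?\<nu> "{0..d}" by standard simp
  have R: "R = (\<Pi>\<^sub>M i\<in>{0..d}. ?\<nu> i)" unfolding R_def by (rule PiM_cong) auto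
  interpret R: prob_space R unfolding R by (rule \<nu>.P.prob_space_axioms)
  have comp: "distr R borel (\<lambda>x. x i) = distr P borel (\<lambda>x. x i)" if "i \<in> {0..d}" for i
  proof -
    have "distr R (?\<nu> i) (\<lambda>x. x i) = ?\<nu> i" unfolding R by (rule \<nu>.PiM_component[OF that])
    moreover have "distr R (?\<nu> i) (\<lambda>x. x i) = distr R borel (\<lambda>x. x i)"
      using that by (intro distr_cong) auto
    ultimately show ?thesis using that by simp
  qed
  then show "i \<in> {0..d} \<Longrightarrow> distr R borel (\<lambda>x. x i) = distr P borel (\<lambda>x. x i)" .
  have sets_R: "sets R = sets (vec_space d)" unfolding R_def by (rule sets_PiM_cong) auto
  note comp0 = comp[of 0, simplified]
  show "conditional_product R d (\<lambda>i A _. measure (distr P borel (\<lambda>x. x i)) A)"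
  proof (unfold_locales, unfold comp0)
    fix i assume i: "i \<in> {1..d}"
    interpret \<mu>: prob_space "distr P borel (\<lambda>x. x i)" using \<mu>_prob[of i] i by simp
    show "AE u in P0. measure (distr P borel (\<lambda>x. x i)) UNIV = 1"
      using \<mu>.prob_space by simp
  next
    fix i A B assume i: "i \<in> {1..d}" and AB: "A \<in> sets (borel :: real measure)" "B \<in> sets borel" "A \<inter> B = {}"
    interpret \<mu>: prob_space "distr P borel (\<lambda>x. x i)" using \<mu>_prob[of i] i by simp
    show "AE u in P0. measure (distr P borel (\<lambda>x. x i)) (A \<union> B) =
        measure (distr P borel (\<lambda>x. x i)) A + measure (distr P borel (\<lambda>x. x i)) B"
      using \<mu>.finite_measure_Union[of A B] AB by simp
  next
    fix S :: "nat \<Rightarrow> real set" assume S: "\<And>i. i \<in> {0..d} \<Longrightarrow> S i \<in> sets borel"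
    have "{x \<in> space R. \<forall>i\<in>{0..d}. x i \<in> S i} = Pi\<^sub>E {0..d} S"
      unfolding sets_eq_imp_space_eq[OF sets_R] by (auto simp: space_PiM PiE_iff extensional_def)
    then have "measure R {x \<in> space R. \<forall>i\<in>{0..d}. x i \<in> S i} = (\<Prod>i\<in>{0..d}. measure (?\<nu> i) (S i))"
      unfolding R using S by (subst \<nu>.prob_times[symmetric]) auto
    also have "\<dots> = measure P0 (S 0) * (\<Prod>i\<in>{1..d}. measure (distr P borel (\<lambda>x. x i)) (S i))"
    proof -
      have "{0..d} = insert 0 {1..d}" by auto
      then have "(\<Prod>i\<in>{0..d}. measure (?\<nu> i) (S i)) = measure (?\<nu> 0) (S 0) * (\<Prod>i\<in>{1..d}. measure (?\<nu> i) (S i))"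
        by simp
      also have "(\<Prod>i\<in>{1..d}. measure (?\<nu> i) (S i)) = (\<Prod>i\<in>{1..d}. measure (distr P borel (\<lambda>x. x i)) (S i))"
        by (rule prod.cong) auto
      finally show ?thesis by simp
    qed
    also have "measure P0 (S 0) = (LINT u|P0. indicator (S 0) u)" using S[of 0] by simp
    also have "(LINT u|P0. indicator (S 0) u) * (\<Prod>i\<in>{1..d}. measure (distr P borel (\<lambda>x. x i)) (S i)) =
        (LINT u|P0. indicator (S 0) u * (\<Prod>i\<in>{1..d}. measure (distr P borel (\<lambda>x. x i)) (S i)))"
      by simp
    finally show "measure R {x \<in> space R. \<forall>i\<in>{0..d}. x i \<in> S i} =
        (LINT u|P0. indicator (S 0) u * (\<Prod>i\<in>{1..d}. measure (distr P borel (\<lambda>x. x i)) (S i)))" .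
  qed (use sets_R in auto)
qed

text \<open>Each kernel of \<open>P\<close> averages to the corresponding marginal, which is the
  constant kernel of the product law, so \<open>superlevel_le_const\<close> supplies the Schur
  condition.\<close>

lemma ordered_pair_indep:
  assumes st: "\<And>i c. i \<in> {1..d} \<Longrightarrow>
      \<exists>A. (AE t in U01. t \<in> A) \<and> antimono_on (A \<inter> {0<..<1}) (\<lambda>t. \<kappa> i {..c} (q t))"
  shows "ordered_pair (\<Pi>\<^sub>M i\<in>{0..d}. distr P borel (\<lambda>x. x i)) P d
    (\<lambda>i A _. measure (distr P borel (\<lambda>x. x i)) A) \<kappa>"
proof -
  interpret R: conditional_product "\<Pi>\<^sub>M i\<in>{0..d}. distr P borel (\<lambda>x. x i)" d
    "\<lambda>i A _. measure (distr P borel (\<lambda>x. x i)) A"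
    by (rule conditional_product_indep(1))
  have R0: "R.P0 = P0" by (rule conditional_product_indep(2)) simp
  then have q: "R.q = q" by (simp add: R.q_def[abs_def] q_def[abs_def])
  show ?thesis
  proof (unfold_locales, unfold q)
    show "R.P0 = P0" by (rule R0)
    fix i c assume i: "i \<in> {1..d}"
    show "superlevel_le (\<lambda>t. measure (distr P borel (\<lambda>x. x i)) {..c}) (\<lambda>t. \<kappa> i {..c} (q t))"
      using i by (intro superlevel_le_const measurable_\<kappa>_q \<kappa>_bounds_q integral_\<kappa>_q) auto
  qed (rule st)
qed

end

section \<open>From ordered pairs to the supermodular order\<close>

lemma sm_comparison_ordered_pair:
  assumes PQ: "ordered_pair P Q d \<kappa> \<kappa>'"
    and marg: "\<And>i. i \<le> d \<Longrightarrow> distr P borel (\<lambda>x. x i) = distr Q borel (\<lambda>x. x i)"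
  shows "sm_comparison P Q d"
proof -
  interpret PQ: ordered_pair P Q d \<kappa> \<kappa>' by (rule PQ)
  \<comment> \<open>This second instance provides \<open>indep_le\<close>, also when
    \<open>P\<close> is the law of \<open>X\<close>.\<close>
  interpret RQ: ordered_pair "\<Pi>\<^sub>M i\<in>{0..d}. distr Q borel (\<lambda>x. x i)" Q d
    "\<lambda>i A _. measure (distr Q borel (\<lambda>x. x i)) A" \<kappa>'
    by (rule PQ.Q.ordered_pair_indep) (use PQ.stoch_incr PQ.q_eq in simp)
  show ?thesis
    by unfold_locales
      (use PQ.P.sets_P PQ.Q.sets_P marg PQ.modulus_supermodular_le RQ.modulus_supermodular_le
         PQ.modulus_association in auto)
qed

lemma weight_bounded_integrable:
  assumes b: "weight_function d b" "integrable P b" and P: "sets P = sets (vec_space d)"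
    and f: "f \<in> borel_measurable (vec_space d)" "weight_bounded d b f"
  shows "integrable P f"
proof -
  obtain C where C: "\<And>x. x \<in> vecs d \<Longrightarrow> \<bar>f x\<bar> / b x \<le> C"
    using f(2) by (auto simp: weight_bounded_def bdd_above_def)
  show ?thesis
  proof (rule Bochner_Integration.integrable_bound)
    show "integrable P (\<lambda>x. C * b x)" using b(2) by simp
    show "f \<in> borel_measurable P" using f(1) measurable_cong_sets[OF P refl] by auto
    show "AE x in P. norm (f x) \<le> norm (C * b x)"
    proof (rule AE_I2)
      fix x assume "x \<in> space P"
      then have x: "x \<in> vecs d" using sets_eq_imp_space_eq[OF P] by simp
      then have "1 \<le> b x" using b(1) by (auto simp: weight_function_def)
      with C[OF x] have "\<bar>f x\<bar> \<le> C * b x" by (simp add: divide_le_eq)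
      then show "norm (f x) \<le> norm (C * b x)" by simp
    qed
  qed
qed

lemma sm_le_of_comparison:
  assumes PQ: "sm_comparison P Q d" and b: "weight_function d b" "integrable P b" "integrable Q b"
    "integrable (\<Pi>\<^sub>M i\<in>{0..d}. distr Q borel (\<lambda>x. x i)) b"
  shows "sm_le d b P Q"
proof -
  interpret sm_comparison P Q d by (rule PQ)
  have "sets R = sets (vec_space d)" by (rule sets_PiM_cong) auto
  then show ?thesis
    unfolding sm_le_def using b sets_P sets_Q
    by (auto intro!: integral_le intro: weight_bounded_integrable)
qed

theorem proposition4p2:
  fixes d :: nat
    and M :: "'a measure" and N :: "'b measure"
    and X :: "nat \<Rightarrow> 'a \<Rightarrow> real" and Y :: "nat \<Rightarrow> 'b \<Rightarrow> real"
    and b :: "(nat \<Rightarrow> real) \<Rightarrow> real"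
  assumes "prob_space M" and "prob_space N"
    and "\<And>i. i \<in> {0..d} \<Longrightarrow> X i \<in> borel_measurable M"
    and "\<And>i. i \<in> {0..d} \<Longrightarrow> Y i \<in> borel_measurable N"
    and "weight_function d b"
    and "integrable (law d M X) b"
    and "integrable (law d N Y) b"
    and "integrable (indep_law d N Y) b"
    and "cond_indep M (X 0) X {1..d}"
    and "cond_indep N (Y 0) Y {1..d}"
    and "distr M borel (X 0) = distr N borel (Y 0)"
    and "\<And>i. i \<in> {1..d} \<Longrightarrow> st_increasing N (Y i) (Y 0)"
    and "\<And>i. i \<in> {1..d} \<Longrightarrow> cond_schur_le M (X i) (X 0) N (Y i) (Y 0)"
  shows "sm_le d b (law d M X) (law d N Y) \<and> PSMD d b N Y"
proof -
  interpret X: random_vector M d X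
    using assms(1,3,9) by (simp add: random_vector_def random_vector_axioms_def)
  interpret Y: random_vector N d Y
    using assms(2,4,10) by (simp add: random_vector_def random_vector_axioms_def)
  let ?P = "law d M X" and ?Q = "law d N Y"
  have qX: "X.L.q = quantile M (X 0)" and qY: "Y.L.q = quantile N (Y 0)"
    by (rule X.q_eq_quantile Y.q_eq_quantile)+
  have q: "quantile M (X 0) = quantile N (Y 0)"
    by (simp add: quantile_def[abs_def] assms(11))
  have stoch: "\<exists>A. (AE t in U01. t \<in> A) \<and> antimono_on (A \<inter> {0<..<1}) (\<lambda>t. Y.\<kappa> i {..c} (Y.L.q t))"
    if "i \<in> {1..d}" for i c
    using Y.stochastic_increase[OF assms(12)[OF that] that] .
  have marg: "distr ?P borel (\<lambda>x. x i) = distr ?Q borel (\<lambda>x. x i)" if "i \<le> d" for i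
    using assms(11) assms(13)[of i] that X.distr_law_component[of i] Y.distr_law_component[of i]
    by (cases "i = 0") (auto simp: cond_schur_le_def)
  have PQ: "ordered_pair ?P ?Q d X.\<kappa> Y.\<kappa>"
  proof
    show "X.L.P0 = Y.L.P0" using marg[of 0] by simp
  next
    fix i c assume i: "i \<in> {1..d}"
    show "superlevel_le (\<lambda>t. X.\<kappa> i {..c} (X.L.q t)) (\<lambda>t. Y.\<kappa> i {..c} (X.L.q t))"
    proof (rule schur_le_imp_superlevel_le)
      show "schur_le (\<lambda>t. X.\<kappa> i {..c} (X.L.q t)) (\<lambda>t. Y.\<kappa> i {..c} (X.L.q t))"
        using assms(13)[OF i]
        by (simp add: cond_schur_le_def X.\<kappa>_eq_cond_cdf Y.\<kappa>_eq_cond_cdf qX q)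
      show "(\<lambda>t. X.\<kappa> i {..c} (X.L.q t)) \<in> borel_measurable U01"
        using i by (intro X.L.measurable_\<kappa>_q) auto
      show "AE t in U01. 0 \<le> X.\<kappa> i {..c} (X.L.q t) \<and> X.\<kappa> i {..c} (X.L.q t) \<le> 1"
        using i by (intro X.L.\<kappa>_bounds_q) auto
      show "(\<lambda>t. Y.\<kappa> i {..c} (X.L.q t)) \<in> borel_measurable U01"
        unfolding qX q qY[symmetric] using i by (intro Y.L.measurable_\<kappa>_q) auto
      show "AE t in U01. 0 \<le> Y.\<kappa> i {..c} (X.L.q t) \<and> Y.\<kappa> i {..c} (X.L.q t) \<le> 1"
        unfolding qX q qY[symmetric] using i by (intro Y.L.\<kappa>_bounds_q) auto
    qed
    show "\<exists>A. (AE t in U01. t \<in> A) \<and> antimono_on (A \<inter> {0<..<1}) (\<lambda>t. Y.\<kappa> i {..c} (X.L.q t))"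
      unfolding qX q qY[symmetric] by (rule stoch[OF i])
  qed
  let ?R = "\<Pi>\<^sub>M i\<in>{0..d}. distr ?Q borel (\<lambda>x. x i)"
  have R: "indep_law d N Y = ?R"
    unfolding indep_law_def by (rule PiM_cong) (simp_all add: Y.distr_law_component)
  \<comment> \<open>PSMD is the same comparison with the product of the marginals in the role of the
    law of \<open>X\<close>.\<close>
  have RQ: "ordered_pair ?R ?Q d (\<lambda>i A _. measure (distr ?Q borel (\<lambda>x. x i)) A) Y.\<kappa>"
    by (rule Y.L.ordered_pair_indep[OF stoch])
  have "sm_le d b ?P ?Q"
    by (rule sm_le_of_comparison[OF sm_comparison_ordered_pair[OF PQ marg]])
      (use assms(5-8) R in auto)
  moreover have "sm_le d b ?R ?Q"
  proof (rule sm_le_of_comparison[OF sm_comparison_ordered_pair[OF RQ]])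
    show "distr ?R borel (\<lambda>x. x i) = distr ?Q borel (\<lambda>x. x i)" if "i \<le> d" for i
      using that by (intro Y.L.conditional_product_indep(2)) simp
  qed (use assms(5-8) R in auto)
  ultimately show ?thesis by (simp add: PSMD_def R)
qed

end
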